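(* For any $1\le a<b\le n$, the assignments $$T'_1\mapsto(T_aT_{a+1}\cdots T_{b-1}T_bT_{b-1}\cdots T_a)(T_{a-2}T_{a-4}\cdots)(T_{b+2}T_{b+4}\cdots),\qquad T'_2\mapsto(T_{a-1}T_{a-3}\cdots)(T_{b+1}T_{b+3}\cdots)$$ define a parabolic homomorphism $\mathrm{Br}^+(I_2(2m))\to\mathrm{Br}^+(A_n)$, where $m=n-b+1+(1-\delta_{a+b,n+1})\,a$. Here the products $T_{a-2}T_{a-4}\cdots$, $T_{a-1}T_{a-3}\cdots$ run over all indices $\ge1$ of the respective parity and $T_{b+2}T_{b+4}\cdots$, $T_{b+1}T_{b+3}\cdots$ over all indices $\le n$ of the respective parity.
   Context: A Coxeter matrix over a finite set $I$ is a symmetric matrix $M=(m_{ij})_{i,j\in I}$ with $m_{ii}=1$, $m_{ij}\in\mathbb Z_{\ge2}\cup\{\infty\}$ for $i\neq j$. The Artin monoid $\mathrm{Br}^+(M)$ is generated by $T_i$, $i\in I$, subject to $T_iT_jT_i\cdots=T_jT_iT_j\cdots$ ($m_{ij}$ factors on each side) for $i\ne j$, $m_{ij}<\infty$. $W(M)$ is the Coxeter group with simple generators $s_i$. For $w\in W(M)$, $T_w:=T_{i_1}\cdots T_{i_k}$ for any reduced expression $w=s_{i_1}\cdots s_{i_k}$. $A_n$ is the Coxeter matrix over $\{1,\dots,n\}$ with $m_{ij}=3$ if $|i-j|=1$ and $m_{ij}=2$ if $|i-j|>1$; $I_2(r)$ is the Coxeter matrix over $\{1,2\}$ with $m_{12}=r$.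 $T'_1,T'_2$ are the generators of the domain, $T_1,\dots,T_n$ of the codomain; $\delta$ is the Kronecker symbol. For $K\subset I$ with $W_K(M)=\langle s_k:k\in K\rangle$ finite, $w_\circ^K$ is its longest element, and $w_{J;K}=w_\circ^Jw_\circ^K$ for $J\subset K$. Connected components of $K$ are those of the graph on $K$ with edges $\{i,j\}$, $m_{ij}>2$. If $K_1,\dots,K_r$ are the connected components of such $K$, $\mathsf P(\mathrm{Br}^+_K(M))$ is the submonoid of $\mathrm{Br}^+_K(M)=\langle T_k:k\in K\rangle$ generated by all $T_{w_{J;K_i}}$, $1\le i\le r$, $J\subset K_i$. For $\widehat M$, $M$ of finite type (finite Coxeter groups) a homomorphism $\Phi:\mathrm{Br}^+(\widehat M)\to\mathrm{Br}^+(M)$ is called parabolic if $\Phi(\mathsf P(\mathrm{Br}^+(\widehat M)))\subset\mathsf P(\mathrm{Br}^+_{K}(M))$, where $K\subset I$ is the set of indices of generators occurring in the elements $\Phi(\widehat T_i)$, $i\in\widehat I$. *)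

theory Defs
  imports "HOL-Library.Extended_Nat" "HOL-Algebra.Generated_Groups"
begin

section \<open>Monoids given by generators and relations\<close>

text \<open>The congruence on the free monoid \<open>lists I\<close> generated by the relations \<open>R\<close>.\<close>

inductive_set word_cong :: "'i set \<Rightarrow> ('i list \<times> 'i list) set \<Rightarrow> ('i list \<times> 'i list) set"
  for I :: "'i set" and R :: "('i list \<times> 'i list) set"
  where
    refl: "w \<in> lists I \<Longrightarrow> (w, w) \<in> word_cong I R"
  | rel: "(x, y) \<in> R \<Longrightarrow> u \<in> lists I \<Longrightarrow> v \<in> lists I \<Longrightarrow> (u @ x @ v, u @ y @ v) \<in> word_cong I R"
  | sym: "(x, y) \<in> word_cong I R \<Longrightarrow> (y, x) \<in> word_cong I R"
  | trans: "(x, y) \<in> word_cong I R \<Longrightarrow> (y, z) \<in> word_cong I R \<Longrightarrow> (x, z) \<in> word_cong I R"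

definition presented_monoid :: "'i set \<Rightarrow> ('i list \<times> 'i list) set \<Rightarrow> 'i list set monoid" where
  "presented_monoid I R =
    \<lparr>carrier = lists I // word_cong I R,
     mult = (\<lambda>A B. \<Union>x\<in>A. \<Union>y\<in>B. word_cong I R `` {x @ y}),
     one = word_cong I R `` {[]}\<rparr>"


section \<open>Coxeter matrices, Artin monoids and Coxeter groups\<close>

definition coxeter_matrix :: "'i set \<Rightarrow> ('i \<Rightarrow> 'i \<Rightarrow> enat) \<Rightarrow> bool" where
  "coxeter_matrix I M \<longleftrightarrow> finite I \<and> (\<forall>i\<in>I. M i i = 1) \<and>
     (\<forall>i\<in>I. \<forall>j\<in>I. M i j = M j i) \<and> (\<forall>i\<in>I. \<forall>j\<in>I. i \<noteq> j \<longrightarrow> 2 \<le> M i j)"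

fun alternating :: "nat \<Rightarrow> 'i \<Rightarrow> 'i \<Rightarrow> 'i list" where
  "alternating 0 i j = []"
| "alternating (Suc k) i j = i # alternating k j i"

definition artin_rels :: "'i set \<Rightarrow> ('i \<Rightarrow> 'i \<Rightarrow> enat) \<Rightarrow> ('i list \<times> 'i list) set" where
  "artin_rels I M = {(alternating k i j, alternating k j i) | i j k.
     i \<in> I \<and> j \<in> I \<and> i \<noteq> j \<and> M i j = enat k}"

text \<open>The relations \<open>(s\<^sub>i s\<^sub>j)\<^sup>m = 1\<close> with \<open>m = M i j\<close>. The case \<open>i = j\<close> gives \<open>s\<^sub>i s\<^sub>i = 1\<close>, so the
  monoid presented by these relations is already a group, namely the Coxeter group
  (see \<open>group_coxeter_group\<close> below).\<close>

definition coxeter_rels :: "'i set \<Rightarrow> ('i \<Rightarrow> 'i \<Rightarrow> enat) \<Rightarrow> ('i list \<times> 'i list) set" where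
  "coxeter_rels I M = {(alternating (2 * k) i j, []) | i j k. i \<in> I \<and> j \<in> I \<and> M i j = enat k}"

definition artin_monoid :: "'i set \<Rightarrow> ('i \<Rightarrow> 'i \<Rightarrow> enat) \<Rightarrow> 'i list set monoid" where
  "artin_monoid I M = presented_monoid I (artin_rels I M)"

definition coxeter_group :: "'i set \<Rightarrow> ('i \<Rightarrow> 'i \<Rightarrow> enat) \<Rightarrow> 'i list set monoid" where
  "coxeter_group I M = presented_monoid I (coxeter_rels I M)"

text \<open>The elements \<open>T\<^sub>i\<^sub>1 \<dots> T\<^sub>i\<^sub>k\<close> and \<open>s\<^sub>i\<^sub>1 \<dots> s\<^sub>i\<^sub>k\<close>; in particular \<open>artin_word I M [i]\<close> is
  the generator \<open>T\<^sub>i\<close> (see \<open>artin_word_Cons\<close> below).\<close>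

definition artin_word :: "'i set \<Rightarrow> ('i \<Rightarrow> 'i \<Rightarrow> enat) \<Rightarrow> 'i list \<Rightarrow> 'i list set" where
  "artin_word I M w = word_cong I (artin_rels I M) `` {w}"

definition coxeter_word :: "'i set \<Rightarrow> ('i \<Rightarrow> 'i \<Rightarrow> enat) \<Rightarrow> 'i list \<Rightarrow> 'i list set" where
  "coxeter_word I M w = word_cong I (coxeter_rels I M) `` {w}"

definition finite_type :: "'i set \<Rightarrow> ('i \<Rightarrow> 'i \<Rightarrow> enat) \<Rightarrow> bool" where
  "finite_type I M \<longleftrightarrow> coxeter_matrix I M \<and> finite (carrier (coxeter_group I M))"

definition coxeter_A :: "nat \<Rightarrow> nat \<Rightarrow> enat" where
  "coxeter_A i j = (if i = j then 1 else if i = Suc j \<or> j = Suc i then 3 else 2)"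

definition coxeter_I2 :: "nat \<Rightarrow> nat \<Rightarrow> nat \<Rightarrow> enat" where
  "coxeter_I2 r i j = (if i = j then 1 else enat r)"


section \<open>Reduced expressions, longest elements\<close>

text \<open>A group element is the set of all words representing it.\<close>

definition coxeter_length :: "'i list set \<Rightarrow> nat" where
  "coxeter_length w = (LEAST k. \<exists>x\<in>w. length x = k)"

definition reduced_expression :: "'i list \<Rightarrow> 'i list set \<Rightarrow> bool" where
  "reduced_expression x w \<longleftrightarrow> x \<in> w \<and> length x = coxeter_length w"

text \<open>\<open>T\<^sub>w\<close>; by Matsumoto's theorem it does not depend on the chosen reduced expression.\<close>

definition artin_lift :: "'i set \<Rightarrow> ('i \<Rightarrow> 'i \<Rightarrow> enat) \<Rightarrow> 'i list set \<Rightarrow> 'i list set" where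
  "artin_lift I M w = artin_word I M (SOME x. reduced_expression x w)"

definition parabolic_subgroup ::
    "'i set \<Rightarrow> ('i \<Rightarrow> 'i \<Rightarrow> enat) \<Rightarrow> 'i set \<Rightarrow> 'i list set set" where
  "parabolic_subgroup I M K = generate (coxeter_group I M) ((\<lambda>k. coxeter_word I M [k]) ` K)"

definition longest_element ::
    "'i set \<Rightarrow> ('i \<Rightarrow> 'i \<Rightarrow> enat) \<Rightarrow> 'i set \<Rightarrow> 'i list set" where
  "longest_element I M K = arg_max_on coxeter_length (parabolic_subgroup I M K)"

definition rel_longest_element ::
    "'i set \<Rightarrow> ('i \<Rightarrow> 'i \<Rightarrow> enat) \<Rightarrow> 'i set \<Rightarrow> 'i set \<Rightarrow> 'i list set" where
  "rel_longest_element I M J K =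
     longest_element I M J \<otimes>\<^bsub>coxeter_group I M\<^esub> longest_element I M K"


section \<open>Parabolic homomorphisms\<close>

definition coxeter_components :: "('i \<Rightarrow> 'i \<Rightarrow> enat) \<Rightarrow> 'i set \<Rightarrow> 'i set set" where
  "coxeter_components M K = K // (Restr ({(i, j). i \<in> K \<and> j \<in> K \<and> M i j > 2}\<^sup>*) K)"

text \<open>The submonoid \<open>P(Br\<^sup>+\<^sub>K(M))\<close>. Its generators lie in the submonoid \<open>Br\<^sup>+\<^sub>K(M)\<close> of
  \<open>Br\<^sup>+(M)\<close>, so it may be generated inside \<open>Br\<^sup>+(M)\<close>.\<close>

definition parabolic_submonoid ::
    "'i set \<Rightarrow> ('i \<Rightarrow> 'i \<Rightarrow> enat) \<Rightarrow> 'i set \<Rightarrow> 'i list set set" where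
  "parabolic_submonoid I M K = (\<lambda>H. submonoid H (artin_monoid I M)) hull
     {artin_lift I M (rel_longest_element I M J C) | J C. C \<in> coxeter_components M K \<and> J \<subseteq> C}"

definition artin_hom ::
    "'j set \<Rightarrow> ('j \<Rightarrow> 'j \<Rightarrow> enat) \<Rightarrow> 'i set \<Rightarrow> ('i \<Rightarrow> 'i \<Rightarrow> enat) \<Rightarrow> ('j list set \<Rightarrow> 'i list set) \<Rightarrow> bool"
  where "artin_hom I' M' I M \<Phi> \<longleftrightarrow> \<Phi> \<in> hom (artin_monoid I' M') (artin_monoid I M) \<and>
     \<Phi> \<one>\<^bsub>artin_monoid I' M'\<^esub> = \<one>\<^bsub>artin_monoid I M\<^esub>"

text \<open>The generators occurring in an element of the Artin monoid. An element is the set of all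
  words representing it; these words all have the same letters, since the two sides of a braid
  relation do.\<close>

definition artin_support :: "'i list set \<Rightarrow> 'i set" where
  "artin_support x = (\<Union>w\<in>x. set w)"

definition parabolic_hom ::
    "'j set \<Rightarrow> ('j \<Rightarrow> 'j \<Rightarrow> enat) \<Rightarrow> 'i set \<Rightarrow> ('i \<Rightarrow> 'i \<Rightarrow> enat) \<Rightarrow> ('j list set \<Rightarrow> 'i list set) \<Rightarrow> bool"
  where "parabolic_hom I' M' I M \<Phi> \<longleftrightarrow>
     finite_type I' M' \<and> finite_type I M \<and> artin_hom I' M' I M \<Phi> \<and>
     \<Phi> ` parabolic_submonoid I' M' I'
       \<subseteq> parabolic_submonoid I M (\<Union>i\<in>I'. artin_support (\<Phi> (artin_word I' M' [i])))"


section \<open>Basic facts\<close>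

lemma word_cong_lists:
  assumes "R \<subseteq> lists I \<times> lists I" "(x, y) \<in> word_cong I R"
  shows "x \<in> lists I \<and> y \<in> lists I"
  using assms(2) by induction (use assms(1) in auto)

lemma word_cong_context:
  assumes "(x, y) \<in> word_cong I R" "u \<in> lists I" "v \<in> lists I"
  shows "(u @ x @ v, u @ y @ v) \<in> word_cong I R"
  using assms(1)
proof induction
  case (refl w)
  then show ?case using assms by (intro word_cong.refl) auto
next
  case (rel x y u' v')
  then show ?case
    using word_cong.rel[of x y R "u @ u'" I "v' @ v"] assms by auto
next
  case (sym x y)
  show ?case by (rule word_cong.sym[OF sym.IH])
next
  case (trans x y z)
  show ?case by (rule word_cong.trans[OF trans.IH])
qed

lemma equiv_word_cong:
  assumes "R \<subseteq> lists I \<times> lists I"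
  shows "equiv (lists I) (word_cong I R)"
  using word_cong_lists[OF assms]
  by (intro equivI refl_onI symI transI)
     (auto intro: word_cong.refl word_cong.sym word_cong.trans simp del: in_lists_conv_set)

lemma word_cong_append:
  assumes "R \<subseteq> lists I \<times> lists I" "(x, x') \<in> word_cong I R" "(y, y') \<in> word_cong I R"
  shows "(x @ y, x' @ y') \<in> word_cong I R"
  using word_cong_context[OF assms(2), of "[]" y] word_cong_context[OF assms(3), of x' "[]"]
    word_cong_lists[OF assms(1,2)] word_cong_lists[OF assms(1,3)]
  by (auto intro: word_cong.trans)

lemma presented_monoid_mult:
  assumes R: "R \<subseteq> lists I \<times> lists I" and "u \<in> lists I" "v \<in> lists I"
  shows "word_cong I R `` {u} \<otimes>\<^bsub>presented_monoid I R\<^esub> word_cong I R `` {v}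
         = word_cong I R `` {u @ v}"
proof -
  have "word_cong I R `` {x @ y} = word_cong I R `` {u @ v}"
    if "(u, x) \<in> word_cong I R" "(v, y) \<in> word_cong I R" for x y
    using equiv_class_eq[OF equiv_word_cong[OF R] word_cong_append[OF R that]] by simp
  moreover have "(u, u) \<in> word_cong I R" "(v, v) \<in> word_cong I R"
    using assms by (auto intro: word_cong.refl)
  ultimately have "(\<Union>x\<in>word_cong I R `` {u}. \<Union>y\<in>word_cong I R `` {v}. word_cong I R `` {x @ y})
      = word_cong I R `` {u @ v}" by blast
  then show ?thesis by (simp add: presented_monoid_def)
qed

lemma monoid_presented_monoid:
  assumes R: "R \<subseteq> lists I \<times> lists I"
  shows "monoid (presented_monoid I R)"
proof -
  note mult = presented_monoid_mult[OF R]
  have carr: "\<exists>u\<in>lists I. x = word_cong I R `` {u}" if "x \<in> carrier (presented_monoid I R)" for x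
    using that by (auto simp: presented_monoid_def elim!: quotientE)
  have inc: "word_cong I R `` {u} \<in> carrier (presented_monoid I R)" if "u \<in> lists I" for u
    using that by (auto simp: presented_monoid_def intro: quotientI)
  have one: "\<one>\<^bsub>presented_monoid I R\<^esub> = word_cong I R `` {[]}"
    by (simp add: presented_monoid_def)
  show ?thesis
  proof (rule monoidI)
    fix x y assume "x \<in> carrier (presented_monoid I R)" "y \<in> carrier (presented_monoid I R)"
    then obtain u v where "u \<in> lists I" "x = word_cong I R `` {u}"
      "v \<in> lists I" "y = word_cong I R `` {v}" using carr[of x] carr[of y] by auto
    then show "x \<otimes>\<^bsub>presented_monoid I R\<^esub> y \<in> carrier (presented_monoid I R)"
      using mult[of u v] inc[of "u @ v"] by simp
  next
    fix x y z assume "x \<in> carrier (presented_monoid I R)" "y \<in> carrier (presented_monoid I R)"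
      "z \<in> carrier (presented_monoid I R)"
    then obtain u v w where "u \<in> lists I" "x = word_cong I R `` {u}"
      "v \<in> lists I" "y = word_cong I R `` {v}" "w \<in> lists I" "z = word_cong I R `` {w}"
      using carr[of x] carr[of y] carr[of z] by auto
    then show "x \<otimes>\<^bsub>presented_monoid I R\<^esub> y \<otimes>\<^bsub>presented_monoid I R\<^esub> z
      = x \<otimes>\<^bsub>presented_monoid I R\<^esub> (y \<otimes>\<^bsub>presented_monoid I R\<^esub> z)"
      using mult[of u v] mult[of v w] mult[of "u @ v" w] mult[of u "v @ w"] by simp
  next
    show "\<one>\<^bsub>presented_monoid I R\<^esub> \<in> carrier (presented_monoid I R)"
      using inc one by auto
  next
    fix x assume "x \<in> carrier (presented_monoid I R)"
    then obtain u where u: "u \<in> lists I" "x = word_cong I R `` {u}" using carr by blast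
    show "\<one>\<^bsub>presented_monoid I R\<^esub> \<otimes>\<^bsub>presented_monoid I R\<^esub> x = x"
      using mult[of "[]" u] u one by simp
    show "x \<otimes>\<^bsub>presented_monoid I R\<^esub> \<one>\<^bsub>presented_monoid I R\<^esub> = x"
      using mult[of u "[]"] u one by simp
  qed
qed

lemma set_alternating: "set (alternating k i j) \<subseteq> {i, j}"
  by (induction k i j rule: alternating.induct) auto

lemma artin_rels_lists: "artin_rels I M \<subseteq> lists I \<times> lists I"
  using set_alternating by (fastforce simp: artin_rels_def)

lemma coxeter_rels_lists: "coxeter_rels I M \<subseteq> lists I \<times> lists I"
  using set_alternating by (fastforce simp: coxeter_rels_def)

lemma artin_word_Nil: "artin_word I M [] = \<one>\<^bsub>artin_monoid I M\<^esub>"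
  by (simp add: artin_word_def artin_monoid_def presented_monoid_def)

lemma artin_word_Cons:
  assumes "i \<in> I" "w \<in> lists I"
  shows "artin_word I M (i # w) = artin_word I M [i] \<otimes>\<^bsub>artin_monoid I M\<^esub> artin_word I M w"
  using presented_monoid_mult[OF artin_rels_lists, of "[i]" I w M] assms
  by (simp add: artin_word_def artin_monoid_def)

lemma group_coxeter_group:
  assumes M: "\<forall>i\<in>I. M i i = 1"
  shows "group (coxeter_group I M)"
proof -
  note mult = presented_monoid_mult[OF coxeter_rels_lists]
  interpret monoid "coxeter_group I M"
    unfolding coxeter_group_def by (rule monoid_presented_monoid[OF coxeter_rels_lists])
  have inv: "(rev u @ u, []) \<in> word_cong I (coxeter_rels I M)" if "u \<in> lists I" for u
    using that
  proof (induction u)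
    case Nil
    show ?case by (simp add: word_cong.refl)
  next
    case (Cons i u)
    have "(alternating (2 * 1) i i, []) \<in> coxeter_rels I M"
      using Cons.hyps M unfolding coxeter_rels_def by (force simp: one_enat_def)
    then have "(rev u @ [i, i] @ u, rev u @ [] @ u) \<in> word_cong I (coxeter_rels I M)"
      using Cons by (intro word_cong.rel) (auto simp: numeral_2_eq_2)
    then show ?case using Cons.IH by (auto intro: word_cong.trans)
  qed
  show ?thesis
  proof (rule groupI)
    fix x assume "x \<in> carrier (coxeter_group I M)"
    then obtain u where u: "u \<in> lists I" "x = word_cong I (coxeter_rels I M) `` {u}"
      by (auto simp: coxeter_group_def presented_monoid_def elim!: quotientE)
    let ?y = "word_cong I (coxeter_rels I M) `` {rev u}"
    have "?y \<otimes>\<^bsub>coxeter_group I M\<^esub> x = \<one>\<^bsub>coxeter_group I M\<^esub>"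
    proof -
      have "?y \<otimes>\<^bsub>coxeter_group I M\<^esub> x = word_cong I (coxeter_rels I M) `` {rev u @ u}"
        using mult[of "rev u" I u M] u in_lists_conv_set[of "rev u"] in_lists_conv_set[of u]
        by (simp add: coxeter_group_def)
      also have "\<dots> = word_cong I (coxeter_rels I M) `` {[]}"
        using equiv_class_eq[OF equiv_word_cong[OF coxeter_rels_lists] inv[OF u(1)]] .
      also have "\<dots> = \<one>\<^bsub>coxeter_group I M\<^esub>"
        by (simp add: coxeter_group_def presented_monoid_def)
      finally show ?thesis .
    qed
    moreover have "?y \<in> carrier (coxeter_group I M)"
      using u by (auto simp: coxeter_group_def presented_monoid_def intro!: quotientI)
    ultimately show "\<exists>y\<in>carrier (coxeter_group I M).
        y \<otimes>\<^bsub>coxeter_group I M\<^esub> x = \<one>\<^bsub>coxeter_group I M\<^esub>" by blast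
  qed (simp_all add: m_assoc)
qed

end

theory Submission
  imports Defs "HOL-Combinatorics.Transposition"
begin

text \<open>
  Let \<open>\<Delta>\<^sub>J\<close> be the lift of the longest element of the parabolic subgroup of \<open>J\<close>, put
  \<open>J = {a + 1, \<dots>, b - 1}\<close> and \<open>K = {1, \<dots>, n}\<close>, and let \<open>x\<close>, \<open>y\<close> be the two images. The element
  \<open>T\<^sub>a \<dots> T\<^sub>b \<dots> T\<^sub>a\<close> moves two strands past each other around the band of strands \<open>a + 1, \<dots>, b\<close>, so
  that \<open>x y\<close> rotates the \<open>n - b + 1 + a\<close> strands outside the band around it. A full rotation gives
  \<open>\<Delta>\<^sub>J\<^sup>2 (x y)\<^sup>m = \<Delta>\<^sub>K\<^sup>2\<close>; if the band is in the middle, then \<open>\<Delta>\<^sub>J (x y)\<^sup>m = \<Delta>\<^sub>K\<close> after half of it. The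
  same holds for \<open>y x\<close>, and left cancellation yields the relation of \<open>I\<^sub>2(2 m)\<close>.

  For the rotation: statements \<open>D z\<^sup>m = Z\<close> with \<open>D\<close>, \<open>Z\<close> commuting with \<open>u\<close> and \<open>v\<close> are invariant under
  the cyclic shift of \<open>z = u v\<close> to \<open>v u\<close>, again by left cancellation. Such shifts turn the bipartite
  product \<open>x y\<close> into a linearly ordered one and move the band to the left end, where the power of a
  Coxeter element of type \<open>B\<close> is a short computation.

  Parabolicity follows from \<open>\<Delta>\<^sub>J x = \<Delta>\<^sub>J\<^sub>'\<close> and \<open>\<Delta>\<^sub>J y = \<Delta>\<^sub>J\<^sub>'\<^sub>'\<close> for larger sets \<open>J'\<close>, \<open>J''\<close>, because an
  element \<open>u\<close> with \<open>\<Delta>\<^sub>L u = \<Delta>\<^sub>K\<close> is the lift of \<open>w\<^bsub>L;K\<^esub>\<close> by Matsumoto's theorem. In the case of a full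
  rotation one obtains products of two such lifts.
\<close>

section \<open>Braid words and left cancellation\<close>

text \<open>All braid arguments take place in one monoid of positive braids on strands numbered by
  the natural numbers; an index set enters only as a bound on the letters of a word. Two tools carry
  the proof. Reduced words are braid equivalent as soon as their permutations agree, which turns
  identities between half twists into bookkeeping of strands. Powers such as \<open>(x y)^m\<close>
  are not reduced in general, and for them left cancellation takes over: the relation is obtained
  after multiplication by a power of the half twist of the band, and conjugation is replaced by
  cancelling a common left factor.

  The exponent counts strands: of the n + 1 strands, b - a belong to the band, so n - b + 1 + a
  rotate around it. If a + b = n + 1, this number is 2 a, and half a rotation takes a = n - b + 1
  factors, whence the Kronecker symbol. In that case the flip by the half twist of K preserves the
  band; otherwise it moves the band, and only the full twist commutes with all factors.\<close>

definition far :: "nat \<Rightarrow> nat \<Rightarrow> bool" where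
  "far i j \<longleftrightarrow> i + 2 \<le> j \<or> j + 2 \<le> i"

definition adj :: "nat \<Rightarrow> nat \<Rightarrow> bool" where
  "adj i j \<longleftrightarrow> j = Suc i \<or> i = Suc j"

lemma far_sym: "far i j \<Longrightarrow> far j i"
  by (auto simp: far_def)

lemma adj_sym: "adj i j \<Longrightarrow> adj j i"
  by (auto simp: adj_def)

lemma far_adj_eq_cases: "i = j \<or> far i j \<or> adj i j"
  by (auto simp: far_def adj_def)

text \<open>Right contexts are the tail \<open>w\<close> of the two relations, left contexts come
  from \<open>Cons\<close>. Letters range over all natural numbers, so no index set has to be
  carried along; \<open>artin_cong_A_iff\<close> restricts to one.\<close>

inductive braid_step :: "nat list \<Rightarrow> nat list \<Rightarrow> bool" where
  far: "far i j \<Longrightarrow> braid_step (i # j # w) (j # i # w)"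
| adj: "adj i j \<Longrightarrow> braid_step (i # j # i # w) (j # i # j # w)"
| Cons: "braid_step u v \<Longrightarrow> braid_step (i # u) (i # v)"

abbreviation braid_eq :: "nat list \<Rightarrow> nat list \<Rightarrow> bool" (infix "\<approx>" 50) where
  "u \<approx> v \<equiv> braid_step\<^sup>*\<^sup>* u v"

lemma braid_step_sym: "braid_step u v \<Longrightarrow> braid_step v u"
  by (induction rule: braid_step.induct) (auto intro: braid_step.intros far_sym adj_sym)

lemma braid_eq_sym: "u \<approx> v \<Longrightarrow> v \<approx> u"
  by (metis braid_step_sym symp_def symp_rtranclp)

lemma braid_eq_trans [trans]: "u \<approx> v \<Longrightarrow> v \<approx> w \<Longrightarrow> u \<approx> w"
  by (rule rtranclp_trans)

lemma braid_eq_Cons: "u \<approx> v \<Longrightarrow> i # u \<approx> i # v"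
  by (induction rule: rtranclp_induct) (auto intro: rtranclp.rtrancl_into_rtrancl braid_step.Cons)

lemma braid_eq_append_left: "u \<approx> v \<Longrightarrow> w @ u \<approx> w @ v"
  by (induction w) (auto intro: braid_eq_Cons)

lemma braid_step_append_right: "braid_step u v \<Longrightarrow> braid_step (u @ w) (v @ w)"
  by (induction rule: braid_step.induct) (auto intro: braid_step.intros)

lemma braid_eq_append: "u \<approx> u' \<Longrightarrow> v \<approx> v' \<Longrightarrow> u @ v \<approx> u' @ v'"
proof -
  assume "u \<approx> u'" "v \<approx> v'"
  have "u @ v \<approx> u' @ v"
    using \<open>u \<approx> u'\<close> by (induction rule: rtranclp_induct)
      (auto intro: rtranclp.rtrancl_into_rtrancl braid_step_append_right)
  then show ?thesis
    using braid_eq_append_left[OF \<open>v \<approx> v'\<close>, of u'] by (rule braid_eq_trans)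
qed

lemma braid_eq_far: "far i j \<Longrightarrow> i # j # w \<approx> j # i # w"
  by (intro r_into_rtranclp braid_step.far)

lemma braid_eq_adj: "adj i j \<Longrightarrow> i # j # i # w \<approx> j # i # j # w"
  by (intro r_into_rtranclp braid_step.adj)

lemma braid_eq_set: "u \<approx> v \<Longrightarrow> set u = set v"
proof (induction rule: rtranclp_induct)
  case (step v w)
  have "set v = set w" using step.hyps(2) by induction auto
  with step.IH show ?case by simp
qed simp

lemma braid_eq_length: "u \<approx> v \<Longrightarrow> length u = length v"
proof (induction rule: rtranclp_induct)
  case (step v w)
  have "length v = length w" using step.hyps(2) by induction auto
  with step.IH show ?case by simp
qed simp

lemma braid_step_rev: "braid_step u v \<Longrightarrow> rev u \<approx> rev v"
proof (induction rule: braid_step.induct)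
  case (far i j w)
  show ?case using braid_eq_append_left[OF braid_eq_far[of j i "[]"], of "rev w"] far
    by (auto intro: far_sym)
next
  case (adj i j w)
  show ?case using braid_eq_append_left[OF braid_eq_adj[of i j "[]"], of "rev w"] adj by auto
next
  case (Cons u v i)
  show ?case using braid_eq_append[OF Cons.IH, of "[i]" "[i]"] by simp
qed

lemma braid_eq_rev: "u \<approx> v \<Longrightarrow> rev u \<approx> rev v"
  by (induction rule: rtranclp_induct) (auto intro: braid_eq_trans braid_step_rev)

text \<open>The conclusion of Garside's theorem on words with the same class and first letters
  \<open>i\<close> and \<open>j\<close>: both words are right multiples of the least common multiple of their first letters.\<close>

definition cocancel :: "nat \<Rightarrow> nat list \<Rightarrow> nat \<Rightarrow> nat list \<Rightarrow> bool" where
  "cocancel i u j v \<longleftrightarrow> (i = j \<longrightarrow> u \<approx> v) \<and>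
     (far i j \<longrightarrow> (\<exists>z. u \<approx> j # z \<and> v \<approx> i # z)) \<and>
     (adj i j \<longrightarrow> (\<exists>z. u \<approx> j # i # z \<and> v \<approx> i # j # z))"

lemma cocancelI:
  "(i = j \<Longrightarrow> u \<approx> v) \<Longrightarrow> (far i j \<Longrightarrow> \<exists>z. u \<approx> j # z \<and> v \<approx> i # z) \<Longrightarrow>
   (adj i j \<Longrightarrow> \<exists>z. u \<approx> j # i # z \<and> v \<approx> i # j # z) \<Longrightarrow> cocancel i u j v"
  by (auto simp: cocancel_def)

lemma cocancel_sym: "cocancel i u j v \<Longrightarrow> cocancel j v i u"
  unfolding cocancel_def by (metis braid_eq_sym far_sym adj_sym)

lemma cocancel_cong_left: "u \<approx> u' \<Longrightarrow> cocancel i u' j v \<Longrightarrow> cocancel i u j v"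
  unfolding cocancel_def by (metis braid_eq_trans)

lemma cocancel_cong_right: "cocancel i u j v' \<Longrightarrow> v' \<approx> v \<Longrightarrow> cocancel i u j v"
  unfolding cocancel_def by (metis braid_eq_trans braid_eq_sym)


text \<open>This and the next two lemmas glue the comparison of \<open>i\<close> with
  \<open>k\<close> and that of \<open>k\<close> with \<open>j\<close> along the common word
  \<open>p\<close>. The two factorisations of \<open>p\<close> begin with \<open>i\<close> and
  \<open>j\<close> and have shorter tails, so the induction hypothesis compares them; here
  \<open>k\<close> commutes with both letters and is carried through.\<close>

lemma cocancel_far_far:
  assumes IH: "\<And>i j u v. i # u \<approx> j # v \<Longrightarrow> length u < length p \<Longrightarrow> cocancel i u j v"
    and rels: "far i k" "far k j"
    and u: "u \<approx> k # z1" "p \<approx> i # z1" and v: "v \<approx> k # z2" "p \<approx> j # z2"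
  shows "cocancel i u j v"
proof -
  note r = rels rels[THEN far_sym]
  have c: "cocancel i z1 j z2"
    using braid_eq_trans[OF braid_eq_sym[OF u(2)] v(2)] braid_eq_length[OF u(2)] by (intro IH) auto
  show ?thesis
  proof (rule cocancelI)
    assume "i = j"
    then have "z1 \<approx> z2" using c by (simp add: cocancel_def)
    then show "u \<approx> v" by (meson braid_eq_Cons braid_eq_sym braid_eq_trans u v)
  next
    assume "far i j"
    then obtain y where y: "z1 \<approx> j # y" "z2 \<approx> i # y" using c by (auto simp: cocancel_def)
    have "u \<approx> k # z1" by fact
    also have "\<dots> \<approx> k # j # y" by (intro braid_eq_Cons y)
    also have "\<dots> \<approx> j # k # y" by (intro braid_eq_far r)
    finally have 1: "u \<approx> j # k # y" .
    have "v \<approx> k # z2" by fact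
    also have "\<dots> \<approx> k # i # y" by (intro braid_eq_Cons y)
    also have "\<dots> \<approx> i # k # y" by (intro braid_eq_far r)
    finally show "\<exists>z. u \<approx> j # z \<and> v \<approx> i # z" using 1 by blast
  next
    assume "adj i j"
    then obtain y where y: "z1 \<approx> j # i # y" "z2 \<approx> i # j # y" using c by (auto simp: cocancel_def)
    have "u \<approx> k # z1" by fact
    also have "\<dots> \<approx> k # j # i # y" by (intro braid_eq_Cons y)
    also have "\<dots> \<approx> j # k # i # y" by (intro braid_eq_far r)
    also have "\<dots> \<approx> j # i # k # y" by (intro braid_eq_Cons braid_eq_far r)
    finally have 1: "u \<approx> j # i # k # y" .
    have "v \<approx> k # z2" by fact
    also have "\<dots> \<approx> k # i # j # y" by (intro braid_eq_Cons y)
    also have "\<dots> \<approx> i # k # j # y" by (intro braid_eq_far r)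
    also have "\<dots> \<approx> i # j # k # y" by (intro braid_eq_Cons braid_eq_far r)
    finally show "\<exists>z. u \<approx> j # i # z \<and> v \<approx> i # j # z" using 1 by blast
  qed
qed

text \<open>If \<open>i\<close> and \<open>j\<close> are adjacent, then \<open>k\<close>,
  \<open>i\<close>, \<open>j\<close> form a chain of type A3, and both words are rewritten until its
  least common multiple, of length six, appears. This takes further applications of the hypothesis
  to tails of \<open>p\<close>.\<close>

lemma cocancel_adj_far:
  assumes IH: "\<And>i j u v. i # u \<approx> j # v \<Longrightarrow> length u < length p \<Longrightarrow> cocancel i u j v"
    and rels: "adj i k" "far k j"
    and u: "u \<approx> k # i # z1" "p \<approx> i # k # z1" and v: "v \<approx> k # z2" "p \<approx> j # z2"
  shows "cocancel i u j v"
proof -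
  note r = rels rels(1)[THEN adj_sym] rels(2)[THEN far_sym]
  have len: "length p = Suc (Suc (length z1))" using braid_eq_length[OF u(2)] by simp
  have c: "cocancel i (k # z1) j z2"
    using braid_eq_trans[OF braid_eq_sym[OF u(2)] v(2)] len by (intro IH) auto
  show ?thesis
  proof (rule cocancelI)
    assume "i = j"
    then show "u \<approx> v" using rels by (auto simp: far_def adj_def)
  next
    assume ij: "far i j"
    then obtain y where y: "k # z1 \<approx> j # y" "z2 \<approx> i # y" using c by (auto simp: cocancel_def)
    then have "cocancel k z1 j y" using len by (intro IH) auto
    then obtain y' where y': "z1 \<approx> j # y'" "y \<approx> k # y'" using rels by (auto simp: cocancel_def)
    have "u \<approx> k # i # z1" by fact
    also have "\<dots> \<approx> k # i # j # y'" by (intro braid_eq_Cons y')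
    also have "\<dots> \<approx> k # j # i # y'" by (intro braid_eq_Cons braid_eq_far ij)
    also have "\<dots> \<approx> j # k # i # y'" by (intro braid_eq_far r)
    finally have 1: "u \<approx> j # k # i # y'" .
    have "v \<approx> k # z2" by fact
    also have "\<dots> \<approx> k # i # y" by (intro braid_eq_Cons y)
    also have "\<dots> \<approx> k # i # k # y'" by (intro braid_eq_Cons y')
    also have "\<dots> \<approx> i # k # i # y'" by (intro braid_eq_adj r)
    finally show "\<exists>z. u \<approx> j # z \<and> v \<approx> i # z" using 1 by blast
  next
    assume ij: "adj i j"
    then obtain y where y: "k # z1 \<approx> j # i # y" "z2 \<approx> i # j # y" using c by (auto simp: cocancel_def)
    then have "cocancel k z1 j (i # y)" using len by (intro IH) auto
    then obtain y1 where y1: "z1 \<approx> j # y1" "i # y \<approx> k # y1" using rels by (auto simp: cocancel_def)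
    have "cocancel i y k y1" using len braid_eq_length[OF y(1)] by (intro IH y1) auto
    then obtain y2 where y2: "y \<approx> k # i # y2" "y1 \<approx> i # k # y2" using rels by (auto simp: cocancel_def)
    have "u \<approx> k # i # z1" by fact
    also have "\<dots> \<approx> k # i # j # y1" by (intro braid_eq_Cons y1)
    also have "\<dots> \<approx> k # i # j # i # k # y2" by (intro braid_eq_Cons y2)
    also have "\<dots> \<approx> k # j # i # j # k # y2" by (intro braid_eq_Cons braid_eq_adj ij)
    also have "\<dots> \<approx> j # k # i # j # k # y2" by (intro braid_eq_far r)
    also have "\<dots> \<approx> j # k # i # k # j # y2" by (intro braid_eq_Cons braid_eq_far r)
    also have "\<dots> \<approx> j # i # k # i # j # y2" by (intro braid_eq_Cons braid_eq_adj r)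
    finally have 1: "u \<approx> j # i # k # i # j # y2" .
    have "v \<approx> k # z2" by fact
    also have "\<dots> \<approx> k # i # j # y" by (intro braid_eq_Cons y)
    also have "\<dots> \<approx> k # i # j # k # i # y2" by (intro braid_eq_Cons y2)
    also have "\<dots> \<approx> k # i # k # j # i # y2" by (intro braid_eq_Cons braid_eq_far r)
    also have "\<dots> \<approx> i # k # i # j # i # y2" by (intro braid_eq_adj r)
    also have "\<dots> \<approx> i # k # j # i # j # y2" by (intro braid_eq_Cons braid_eq_adj ij)
    also have "\<dots> \<approx> i # j # k # i # j # y2" by (intro braid_eq_Cons braid_eq_far r)
    finally show "\<exists>z. u \<approx> j # i # z \<and> v \<approx> i # j # z" using 1 by blast
  qed
qed

text \<open>Now \<open>k\<close> is the middle of the chain. Two neighbours of \<open>k\<close> have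
  the same parity, so \<open>i\<close> and \<open>j\<close> are equal or far apart.\<close>

lemma cocancel_adj_adj:
  assumes IH: "\<And>i j u v. i # u \<approx> j # v \<Longrightarrow> length u < length p \<Longrightarrow> cocancel i u j v"
    and rels: "adj i k" "adj k j"
    and u: "u \<approx> k # i # z1" "p \<approx> i # k # z1" and v: "v \<approx> k # j # z2" "p \<approx> j # k # z2"
  shows "cocancel i u j v"
proof -
  note r = rels rels[THEN adj_sym]
  have len: "length p = Suc (Suc (length z1))" "length p = Suc (Suc (length z2))"
    using braid_eq_length[OF u(2)] braid_eq_length[OF v(2)] by auto
  have c: "cocancel i (k # z1) j (k # z2)"
    using braid_eq_trans[OF braid_eq_sym[OF u(2)] v(2)] len by (intro IH) auto
  show ?thesis
  proof (rule cocancelI)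
    assume ij: "i = j"
    then have "k # z1 \<approx> k # z2" using c by (simp add: cocancel_def)
    then have "cocancel k z1 k z2" using len by (intro IH) auto
    then have "z1 \<approx> z2" by (simp add: cocancel_def)
    then have "k # i # z1 \<approx> k # j # z2" unfolding ij by (intro braid_eq_Cons)
    then show "u \<approx> v" by (meson braid_eq_sym braid_eq_trans u v)
  next
    assume ij: "far i j"
    then obtain y where y: "k # z1 \<approx> j # y" "k # z2 \<approx> i # y" using c by (auto simp: cocancel_def)
    have "cocancel k z1 j y" using len by (intro IH y) auto
    then obtain y1 where y1: "z1 \<approx> j # k # y1" "y \<approx> k # j # y1" using rels by (auto simp: cocancel_def)
    have "cocancel k z2 i y" using len by (intro IH y) auto
    then obtain y2 where y2: "z2 \<approx> i # k # y2" "y \<approx> k # i # y2" using r by (auto simp: cocancel_def)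
    \<comment> \<open>Both descriptions of \<open>y\<close> begin with \<open>k\<close>; cancelling
      it leaves tails with the commuting first letters \<open>j\<close> and
      \<open>i\<close>.\<close>
    have "cocancel k (j # y1) k (i # y2)"
      using braid_eq_trans[OF braid_eq_sym[OF y1(2)] y2(2)] len braid_eq_length[OF y1(1)]
      by (intro IH) auto
    then have "j # y1 \<approx> i # y2" by (simp add: cocancel_def)
    then have "cocancel j y1 i y2" using len braid_eq_length[OF y1(1)] by (intro IH) auto
    then obtain x where x: "y1 \<approx> i # x" "y2 \<approx> j # x"
      using ij by (auto simp: cocancel_def far_sym)
    have "u \<approx> k # i # z1" by fact
    also have "\<dots> \<approx> k # i # j # k # y1" by (intro braid_eq_Cons y1)
    also have "\<dots> \<approx> k # i # j # k # i # x" by (intro braid_eq_Cons x)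
    also have "\<dots> \<approx> k # j # i # k # i # x" by (intro braid_eq_Cons braid_eq_far ij)
    also have "\<dots> \<approx> k # j # k # i # k # x" by (intro braid_eq_Cons braid_eq_adj r)
    also have "\<dots> \<approx> j # k # j # i # k # x" by (intro braid_eq_adj r)
    finally have 1: "u \<approx> j # k # j # i # k # x" .
    have "v \<approx> k # j # z2" by fact
    also have "\<dots> \<approx> k # j # i # k # y2" by (intro braid_eq_Cons y2)
    also have "\<dots> \<approx> k # j # i # k # j # x" by (intro braid_eq_Cons x)
    also have "\<dots> \<approx> k # i # j # k # j # x" by (intro braid_eq_Cons braid_eq_far far_sym[OF ij])
    also have "\<dots> \<approx> k # i # k # j # k # x" by (intro braid_eq_Cons braid_eq_adj r)
    also have "\<dots> \<approx> i # k # i # j # k # x" by (intro braid_eq_adj r)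
    also have "\<dots> \<approx> i # k # j # i # k # x" by (intro braid_eq_Cons braid_eq_far ij)
    finally show "\<exists>z. u \<approx> j # z \<and> v \<approx> i # z" using 1 by blast
  next
    assume "adj i j"
    then show "\<exists>z. u \<approx> j # i # z \<and> v \<approx> i # j # z" using rels by (auto simp: adj_def)
  qed
qed

text \<open>The intermediate word is \<open>k # p\<close>. The position of \<open>k\<close> relative
  to \<open>i\<close> and \<open>j\<close> gives the cases; the one with \<open>far i k\<close> and
  \<open>adj k j\<close> is the mirror image of its predecessor under
  \<open>cocancel_sym\<close>.\<close>

lemma cocancel_trans:
  assumes IH: "\<And>i j u v. i # u \<approx> j # v \<Longrightarrow> length u < length p \<Longrightarrow> cocancel i u j v"
    and ik: "cocancel i u k p" and kj: "cocancel k p j v"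
  shows "cocancel i u j v"
proof -
  consider "i = k" | "k = j" | "far i k" "far k j" | "adj i k" "far k j"
    | "far i k" "adj k j" | "adj i k" "adj k j"
    using far_adj_eq_cases[of i k] far_adj_eq_cases[of k j] by blast
  then show ?thesis
  proof cases
    case 1
    then show ?thesis using ik kj by (metis cocancel_cong_left cocancel_def)
  next
    case 2
    then show ?thesis using ik kj by (metis cocancel_cong_right cocancel_def)
  next
    case 3
    then obtain z1 z2 where "u \<approx> k # z1" "p \<approx> i # z1" "p \<approx> j # z2" "v \<approx> k # z2"
      using ik kj by (auto simp: cocancel_def)
    then show ?thesis using cocancel_far_far[OF IH] 3 by blast
  next
    case 4
    then obtain z1 z2 where "u \<approx> k # i # z1" "p \<approx> i # k # z1" "p \<approx> j # z2" "v \<approx> k # z2"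
      using ik kj by (auto simp: cocancel_def)
    then show ?thesis using cocancel_adj_far[OF IH] 4 by blast
  next
    case 5
    then obtain z1 z2 where "u \<approx> k # z1" "p \<approx> i # z1" "p \<approx> j # k # z2" "v \<approx> k # j # z2"
      using ik kj by (auto simp: cocancel_def)
    then have "cocancel j v i u" using cocancel_adj_far[OF IH adj_sym[OF 5(2)] far_sym[OF 5(1)]] by blast
    then show ?thesis by (rule cocancel_sym)
  next
    case 6
    then obtain z1 z2 where "u \<approx> k # i # z1" "p \<approx> i # k # z1" "p \<approx> j # k # z2" "v \<approx> k # j # z2"
      using ik kj by (auto simp: cocancel_def)
    then show ?thesis using cocancel_adj_adj[OF IH] 6 by blast
  qed
qed

lemma braid_step_cocancel:
  assumes "braid_step (i # u) (k # p)"
  shows "cocancel i u k p"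
  using assms by cases (auto simp: cocancel_def far_def adj_def)

text \<open>Two nested inductions: the outer one on the length supplies the hypothesis of
  \<open>cocancel_trans\<close>, the inner one runs along the rewriting steps from
  \<open>i # u\<close> to \<open>j # v\<close>.\<close>

theorem garside_cocancel: "i # u \<approx> j # v \<Longrightarrow> cocancel i u j v"
proof (induction "length u" arbitrary: i j u v rule: less_induct)
  case less
  \<comment> \<open>The end \<open>j # v\<close> of the chain stays fixed while its beginning is
    arbitrary, so that the first letter may change from step to step.\<close>
  have "\<forall>i u. length u = length v \<longrightarrow> x = i # u \<longrightarrow> cocancel i u j v" if "x \<approx> j # v" for x
    using that
  proof (induction rule: converse_rtranclp_induct)
    case base
    then show ?case by (auto simp: cocancel_def far_def adj_def)
  next
    case (step x y)
    show ?case
    proof (intro allI impI)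
      fix i' u' assume u': "length u' = length v" "x = i' # u'"
      then obtain k p where y: "y = k # p"
        using braid_eq_length[OF step.hyps(2)] by (cases y) auto
      have len: "length p = length v" "length u = length v"
        using braid_eq_length[OF step.hyps(2)] braid_eq_length[OF less.prems] y by auto
      have 1: "cocancel i' u' k p" using step.hyps(1) u' y by (auto intro: braid_step_cocancel)
      have 2: "cocancel k p j v" using step.IH y len by auto
      show "cocancel i' u' j v"
        by (rule cocancel_trans[OF _ 1 2]) (use less.hyps len in auto)
    qed
  qed
  then show ?case using less.prems braid_eq_length[OF less.prems] by auto
qed

lemma braid_eq_left_cancel: "w @ u \<approx> w @ v \<Longrightarrow> u \<approx> v"
proof (induction w)
  case (Cons i w)
  then show ?case using garside_cocancel[of i "w @ u" i "w @ v"] by (simp add: cocancel_def)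
qed simp


\<comment> \<open>The monoid of positive braids\<close>
quotient_type braid = "nat list" / braid_eq
  by (intro equivpI reflpI sympI transpI) (auto intro: braid_eq_sym braid_eq_trans)

instantiation braid :: monoid_mult
begin

lift_definition one_braid :: braid is "[]" .

lift_definition times_braid :: "braid \<Rightarrow> braid \<Rightarrow> braid" is "(@)"
  by (rule braid_eq_append)

instance
  by standard (transfer; simp)+

end

lift_definition br :: "nat list \<Rightarrow> braid" is "\<lambda>w. w" .

text \<open>An anti-automorphism that fixes every half twist of a finite set; it turns identities
  with factors on the right into identities with factors on the left.\<close>

lift_definition mirror :: "braid \<Rightarrow> braid" is rev
  by (rule braid_eq_rev)

abbreviation T :: "nat \<Rightarrow> braid" where
  "T i \<equiv> br [i]"

lemma br_eq_iff: "br u = br v \<longleftrightarrow> u \<approx> v"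
  by transfer simp

lemma br_Nil [simp]: "br [] = 1"
  by transfer simp

lemma br_append: "br (u @ v) = br u * br v"
  by transfer simp

lemma br_Cons: "br (i # w) = T i * br w"
  by transfer simp

lemma T_far: "far i j \<Longrightarrow> T i * T j = T j * T i"
  by transfer (auto intro: braid_eq_far)

lemma T_adj: "adj i j \<Longrightarrow> T i * T j * T i = T j * T i * T j"
  by transfer (auto intro: braid_eq_adj)

lemma mirror_mult: "mirror (x * y) = mirror y * mirror x"
  by transfer simp

lemma mirror_br: "mirror (br w) = br (rev w)"
  by transfer simp

lemma braid_mult_left_cancel [simp]: "x * y = x * z \<longleftrightarrow> y = z" for x y z :: braid
  by transfer (metis braid_eq_append_left braid_eq_left_cancel)

section \<open>Strand permutations and Matsumoto's theorem\<close>

abbreviation swap :: "nat \<Rightarrow> nat \<Rightarrow> nat" where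
  "swap i \<equiv> Transposition.transpose i (Suc i)"

text \<open>The first letter acts first. Prefixing a letter therefore composes on the argument side,
  where it only relabels the positions of inversions apart from the pair
  \<open>(i, Suc i)\<close>.\<close>

definition strand :: "nat list \<Rightarrow> nat \<Rightarrow> nat" where
  "strand = fold swap"

definition Inv :: "(nat \<Rightarrow> nat) \<Rightarrow> (nat \<times> nat) set" where
  "Inv \<pi> = {(p, q). p < q \<and> \<pi> q < \<pi> p}"

text \<open>The inversion number is the Coxeter length in type A;
  \<open>reduced_expression_A_iff\<close> makes the connection.\<close>

definition reduced :: "nat list \<Rightarrow> bool" where
  "reduced w \<longleftrightarrow> length w = card (Inv (strand w))"

lemma strand_Nil [simp]: "strand [] = id"
  by (simp add: strand_def)

lemma strand_Cons: "strand (i # w) = strand w \<circ> swap i"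
  by (simp add: strand_def)

lemma strand_append: "strand (u @ v) = strand v \<circ> strand u"
  by (simp add: strand_def)

lemma bij_strand: "bij (strand w)"
proof (induction w)
  case (Cons i w)
  show ?case unfolding strand_Cons by (rule bij_comp[OF bij_transpose Cons.IH])
qed (unfold strand_Nil, rule bij_id)

lemma strand_eq_iff [simp]: "strand w p = strand w q \<longleftrightarrow> p = q"
  using bij_strand[of w] by (auto simp: bij_def dest: injD)

lemma strand_braid_eq: "u \<approx> v \<Longrightarrow> strand u = strand v"
proof (induction rule: rtranclp_induct)
  case (step v w)
  from step.hyps(2) have "strand v = strand w"
  proof induction
    case (far i j w)
    then show ?case by (auto simp: strand_Cons fun_eq_iff far_def Transposition.transpose_def)
  next
    case (adj i j w)
    then show ?case by (auto simp: strand_Cons fun_eq_iff adj_def Transposition.transpose_def)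
  qed (simp add: strand_Cons)
  with step.IH show ?case by simp
qed simp

lemma comp_swap_eq_iff: "\<pi> \<circ> swap i = \<sigma> \<longleftrightarrow> \<pi> = \<sigma> \<circ> swap i"
  by (auto simp: comp_assoc)

lemma Inv_id [simp]: "Inv id = {}"
  by (auto simp: Inv_def)

lemma Inv_comp_swap:
  assumes "\<pi> i < \<pi> (Suc i)"
  shows "Inv (\<pi> \<circ> swap i) = insert (i, Suc i) (map_prod (swap i) (swap i) ` Inv \<pi>)"
proof -
  have "(p, q) \<in> Inv (\<pi> \<circ> swap i) \<longleftrightarrow> (p, q) = (i, Suc i) \<or> (swap i p, swap i q) \<in> Inv \<pi>" for p q
    using assms by (auto simp: Inv_def Transposition.transpose_def)
  moreover have "(swap i p, swap i q) \<in> Inv \<pi> \<longleftrightarrow> (p, q) \<in> map_prod (swap i) (swap i) ` Inv \<pi>" for p q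
    by (force simp: image_iff intro: bexI[of _ "(swap i p, swap i q)"])
  ultimately show ?thesis by (auto simp del: Transposition.transpose_apply_other)
qed

lemma Inv_comp_swap_card:
  assumes "\<pi> i < \<pi> (Suc i)" "finite (Inv \<pi>)"
  shows "finite (Inv (\<pi> \<circ> swap i))" "card (Inv (\<pi> \<circ> swap i)) = Suc (card (Inv \<pi>))"
proof -
  show "finite (Inv (\<pi> \<circ> swap i))"
    using assms by (simp add: Inv_comp_swap)
  have "inj (map_prod (swap i) (swap i))"
    by (intro prod.inj_map inj_transpose)
  then have "card (map_prod (swap i) (swap i) ` Inv \<pi>) = card (Inv \<pi>)"
    by (meson card_image inj_on_subset subset_UNIV)
  moreover have "(i, Suc i) \<notin> map_prod (swap i) (swap i) ` Inv \<pi>"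
    by (auto simp: Inv_def Transposition.transpose_def split: if_splits)
  ultimately show "card (Inv (\<pi> \<circ> swap i)) = Suc (card (Inv \<pi>))"
    using assms by (simp add: Inv_comp_swap)
qed

lemma swap_comp_swap [simp]: "\<pi> \<circ> swap i \<circ> swap i = \<pi>"
  by (simp add: comp_assoc)

lemma Inv_comp_swap_finite:
  assumes "finite (Inv \<pi>)" "\<pi> i \<noteq> \<pi> (Suc i)"
  shows "finite (Inv (\<pi> \<circ> swap i))"
proof (cases "\<pi> i < \<pi> (Suc i)")
  case False
  then have "Inv \<pi> = insert (i, Suc i) (map_prod (swap i) (swap i) ` Inv (\<pi> \<circ> swap i))"
    using Inv_comp_swap[of "\<pi> \<circ> swap i" i] assms by simp
  then have "finite (map_prod (swap i) (swap i) ` Inv (\<pi> \<circ> swap i))"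
    using assms by simp
  then show ?thesis
    by (rule finite_imageD) (auto intro!: inj_on_subset[OF prod.inj_map[OF inj_transpose inj_transpose]])
qed (use assms Inv_comp_swap_card in blast)

lemma Inv_comp_swap_descent:
  assumes "\<pi> (Suc i) < \<pi> i" "finite (Inv \<pi>)"
  shows "card (Inv \<pi>) = Suc (card (Inv (\<pi> \<circ> swap i)))"
  using Inv_comp_swap_card(2)[of "\<pi> \<circ> swap i" i] Inv_comp_swap_finite[of \<pi> i] assms by simp

lemma finite_Inv_strand [simp]: "finite (Inv (strand w))"
proof (induction w)
  case (Cons i w)
  then show ?case unfolding strand_Cons by (rule Inv_comp_swap_finite) simp
next
  case Nil
  have "finite (Inv (strand []))" by simp
  then show ?case .
qed

lemma card_Inv_strand_le: "card (Inv (strand w)) \<le> length w"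
proof (induction w)
  case Nil
  have "card (Inv (strand [])) \<le> length ([] :: nat list)" by simp
  then show ?case .
next
  case (Cons i w)
  have "card (Inv (strand (i # w))) \<le> Suc (card (Inv (strand w)))"
  proof (cases "strand w i < strand w (Suc i)")
    case True
    then show ?thesis using Inv_comp_swap_card(2)[of "strand w" i] by (simp add: strand_Cons)
  next
    case False
    then have "strand w (Suc i) < strand w i" by (simp add: not_less order.order_iff_strict)
    then show ?thesis using Inv_comp_swap_descent[of "strand w" i] by (simp add: strand_Cons)
  qed
  then have "card (Inv (strand (i # w))) \<le> length (i # w)" using Cons by simp
  then show ?case .
qed

lemma reduced_Nil [simp]: "reduced []"
  by (simp add: reduced_def)

lemma reduced_Cons: "reduced (i # w) \<longleftrightarrow> reduced w \<and> strand w i < strand w (Suc i)"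
proof (cases "strand w i < strand w (Suc i)")
  case True
  then show ?thesis using Inv_comp_swap_card(2)[of "strand w" i] by (simp add: strand_Cons reduced_def)
next
  case False
  then have "strand w (Suc i) < strand w i" by (simp add: not_less order.order_iff_strict)
  then show ?thesis using Inv_comp_swap_descent[of "strand w" i] card_Inv_strand_le[of w] False
    by (simp add: strand_Cons reduced_def)
qed

lemma reduced_append_right: "reduced (u @ v) \<Longrightarrow> reduced v"
  by (induction u) (auto simp: reduced_Cons)

lemma reduced_braid_eq: "u \<approx> v \<Longrightarrow> reduced u \<longleftrightarrow> reduced v"
  by (simp add: reduced_def strand_braid_eq braid_eq_length)

text \<open>A strictly monotone map never decreases its argument. The same for the inverse map gives
  the opposite inequality.\<close>

lemma bij_mono_nat_eq_id:
  fixes \<pi> :: "nat \<Rightarrow> nat"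
  assumes "bij \<pi>" "strict_mono \<pi>"
  shows "\<pi> = id"
proof
  fix p
  have le: "q \<le> \<pi> q" for q using assms(2) by (rule strict_mono_imp_increasing)
  have "\<pi> p \<le> p"
  proof (rule ccontr)
    assume "\<not> \<pi> p \<le> p"
    define \<rho> where "\<rho> = inv_into UNIV \<pi>"
    have \<rho>: "\<pi> (\<rho> x) = x" "\<rho> (\<pi> x) = x" for x
      using assms(1) by (auto simp: \<rho>_def bij_def surj_f_inv_f)
    have "strict_mono \<rho>"
      using assms(2) \<rho>(1) by (metis not_less_iff_gr_or_eq strict_mono_def)
    then have "\<pi> p \<le> \<rho> (\<pi> p)" by (rule strict_mono_imp_increasing)
    with \<open>\<not> \<pi> p \<le> p\<close> show False by (simp add: \<rho>)
  qed
  with le[of p] show "\<pi> p = id p" by simp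
qed

text \<open>Bubble sort: if there is an inversion, there is one between neighbours, and undoing it
  lowers the finite inversion number by one. Without inversions a bijection of the natural numbers
  is the identity.\<close>

lemma ex_reduced_word:
  assumes "bij \<pi>" "finite (Inv \<pi>)"
  shows "\<exists>w. strand w = \<pi> \<and> reduced w"
  using assms
proof (induction "card (Inv \<pi>)" arbitrary: \<pi>)
  case 0
  have "strict_mono \<pi>" unfolding strict_mono_Suc_iff
  proof
    fix i
    have "(i, Suc i) \<notin> Inv \<pi>" using 0 by simp
    moreover have "\<pi> i \<noteq> \<pi> (Suc i)" using 0 by (metis bij_pointE n_not_Suc_n)
    ultimately show "\<pi> i < \<pi> (Suc i)" by (auto simp: Inv_def)
  qed
  then have "\<pi> = id" using 0 bij_mono_nat_eq_id by blast
  then show ?case by (intro exI[of _ "[]"]) simp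
next
  case (Suc k)
  have "\<exists>i. \<pi> (Suc i) < \<pi> i"
  proof (rule ccontr)
    assume "\<nexists>i. \<pi> (Suc i) < \<pi> i"
    then have "mono \<pi>" unfolding mono_iff_le_Suc by (simp add: not_less)
    then have "Inv \<pi> = {}" by (auto simp: Inv_def mono_def) (meson leD less_imp_le)
    then show False using Suc.hyps by simp
  qed
  then obtain i where i: "\<pi> (Suc i) < \<pi> i" by blast
  have "bij (\<pi> \<circ> swap i)" using Suc.prems by (auto intro: bij_comp)
  moreover have "finite (Inv (\<pi> \<circ> swap i))" using Inv_comp_swap_finite Suc.prems i by simp
  moreover have "k = card (Inv (\<pi> \<circ> swap i))"
    using Inv_comp_swap_descent[OF i Suc.prems(2)] Suc.hyps by simp
  ultimately obtain w where w: "strand w = \<pi> \<circ> swap i" "reduced w"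
    using Suc.hyps by blast
  then have "strand (i # w) = \<pi>" by (simp add: strand_Cons)
  moreover have "reduced (i # w)" using w i by (simp add: reduced_Cons)
  ultimately show ?case by blast
qed

text \<open>A form of the exchange condition. The word is rebuilt from the permutation by sorting
  instead of being extracted from \<open>u\<close>.\<close>

lemma ex_reduced_descent:
  assumes "strand u (Suc i) < strand u i"
  shows "\<exists>w. strand (i # w) = strand u \<and> reduced (i # w)"
proof -
  have "bij (strand u \<circ> swap i)" by (rule bij_comp[OF bij_transpose bij_strand])
  moreover have "finite (Inv (strand u \<circ> swap i))" using assms by (intro Inv_comp_swap_finite) auto
  ultimately obtain w where w: "strand w = strand u \<circ> swap i" "reduced w"
    using ex_reduced_word by blast
  then have "strand (i # w) = strand u" "reduced (i # w)"
    using assms by (simp_all add: strand_Cons reduced_Cons)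
  then show ?thesis by blast
qed

text \<open>Matsumoto's theorem in type A. The first letters \<open>i\<close> and \<open>j\<close>
  are both descents of the common permutation, which then also has a reduced word beginning with
  either side of the relation between \<open>i\<close> and \<open>j\<close>; induction connects
  \<open>u\<close> with one side and \<open>v\<close> with the other.\<close>

theorem reduced_strand_braid_eq:
  assumes "reduced u" "reduced v" "strand u = strand v"
  shows "u \<approx> v"
  using assms
proof (induction "length u" arbitrary: u v rule: less_induct)
  case less
  have len: "length u = length v" using less.prems by (simp add: reduced_def)
  show ?case
  proof (cases u)
    case Nil
    then show ?thesis using len by simp
  next
    case u: (Cons i u')
    then obtain j v' where v: "v = j # v'" using len by (cases v) auto
    define \<pi> where "\<pi> = strand u"
    have ru: "reduced u'" "strand u' i < strand u' (Suc i)" and rv: "reduced v'" "strand v' j < strand v' (Suc j)"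
      using less.prems u v by (auto simp: reduced_Cons)
    have su: "strand u' = \<pi> \<circ> swap i" and sv: "strand v' = \<pi> \<circ> swap j"
      using less.prems(3) unfolding \<pi>_def u v strand_Cons comp_swap_eq_iff by (simp_all add: comp_assoc)
    have d: "\<pi> (Suc i) < \<pi> i" "\<pi> (Suc j) < \<pi> j" using ru rv su sv by auto
    \<comment> \<open>It is enough to rewrite \<open>u\<close> into some word that begins with
      \<open>j\<close>: its tail is then compared with \<open>v'\<close> by induction.\<close>
    have v'I: "v' \<approx> x" if "u \<approx> j # x" for x
    proof (rule less.hyps)
      have "reduced (j # x)" using that less.prems reduced_braid_eq by blast
      then show "reduced x" by (simp add: reduced_Cons)
      have "strand (j # x) = strand (j # v')" using strand_braid_eq[OF that] less.prems v by simp
      then have "strand x \<circ> swap j \<circ> swap j = strand v' \<circ> swap j \<circ> swap j" by (simp add: strand_Cons)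
      then show "strand v' = strand x" by simp
    qed (use rv len v in auto)
    have *: ?thesis if "u \<approx> j # x" for x
      using braid_eq_trans[OF that braid_eq_Cons[OF braid_eq_sym[OF v'I[OF that]]]] v by simp
    consider "i = j" | "far i j" | "adj i j" using far_adj_eq_cases by blast
    then show ?thesis
    proof cases
      case 1
      then show ?thesis using * u by blast
    next
      case 2
      then have "strand u' (Suc j) < strand u' j" using d su by (auto simp: far_def)
      then obtain w where w: "strand (j # w) = strand u'" "reduced (j # w)"
        using ex_reduced_descent by blast
      have "u' \<approx> j # w" using w ru u by (intro less.hyps) auto
      then have "u \<approx> i # j # w" using u by (simp add: braid_eq_Cons)
      also have "\<dots> \<approx> j # i # w" using 2 by (rule braid_eq_far)
      finally show ?thesis by (rule *)
    next
      case 3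
      then have "strand u' (Suc j) < strand u' j" using d su by (auto simp: adj_def)
      then obtain w where w: "strand (j # w) = strand u'" "reduced (j # w)"
        using ex_reduced_descent by blast
      have uw: "u' \<approx> j # w" using w ru u by (intro less.hyps) auto
      have "strand w = \<pi> \<circ> swap i \<circ> swap j"
        using w su by (metis strand_Cons swap_comp_swap)
      then have "strand w (Suc i) < strand w i" using d 3 by (auto simp: adj_def)
      then obtain w' where w': "strand (i # w') = strand w" "reduced (i # w')"
        using ex_reduced_descent by blast
      have ww: "w \<approx> i # w'" using w w' u braid_eq_length[OF uw]
        by (intro less.hyps) (auto simp: reduced_Cons)
      have "u \<approx> i # j # w" using uw u by (simp add: braid_eq_Cons)
      also have "\<dots> \<approx> i # j # i # w'" by (intro braid_eq_Cons ww)
      also have "\<dots> \<approx> j # i # j # w'" using 3 by (rule braid_eq_adj)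
      finally show ?thesis by (rule *)
    qed
  qed
qed

lemma reduced_descent:
  assumes "reduced u" "strand u (Suc i) < strand u i"
  obtains w where "u \<approx> i # w" "reduced (i # w)"
  using ex_reduced_descent[OF assms(2)] reduced_strand_braid_eq assms(1) by metis

section \<open>Half twists\<close>

text \<open>The positive roots of the parabolic subgroup of \<open>J\<close>, as pairs of strands
  that generators in \<open>J\<close> can exchange.\<close>

definition block :: "nat set \<Rightarrow> (nat \<times> nat) set" where
  "block J = {(p, q). p < q \<and> {p..<q} \<subseteq> J}"

definition half_twist_word :: "nat set \<Rightarrow> nat list \<Rightarrow> bool" where
  "half_twist_word J w \<longleftrightarrow> set w \<subseteq> J \<and> reduced w \<and> Inv (strand w) = block J"

text \<open>All half twist words of \<open>J\<close> give the same braid by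
  \<open>reduced_Inv_braid_eq\<close>, and for finite \<open>J\<close> one exists by
  \<open>extend_to_half_twist_word\<close>.\<close>

definition half_twist :: "nat set \<Rightarrow> braid" where
  "half_twist J = br (SOME w. half_twist_word J w)"

lemma finite_block: "finite J \<Longrightarrow> finite (block J)"
proof (rule finite_subset)
  show "block J \<subseteq> J \<times> Suc ` J"
  proof
    fix x assume "x \<in> block J"
    then obtain p q where x: "x = (p, q)" "p < q" "{p..<q} \<subseteq> J" by (auto simp: block_def)
    then have "p \<in> J" "q - 1 \<in> J" "q = Suc (q - 1)" by auto
    then show "x \<in> J \<times> Suc ` J" using x by blast
  qed
qed auto

text \<open>The right side mentions the permutation only through its inversion set, so that equal
  inversion sets stay equal when a letter is split off in
  \<open>reduced_Inv_braid_eq\<close>.\<close>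

lemma Inv_comp_swap_iff:
  assumes "\<pi> i \<noteq> \<pi> (Suc i)"
  shows "(p, q) \<in> Inv (\<pi> \<circ> swap i) \<longleftrightarrow>
    p < q \<and> (if (p, q) = (i, Suc i) then (p, q) \<notin> Inv \<pi> else (swap i p, swap i q) \<in> Inv \<pi>)"
  using assms by (auto simp: Inv_def Transposition.transpose_def)

lemma Inv_strand_subset: "set w \<subseteq> J \<Longrightarrow> Inv (strand w) \<subseteq> block J"
proof (induction w)
  case Nil
  have "Inv (strand []) \<subseteq> block J" by simp
  then show ?case .
next
  case (Cons i w)
  have "(p, q) \<in> block J" if "(p, q) \<in> Inv (strand (i # w))" for p q
  proof (cases "(p, q) = (i, Suc i)")
    case True
    then show ?thesis using Cons.prems by (auto simp: block_def)
  next
    case False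
    then have "p < q" and "(swap i p, swap i q) \<in> block J"
      using that Cons by (auto simp: strand_Cons Inv_comp_swap_iff)
    moreover have "i \<in> J" using Cons.prems by simp
    moreover have "{p..<q} \<subseteq> insert i {swap i p..<swap i q}"
      using False \<open>p < q\<close> by (auto simp: Transposition.transpose_def)
    ultimately show ?thesis by (auto simp: block_def)
  qed
  then have "Inv (strand (i # w)) \<subseteq> block J" by auto
  then show ?case .
qed

lemma strand_descents:
  assumes "\<And>i. i \<in> J \<Longrightarrow> strand w (Suc i) < strand w i"
  shows "block J \<subseteq> Inv (strand w)"
proof -
  have "{p..<p + Suc k} \<subseteq> J \<Longrightarrow> strand w (p + Suc k) < strand w p" for p k
  proof (induction k)
    case 0
    then show ?case using assms[of p] by auto
  next
    case (Suc k)
    then have "strand w (p + Suc k) < strand w p" by (auto simp: subset_iff)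
    moreover have "strand w (Suc (p + Suc k)) < strand w (p + Suc k)"
      using Suc.prems by (intro assms) auto
    ultimately show ?case by (metis add_Suc_right less_trans)
  qed
  then have "strand w q < strand w p" if "p < q" "{p..<q} \<subseteq> J" for p q
    using that by (metis add_Suc_right less_iff_Suc_add)
  then show ?thesis by (auto simp: block_def Inv_def)
qed

text \<open>The descents force all pairs of \<open>block J\<close>, the letters permit no others,
  and the length bound then makes the word reduced.\<close>

lemma half_twist_wordI:
  assumes "finite J" "set w \<subseteq> J" "length w \<le> card (block J)"
    and "\<And>i. i \<in> J \<Longrightarrow> strand w (Suc i) < strand w i"
  shows "half_twist_word J w"
proof -
  have "Inv (strand w) = block J" using strand_descents Inv_strand_subset assms by blast
  moreover from this have "reduced w" using card_Inv_strand_le[of w] assms by (simp add: reduced_def)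
  ultimately show ?thesis using assms by (simp add: half_twist_word_def)
qed

lemma half_twist_wordI_card:
  assumes "finite J" "set w \<subseteq> J" "reduced w" "length w = card (block J)"
  shows "half_twist_word J w"
  using assms card_subset_eq[OF finite_block[OF assms(1)] Inv_strand_subset[OF assms(2)]]
  by (simp add: half_twist_word_def reduced_def)

lemma half_twist_word_length: "half_twist_word J w \<Longrightarrow> length w = card (block J)"
  by (simp add: half_twist_word_def reduced_def)

lemma half_twist_word_descent: "half_twist_word J w \<Longrightarrow> i \<in> J \<Longrightarrow> strand w (Suc i) < strand w i"
proof -
  assume "half_twist_word J w" "i \<in> J"
  then have "(i, Suc i) \<in> Inv (strand w)" by (auto simp: half_twist_word_def block_def)
  then show ?thesis by (simp add: Inv_def)
qed

text \<open>Prefix an ascent from \<open>J\<close> as long as there is one. The words stay reduced,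
  hence no longer than \<open>card (block J)\<close>, and without ascents all pairs of the block are
  inverted.\<close>

lemma extend_to_half_twist_word:
  assumes "finite J" "reduced u" "set u \<subseteq> J"
  obtains v where "set v \<subseteq> J" "half_twist_word J (v @ u)"
proof -
  have "\<exists>v. set v \<subseteq> J \<and> half_twist_word J (v @ u)"
    using assms(2,3)
  proof (induction "card (block J) - length u" arbitrary: u rule: less_induct)
    case less
    show ?case
    proof (cases "\<exists>i\<in>J. strand u i < strand u (Suc i)")
      case True
      then obtain i where i: "i \<in> J" "strand u i < strand u (Suc i)" by blast
      then have r: "reduced (i # u)" using less.prems by (simp add: reduced_Cons)
      moreover have "length (i # u) \<le> card (block J)"
        using r Inv_strand_subset[of "i # u" J] less.prems i finite_block[OF assms(1)]
        unfolding reduced_def by (metis card_mono insert_subset list.simps(15))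
      ultimately obtain v where "set v \<subseteq> J" "half_twist_word J (v @ i # u)"
        using less.hyps[OF _ r] less.prems i
        by (metis Suc_le_lessD diff_less_mono2 insert_subset length_Cons lessI list.simps(15))
      then show ?thesis using i by (intro exI[of _ "v @ [i]"]) auto
    next
      case False
      then have "strand u (Suc i) < strand u i" if "i \<in> J" for i
        using that by (metis linorder_neqE_nat n_not_Suc_n strand_eq_iff)
      then have "Inv (strand u) = block J" using strand_descents Inv_strand_subset less.prems by blast
      then show ?thesis using less.prems by (intro exI[of _ "[]"]) (simp add: half_twist_word_def)
    qed
  qed
  then show ?thesis using that by blast
qed

text \<open>A permutation is determined by its inversions; on words this follows by splitting off
  the first letter, which is a descent of both permutations.\<close>

lemma reduced_Inv_braid_eq:
  assumes "reduced u" "reduced v" "Inv (strand u) = Inv (strand v)"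
  shows "u \<approx> v"
  using assms
proof (induction u arbitrary: v)
  case Nil
  have "Inv (strand v) = Inv (strand [])" by (rule Nil(3)[symmetric])
  then show ?case using Nil(2) by (simp add: reduced_def)
next
  case (Cons i u)
  have "strand (i # u) (Suc i) < strand (i # u) i" using Cons.prems(1) by (simp add: reduced_Cons strand_Cons)
  then have "(i, Suc i) \<in> Inv (strand v)" using Cons.prems(3) by (auto simp: Inv_def)
  then obtain w where w: "v \<approx> i # w" "reduced (i # w)"
    using reduced_descent[OF Cons.prems(2)] by (auto simp: Inv_def)
  have "strand u = strand (i # u) \<circ> swap i" "strand w = strand (i # w) \<circ> swap i"
    by (auto simp: strand_Cons comp_assoc)
  moreover have "Inv (strand (i # u)) = Inv (strand (i # w))"
    using Cons.prems(3) strand_braid_eq[OF w(1)] by simp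
  ultimately have "(p, q) \<in> Inv (strand u) \<longleftrightarrow> (p, q) \<in> Inv (strand w)" for p q
    using Inv_comp_swap_iff[of "strand (i # u)" i p q] Inv_comp_swap_iff[of "strand (i # w)" i p q]
    by simp
  then have "Inv (strand u) = Inv (strand w)" by (intro equalityI subrelI) simp_all
  then have "u \<approx> w" using Cons w by (simp add: reduced_Cons)
  then have "i # u \<approx> i # w" by (rule braid_eq_Cons)
  also have "\<dots> \<approx> v" using w(1) by (rule braid_eq_sym)
  finally show ?case .
qed

lemma half_twist_eq_br:
  assumes "half_twist_word J w"
  shows "half_twist J = br w"
proof -
  have "half_twist_word J (SOME w. half_twist_word J w)" using assms by (rule someI)
  then show ?thesis using assms reduced_Inv_braid_eq
    by (auto simp: half_twist_def br_eq_iff half_twist_word_def)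
qed

lemma obtain_half_twist_word:
  assumes "finite J"
  obtains w where "half_twist_word J w" "half_twist J = br w"
proof -
  obtain v where "half_twist_word J (v @ [])"
    using extend_to_half_twist_word[OF assms, of "[]"] by auto
  then show ?thesis using that half_twist_eq_br by blast
qed

lemma half_twist_empty [simp]: "half_twist {} = 1"
proof -
  have "half_twist_word {} []" by (auto simp: half_twist_word_def block_def)
  then show ?thesis using half_twist_eq_br by fastforce
qed

lemma strand_rev [simp]: "strand (rev w) (strand w p) = p"
  by (induction w arbitrary: p) (auto simp: strand_Cons strand_append)

lemma reduced_rev: "reduced w \<Longrightarrow> reduced (rev w)"
proof -
  assume w: "reduced w"
  obtain x where x: "strand x = strand (rev w)" "reduced x"
    using ex_reduced_word[OF bij_strand finite_Inv_strand] by blast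
  have "strand (rev x) (strand x (strand w p)) = strand w p" for p by simp
  then have "strand (rev x) = strand w" by (simp add: x(1) fun_eq_iff)
  then have "length w \<le> length x"
    using w card_Inv_strand_le[of "rev x"] by (simp add: reduced_def)
  then show ?thesis using x card_Inv_strand_le[of "rev w"] by (simp add: reduced_def)
qed

lemma half_twist_word_rev:
  assumes "finite J" "half_twist_word J w"
  shows "half_twist_word J (rev w)"
  using assms(2) half_twist_word_length[OF assms(2)]
  by (intro half_twist_wordI_card[OF assms(1)]) (auto simp: half_twist_word_def reduced_rev)

lemma mirror_half_twist [simp]: "finite J \<Longrightarrow> mirror (half_twist J) = half_twist J"
  by (metis half_twist_eq_br half_twist_word_rev mirror_br obtain_half_twist_word)

text \<open>The source of complements, which are the lifts of the elements \<open>w_{J;K}\<close>.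
  Reduced words are extended at their left end, hence the double reversal.\<close>

lemma half_twist_left_divides:
  assumes "finite K" "J \<subseteq> K"
  obtains v where "set v \<subseteq> K" "half_twist J * br v = half_twist K"
proof -
  obtain u where u: "half_twist_word J u" "half_twist J = br u"
    using obtain_half_twist_word assms finite_subset by metis
  have "reduced (rev u)" "set (rev u) \<subseteq> K" using u assms by (auto simp: half_twist_word_def reduced_rev)
  then obtain v where "set v \<subseteq> K" "half_twist_word K (v @ rev u)"
    using extend_to_half_twist_word[OF assms(1)] by blast
  then have "set (rev v) \<subseteq> K" "half_twist J * br (rev v) = half_twist K"
    using half_twist_eq_br half_twist_word_rev[OF assms(1)] u by (fastforce simp: br_append)+
  then show ?thesis by (rule that)
qed

text \<open>With this criterion an identity between half twists needs a count of letters and the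
  final positions of pairs of neighbouring strands only.\<close>

lemma half_twist_mult_eqI:
  assumes "finite K" "J \<subseteq> K" "set v \<subseteq> K"
    and "length v + card (block J) \<le> card (block K)"
    and "\<And>u i. half_twist_word J u \<Longrightarrow> i \<in> K \<Longrightarrow> strand v (strand u (Suc i)) < strand v (strand u i)"
  shows "half_twist K = half_twist J * br v"
proof -
  obtain u where u: "half_twist_word J u" "half_twist J = br u"
    using obtain_half_twist_word assms finite_subset by metis
  have "half_twist_word K (u @ v)"
    using u assms half_twist_word_length[OF u(1)]
    by (intro half_twist_wordI) (auto simp: strand_append half_twist_word_def)
  then show ?thesis using half_twist_eq_br u by (simp add: br_append)
qed

section \<open>Half twists of intervals and of sets with isolated points\<close>

lemma strand_fixes: "p \<notin> set w \<Longrightarrow> p \<notin> Suc ` set w \<Longrightarrow> strand w p = p"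
  by (induction w) (auto simp: strand_Cons)

lemma strand_interval:
  assumes "set w \<subseteq> {p..<q}" "x \<in> {p..q}"
  shows "strand w x \<in> {p..q}"
  using assms by (induction w arbitrary: x) (auto simp: strand_Cons Transposition.transpose_def)

lemma strand_upt: "p \<le> q \<Longrightarrow> strand [p..<q] x = (if x = p then q else if p < x \<and> x \<le> q then x - 1 else x)"
proof (induction "q - p" arbitrary: p x)
  case (Suc k)
  then have "[p..<q] = p # [Suc p..<q]" by (simp add: upt_conv_Cons)
  moreover have "strand [Suc p..<q] y = (if y = Suc p then q else if Suc p < y \<and> y \<le> q then y - 1 else y)" for y
    using Suc by (intro Suc.hyps(1)) auto
  ultimately show ?case using Suc by (auto simp: strand_Cons Transposition.transpose_def)
qed auto

lemma strand_rev_upt: "p \<le> q \<Longrightarrow> strand (rev [p..<q]) x = (if x = q then p else if p \<le> x \<and> x < q then Suc x else x)"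
proof (induction q arbitrary: x)
  case (Suc q)
  then show ?case by (cases "p = Suc q") (auto simp: strand_Cons Transposition.transpose_def)
qed auto

lemma block_interval: "block {p..<q} = {(x, y). p \<le> x \<and> x < y \<and> y \<le> q}"
proof -
  have "{x..<y} \<subseteq> {p..<q} \<longleftrightarrow> p \<le> x \<and> y \<le> q" if "x < y" for x y using that by auto
  then show ?thesis by (auto simp: block_def)
qed


lemma card_block_interval_Suc:
  assumes "p \<le> q"
  shows "card (block {p..<Suc q}) = card (block {p..<q}) + (Suc q - p)"
proof -
  have "block {p..<Suc q} = block {p..<q} \<union> (\<lambda>x. (x, Suc q)) ` {p..q}"
    by (auto simp: block_interval)
  moreover have "block {p..<q} \<inter> (\<lambda>x. (x, Suc q)) ` {p..q} = {}"
    by (auto simp: block_interval)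
  moreover have "card ((\<lambda>x. (x, Suc q)) ` {p..q}) = Suc q - p"
    by (subst card_image) (auto simp: inj_on_def)
  ultimately show ?thesis by (simp add: card_Un_disjoint finite_block)
qed


text \<open>After the half twist of the strands from \<open>p\<close> to \<open>q\<close>, the
  strand \<open>Suc q\<close> is carried across all of them.\<close>

lemma half_twist_interval_right:
  assumes "p \<le> q"
  shows "half_twist {p..<Suc q} = half_twist {p..<q} * br (rev [p..<Suc q])"
proof (rule half_twist_mult_eqI)
  show "length (rev [p..<Suc q]) + card (block {p..<q}) \<le> card (block {p..<Suc q})"
    using assms by (simp add: card_block_interval_Suc)
next
  fix u i assume u: "half_twist_word {p..<q} u" and i: "i \<in> {p..<Suc q}"
  have r: "strand u x \<in> {p..q}" if "x \<in> {p..q}" for x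
    using strand_interval[OF _ that] u by (simp add: half_twist_word_def)
  have S: "strand (rev [p..<Suc q]) x = (if x = Suc q then p else if p \<le> x \<and> x < Suc q then Suc x else x)" for x
    using assms by (intro strand_rev_upt) simp
  show "strand (rev [p..<Suc q]) (strand u (Suc i)) < strand (rev [p..<Suc q]) (strand u i)"
  proof (cases "i = q")
    case True
    have "strand u (Suc q) = Suc q" using u by (intro strand_fixes) (auto simp: half_twist_word_def)
    then show ?thesis using r[of q] True assms unfolding S by auto
  next
    case False
    then show ?thesis using r[of i] r[of "Suc i"] half_twist_word_descent[OF u, of i] i unfolding S by auto
  qed
qed auto

lemma half_twist_interval_left:
  assumes "p < q"
  shows "half_twist {p..<q} = half_twist {Suc p..<q} * br [p..<q]"
proof (rule half_twist_mult_eqI)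
  have "block {p..<q} = block {Suc p..<q} \<union> (\<lambda>x. (p, x)) ` {Suc p..q}"
    by (auto simp: block_interval)
  moreover have "block {Suc p..<q} \<inter> (\<lambda>x. (p, x)) ` {Suc p..q} = {}"
    by (auto simp: block_interval)
  moreover have "card ((\<lambda>x. (p, x)) ` {Suc p..q}) = q - p"
    by (subst card_image) (auto simp: inj_on_def)
  ultimately show "length [p..<q] + card (block {Suc p..<q}) \<le> card (block {p..<q})"
    by (simp add: card_Un_disjoint finite_block)
next
  fix u i assume u: "half_twist_word {Suc p..<q} u" and i: "i \<in> {p..<q}"
  have r: "strand u x \<in> {Suc p..q}" if "x \<in> {Suc p..q}" for x
    using strand_interval[OF _ that] u by (simp add: half_twist_word_def)
  have S: "strand [p..<q] x = (if x = p then q else if p < x \<and> x \<le> q then x - 1 else x)" for x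
    using assms by (intro strand_upt) simp
  show "strand [p..<q] (strand u (Suc i)) < strand [p..<q] (strand u i)"
  proof (cases "i = p")
    case True
    have "strand u p = p" using u by (intro strand_fixes) (auto simp: half_twist_word_def)
    then show ?thesis using r[of "Suc p"] True assms unfolding S by auto
  next
    case False
    then show ?thesis using r[of i] r[of "Suc i"] half_twist_word_descent[OF u, of i] i
      unfolding S by (auto simp: diff_less_mono)
  qed
qed auto

text \<open>The pair \<open>(i, Suc i)\<close> is the only new inversion, because the neighbours of
  \<open>i\<close> do not belong to \<open>J\<close>.\<close>

lemma half_twist_insert_far:
  assumes "finite J" "\<And>j. j \<in> J \<Longrightarrow> far i j"
  shows "half_twist (insert i J) = half_twist J * T i"
proof (rule half_twist_mult_eqI)
  have "i \<notin> J" "i - 1 \<notin> J \<or> i = 0" "Suc i \<notin> J"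
    using assms(2)[of i] assms(2)[of "i - 1"] assms(2)[of "Suc i"] by (auto simp: far_def)
  have "(p, q) \<in> block (insert i J) \<longleftrightarrow> (p, q) \<in> insert (i, Suc i) (block J)" for p q
  proof
    assume "(p, q) \<in> block (insert i J)"
    then have pq: "p < q" "\<And>x. p \<le> x \<Longrightarrow> x < q \<Longrightarrow> x = i \<or> x \<in> J"
      by (auto simp: block_def)
    show "(p, q) \<in> insert (i, Suc i) (block J)"
    proof (cases "p \<le> i \<and> i < q")
      case True
      have "p = i"
      proof (rule ccontr)
        assume "p \<noteq> i"
        then have "p \<le> i - 1" "i - 1 < q" "i - 1 \<noteq> i" "i \<noteq> 0" using True by auto
        then show False using pq(2)[of "i - 1"] \<open>i - 1 \<notin> J \<or> i = 0\<close> by simp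
      qed
      moreover have "q = Suc i" using pq(2)[of "Suc i"] True \<open>Suc i \<notin> J\<close> by (cases "q = Suc i") auto
      ultimately show ?thesis by simp
    next
      case False
      then have "{p..<q} \<subseteq> J" using pq(2) by force
      then show ?thesis using pq(1) by (simp add: block_def)
    qed
  qed (auto simp: block_def)
  then have "block (insert i J) = insert (i, Suc i) (block J)"
    by (intro equalityI subrelI) simp_all
  moreover have "(i, Suc i) \<notin> block J" using \<open>i \<notin> J\<close> by (auto simp: block_def)
  ultimately show "length [i] + card (block J) \<le> card (block (insert i J))"
    by (simp add: finite_block assms)
next
  fix u j assume u: "half_twist_word J u" and j: "j \<in> insert i J"
  have "far i k" if "k \<in> set u" for k
    using u assms(2) that by (auto simp: half_twist_word_def)
  then have "i \<notin> set u" "Suc i \<notin> set u" "i \<notin> Suc ` set u" by (fastforce simp: far_def)+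
  then have fx: "strand u i = i" "strand u (Suc i) = Suc i"
    by (auto simp: strand_fixes image_iff)
  show "strand [i] (strand u (Suc j)) < strand [i] (strand u j)"
  proof (cases "j = i")
    case True
    then show ?thesis by (simp add: fx strand_Cons)
  next
    case False
    then have "j \<in> J" "far i j" using j assms(2) by auto
    then have "strand u j \<noteq> strand u i" "strand u j \<noteq> strand u (Suc i)"
      "strand u (Suc j) \<noteq> strand u i" "strand u (Suc j) \<noteq> strand u (Suc i)"
      by (auto simp: far_def)
    then show ?thesis using half_twist_word_descent[OF u \<open>j \<in> J\<close>] unfolding fx by (simp add: strand_Cons)
  qed
qed (use assms in auto)

lemma br_commute:
  assumes "\<And>i j. i \<in> set u \<Longrightarrow> j \<in> set v \<Longrightarrow> far i j"
  shows "br u * br v = br v * br u"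
proof -
  have T: "T i * br v = br v * T i" if "\<And>j. j \<in> set v \<Longrightarrow> far i j" for i v
    using that
  proof (induction v)
    case (Cons j v)
    then show ?case by (metis T_far br_Cons list.set_intros mult.assoc)
  qed simp
  show ?thesis using assms
  proof (induction u)
    case (Cons i u)
    then show ?case by (metis T br_Cons list.set_intros mult.assoc)
  qed simp
qed

lemma half_twist_commute:
  assumes "finite J" "\<And>i j. i \<in> set u \<Longrightarrow> j \<in> J \<Longrightarrow> far i j"
  shows "br u * half_twist J = half_twist J * br u"
proof -
  obtain w where "half_twist_word J w" "half_twist J = br w"
    using obtain_half_twist_word assms(1) by blast
  then show ?thesis using assms(2) by (auto simp: half_twist_word_def intro!: br_commute)
qed

text \<open>Products of pairwise commuting generators thereby become half twists of sets, and the
  order of their letters no longer matters.\<close>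

lemma half_twist_Un_far:
  assumes "finite J" "distinct w" "J \<inter> set w = {}"
    and "\<And>i j. i \<in> set w \<Longrightarrow> j \<in> J \<union> set w \<Longrightarrow> i = j \<or> far i j"
  shows "half_twist (J \<union> set w) = half_twist J * br w"
  using assms
proof (induction w arbitrary: J)
  case (Cons i w)
  have "half_twist (insert i J \<union> set w) = half_twist (insert i J) * br w"
  proof (rule Cons.IH)
    fix k j assume "k \<in> set w" "j \<in> insert i J \<union> set w"
    then show "k = j \<or> far k j" using Cons.prems(4)[of k j] by auto
  qed (use Cons.prems(1-3) in auto)
  moreover have "half_twist (insert i J) = half_twist J * T i"
  proof (rule half_twist_insert_far)
    fix j assume "j \<in> J"
    then show "far i j" using Cons.prems(3) Cons.prems(4)[of i j] by auto
  qed (rule Cons.prems(1))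
  moreover have "br (i # w) = T i * br w" by (rule br_Cons)
  ultimately show ?case by (simp add: mult.assoc)
qed simp

text \<open>Only \<open>g i\<close> and \<open>g (Suc i)\<close> interact with each other; the
  factors before them commute with \<open>g (Suc i)\<close> and those after them with
  \<open>g i\<close>. The family is general because both the generators (\<open>br_upt_T\<close>)
  and the factors of type B (\<open>seq_prod_shift\<close>) are inserted for it.\<close>

lemma prod_upt_shift:
  fixes g :: "nat \<Rightarrow> 'a::monoid_mult"
  assumes "p \<le> i" "Suc i < q"
    and below: "\<And>j. p \<le> j \<Longrightarrow> j < i \<Longrightarrow> g j * g (Suc i) = g (Suc i) * g j"
    and above: "\<And>j. Suc i < j \<Longrightarrow> j < q \<Longrightarrow> g i * g j = g j * g i"
    and braid: "g i * g (Suc i) * g i = g (Suc i) * g i * g (Suc i)"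
  shows "prod_list (map g [p..<q]) * g i = g (Suc i) * prod_list (map g [p..<q])"
proof -
  define A where "A = prod_list (map g [p..<i])"
  define B where "B = prod_list (map g [Suc (Suc i)..<q])"
  have e: "[p..<q] = [p..<i] @ [i, Suc i] @ [Suc (Suc i)..<q]"
    using upt_add_eq_append[of p i "q - i"] assms(1,2) by (simp add: upt_conv_Cons)
  have "A * g (Suc i) = g (Suc i) * A" if "k \<le> i" "A = prod_list (map g [p..<k])" for k A
    using that
  proof (induction k arbitrary: A)
    case (Suc k)
    show ?case
    proof (cases "p \<le> k")
      case True
      then have "A = prod_list (map g [p..<k]) * g k" using Suc.prems by simp
      then show ?thesis using Suc.IH[OF _ HOL.refl] below[of k] True Suc.prems by (metis Suc_le_eq Suc_leD mult.assoc)
    qed (use Suc.prems in simp)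
  qed simp
  then have 2: "A * g (Suc i) = g (Suc i) * A" by (simp add: A_def)
  have "g i * B = B * g i" if "k \<le> q" "B = prod_list (map g [Suc (Suc i)..<k])" for k B
    using that
  proof (induction k arbitrary: B)
    case (Suc k)
    show ?case
    proof (cases "Suc (Suc i) \<le> k")
      case True
      then have "B = prod_list (map g [Suc (Suc i)..<k]) * g k" using Suc.prems by simp
      then show ?thesis using Suc.IH[OF _ HOL.refl] above[of k] True Suc.prems by (metis Suc_le_eq Suc_leD mult.assoc)
    qed (use Suc.prems in simp)
  qed simp
  then have 1: "g i * B = B * g i" by (simp add: B_def)
  have E: "prod_list (map g [p..<q]) = A * g i * g (Suc i) * B"
    by (simp add: e A_def B_def mult.assoc)
  have "prod_list (map g [p..<q]) * g i = A * (g i * g (Suc i) * g i) * B"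
    by (simp add: E 1 mult.assoc)
  also have "\<dots> = g (Suc i) * (A * g i * g (Suc i) * B)"
    unfolding braid mult.assoc[symmetric] 2 by (rule HOL.refl)
  finally show ?thesis unfolding E .
qed

lemma br_eq_prod_list: "br w = prod_list (map T w)"
  by (induction w) (simp_all, metis br_Cons)

lemma br_upt_T:
  assumes "p \<le> i" "Suc i < q"
  shows "br [p..<q] * T i = T (Suc i) * br [p..<q]"
  unfolding br_eq_prod_list[of "[p..<q]"]
  using assms by (intro prod_upt_shift T_far T_adj) (auto simp: far_def adj_def)

lemma br_rev_upt_T:
  assumes "p \<le> i" "Suc i < q"
  shows "T i * br (rev [p..<q]) = br (rev [p..<q]) * T (Suc i)"
  using arg_cong[OF br_upt_T[OF assms], of mirror] by (simp add: mirror_mult mirror_br)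

text \<open>Conjugation by the half twist reverses the diagram. In the induction the half twist of
  the shorter interval reflects the letter, and the descending word that adds a strand then raises
  it by one.\<close>

lemma T_half_twist_interval:
  assumes "i \<in> {p..<q}"
  shows "T i * half_twist {p..<q} = half_twist {p..<q} * T (p + q - Suc i)"
  using assms
proof (induction q arbitrary: i)
  case (Suc q)
  have below: "T j * half_twist {p..<Suc q} = half_twist {p..<Suc q} * T (p + Suc q - Suc j)"
    if "j \<in> {p..<q}" for j
  proof -
    define k where "k = p + q - Suc j"
    have R: "half_twist {p..<Suc q} = half_twist {p..<q} * br (rev [p..<Suc q])"
      using that by (intro half_twist_interval_right) simp
    have "T j * half_twist {p..<Suc q} = half_twist {p..<q} * T k * br (rev [p..<Suc q])"
      unfolding R mult.assoc[symmetric] k_def by (simp only: Suc.IH[OF that])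
    also have "\<dots> = half_twist {p..<q} * (br (rev [p..<Suc q]) * T (Suc k))"
      unfolding mult.assoc using that by (subst br_rev_upt_T[of p k "Suc q"]) (auto simp: k_def)
    also have "\<dots> = half_twist {p..<Suc q} * T (Suc k)" by (simp only: R mult.assoc)
    also have "Suc k = p + Suc q - Suc j" using that by (auto simp: k_def)
    finally show ?thesis .
  qed
  show ?case
  proof (cases "i = q")
    case False
    then show ?thesis using below Suc.prems by auto
  next
    case True
    show ?thesis
    proof (cases "p = q")
      case True
      then show ?thesis using \<open>i = q\<close> half_twist_interval_right[of q q] by simp
    next
      \<comment> \<open>The last generator lies outside the shorter interval; its relation is the
        mirror image of the one for the first generator.\<close>
      case False
      then have "T p * half_twist {p..<Suc q} = half_twist {p..<Suc q} * T q"
        using below[of p] Suc.prems \<open>i = q\<close> by simp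
      from arg_cong[OF this, of mirror] show ?thesis using \<open>i = q\<close>
        by (simp add: mirror_mult mirror_br)
    qed
  qed
qed simp

section \<open>Powers of Coxeter elements\<close>

definition seq_prod :: "(nat \<Rightarrow> 'a::monoid_mult) \<Rightarrow> nat \<Rightarrow> 'a" where
  "seq_prod g k = prod_list (map g [0..<k])"

text \<open>For \<open>k\<close> and \<open>k - 1\<close> these are the two colour classes of the
  path \<open>0, ..., k - 1\<close>, so that their product is the bipartite Coxeter element.\<close>

fun alt_prod :: "(nat \<Rightarrow> 'a::monoid_mult) \<Rightarrow> nat \<Rightarrow> 'a" where
  "alt_prod g 0 = 1"
| "alt_prod g (Suc 0) = g 0"
| "alt_prod g (Suc (Suc k)) = g (Suc k) * alt_prod g k"

text \<open>The palindromes \<open>g j ... g 1 g 0 g 1 ... g j\<close>, whose product is the Garside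
  element of type B.\<close>

fun nest_prod :: "(nat \<Rightarrow> 'a::monoid_mult) \<Rightarrow> nat \<Rightarrow> 'a" where
  "nest_prod g 0 = g 0"
| "nest_prod g (Suc j) = g (Suc j) * nest_prod g j * g (Suc j)"

lemma seq_prod_Suc: "seq_prod g (Suc k) = seq_prod g k * g k"
  by (simp add: seq_prod_def)

lemma nest_prod_eq:
  "nest_prod g r = prod_list (map g (rev [1..<Suc r])) * g 0 * prod_list (map g [1..<Suc r])"
  by (induction r) (simp_all add: mult.assoc)

text \<open>The relations of type \<open>B\<close> on \<open>g 0, \<dots>, g (k - 1)\<close>, with the one between \<open>g 0\<close> and \<open>g 1\<close> left out.\<close>

definition half_braided :: "(nat \<Rightarrow> 'a::monoid_mult) \<Rightarrow> nat \<Rightarrow> bool" where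
  "half_braided g k \<longleftrightarrow>
     (\<forall>i j. Suc i < j \<longrightarrow> j < k \<longrightarrow> g i * g j = g j * g i) \<and>
     (\<forall>i. 1 \<le> i \<longrightarrow> Suc i < k \<longrightarrow> g i * g (Suc i) * g i = g (Suc i) * g i * g (Suc i))"

lemma seq_prod_shift:
  assumes "half_braided g k" "1 \<le> i" "Suc i < k"
  shows "seq_prod g k * g i = g (Suc i) * seq_prod g k"
  unfolding seq_prod_def using assms by (intro prod_upt_shift) (auto simp: half_braided_def)

lemma seq_prod_shift_rev:
  assumes "half_braided g k" "1 \<le> p" "q < k"
  shows "prod_list (map g (rev [Suc p..<Suc q])) * seq_prod g k
    = seq_prod g k * prod_list (map g (rev [p..<q]))"
  using assms(3)
proof (induction q)
  case (Suc q)
  show ?case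
  proof (cases "p \<le> q")
    case True
    then have "prod_list (map g (rev [Suc p..<Suc (Suc q)])) * seq_prod g k
      = g (Suc q) * (prod_list (map g (rev [Suc p..<Suc q])) * seq_prod g k)"
      by (simp add: mult.assoc)
    also have "\<dots> = g (Suc q) * seq_prod g k * prod_list (map g (rev [p..<q]))"
      using Suc by (simp add: mult.assoc)
    also have "\<dots> = seq_prod g k * g q * prod_list (map g (rev [p..<q]))"
      using seq_prod_shift[OF assms(1), of q] Suc.prems True assms(2) by simp
    finally show ?thesis using True by (simp add: mult.assoc)
  qed (use Suc in auto)
qed simp

text \<open>Every further factor \<open>seq_prod g r * g r\<close> is moved to the left of the
  descending product, which lowers the indices there by one and puts a new \<open>g r\<close> in
  front. The bound on \<open>j\<close> keeps \<open>g 0\<close> out of the descending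
  product.\<close>

lemma seq_prod_Suc_power:
  assumes "half_braided g (Suc r)" "j \<le> r"
  shows "seq_prod g (Suc r) ^ j = seq_prod g r ^ j * prod_list (map g (rev [Suc r - j..<Suc r]))"
  using assms(2)
proof (induction j)
  case (Suc j)
  let ?c = "seq_prod g (Suc r)"
  have "?c ^ Suc j = seq_prod g r ^ j * (prod_list (map g (rev [Suc (r - j)..<Suc r])) * ?c)"
    using Suc by (simp add: power_Suc2 mult.assoc Suc_diff_le del: power_Suc)
  also have "\<dots> = seq_prod g r ^ j * (?c * prod_list (map g (rev [r - j..<r])))"
    using Suc.prems by (subst seq_prod_shift_rev[OF assms(1)]) auto
  also have "\<dots> = seq_prod g r ^ Suc j * prod_list (map g (rev [r - j..<Suc r]))"
    by (simp add: seq_prod_Suc power_Suc2 mult.assoc del: power_Suc)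
  finally show ?case by simp
qed simp

text \<open>The power of a Coxeter element of type \<open>B\<close> that is the Garside element, computed without
  the relation between \<open>g 0\<close> and \<open>g 1\<close>.\<close>

theorem seq_prod_power:
  assumes "half_braided g (Suc r)"
  shows "seq_prod g (Suc r) ^ Suc r = prod_list (map (nest_prod g) [0..<Suc r])"
  using assms
proof (induction r)
  case 0
  then show ?case by (simp add: seq_prod_def)
next
  case (Suc r)
  have "half_braided g (Suc r)" using Suc.prems unfolding half_braided_def by (meson less_SucI)
  then have IH: "seq_prod g (Suc r) ^ Suc r = prod_list (map (nest_prod g) [0..<Suc r])"
    by (rule Suc.IH)
  have c: "seq_prod g (Suc (Suc r)) = g 0 * prod_list (map g [1..<Suc (Suc r)])"
    by (simp add: seq_prod_def upt_conv_Cons del: upt_Suc)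
  have "seq_prod g (Suc (Suc r)) ^ Suc (Suc r)
    = seq_prod g (Suc r) ^ Suc r * (prod_list (map g (rev [1..<Suc (Suc r)])) * seq_prod g (Suc (Suc r)))"
    using seq_prod_Suc_power[OF Suc.prems, of "Suc r"]
    by (simp only: power_Suc2[of _ "Suc r"] mult.assoc) simp
  \<comment> \<open>The descending product ends with \<open>g 1\<close>, and the last factor of the
    power begins with \<open>g 0\<close>: together they form the palindrome.\<close>
  also have "\<dots> = seq_prod g (Suc r) ^ Suc r * nest_prod g (Suc r)"
    by (simp only: c nest_prod_eq mult.assoc)
  also have "\<dots> = prod_list (map (nest_prod g) [0..<Suc (Suc r)])"
    by (simp only: IH upt_Suc[of 0 "Suc r"]) (simp add: mult.assoc)
  finally show ?case .
qed

text \<open>The induction runs over products with an extra factor \<open>t\<close> because the last generator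
  of the longer product does not commute with the cyclic shifts that rearrange the shorter one.\<close>

lemma seq_prod_cyclic_alt_prod:
  fixes g :: "nat \<Rightarrow> 'a::monoid_mult"
  assumes one: "1 \<in> S" and mult: "\<And>u v. u \<in> S \<Longrightarrow> v \<in> S \<Longrightarrow> u * v \<in> S"
    and gS: "\<And>i. i < k \<Longrightarrow> g i \<in> S"
    and comm: "\<And>i j. Suc i < j \<Longrightarrow> j < k \<Longrightarrow> g i * g j = g j * g i"
    and cyclic: "\<And>u v. u \<in> S \<Longrightarrow> v \<in> S \<Longrightarrow> Q (u * v) \<Longrightarrow> Q (v * u)"
    and "0 < k" "Q (seq_prod g k)"
  shows "Q (alt_prod g k * alt_prod g (k - 1))"
proof -
  have alt_comm: "alt_prod g l * t = t * alt_prod g l" if "\<And>i. i < l \<Longrightarrow> g i * t = t * g i" for l t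
    using that
  proof (induction g l rule: alt_prod.induct)
    case (3 g k)
    then have "alt_prod g k * t = t * alt_prod g k" "g (Suc k) * t = t * g (Suc k)" by auto
    then show ?case by simp (metis mult.assoc)
  qed auto
  have altS: "alt_prod g l \<in> S" if "l \<le> k" for l
    using that gS
  proof (induction g l rule: alt_prod.induct)
    case (3 g k)
    then show ?case by (auto intro!: mult)
  qed (auto simp: one)
  have "Q (alt_prod g (Suc l) * alt_prod g l * t)"
    if "l < k" "t \<in> S" "\<And>i. i < l \<Longrightarrow> g i * t = t * g i" "Q (seq_prod g (Suc l) * t)" for l t
    using that
  proof (induction l arbitrary: t)
    case 0
    then show ?case by (simp add: seq_prod_def)
  next
    case (Suc l)
    let ?g = "g (Suc l)" and ?A = "alt_prod g (Suc l)" and ?B = "alt_prod g l"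
    have gt: "?g * t \<in> S" using Suc.prems by (intro mult gS) auto
    have gc: "g i * ?g = ?g * g i" if "i < l" for i
      using that Suc.prems by (intro comm) auto
    have "Q (?A * ?B * (?g * t))"
    proof (rule Suc.IH)
      show "g i * (?g * t) = ?g * t * g i" if "i < l" for i
        using gc[OF that] Suc.prems(3)[of i] that by (metis less_SucI mult.assoc)
      show "Q (seq_prod g (Suc l) * (?g * t))"
        using Suc.prems(4) by (simp add: seq_prod_Suc[of _ "Suc l"] mult.assoc)
    qed (use Suc.prems gt in auto)
    moreover have "?B * ?g = ?g * ?B" using gc by (intro alt_comm) auto
    ultimately have "Q (?A * (?g * ?B * t))" by (metis mult.assoc)
    \<comment> \<open>The product \<open>?g * ?B\<close> is \<open>alt_prod g (Suc (Suc l))\<close>;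
      after this shift \<open>t\<close> only has to commute past \<open>?A\<close>.\<close>
    then have "Q ((?g * ?B * t) * ?A)"
      using Suc.prems altS gS by (intro cyclic[of ?A]) (auto intro!: mult)
    moreover have "?A * t = t * ?A" using Suc.prems by (intro alt_comm) auto
    ultimately show ?case by (simp add: mult.assoc)
  qed
  from this[of "k - 1" 1] show ?thesis using assms by simp
qed


section \<open>Full twists as powers of linearly ordered products\<close>

lemma br_map_Suc:
  assumes "set u \<subseteq> {p..<q}"
  shows "br [p..<Suc q] * br u = br (map Suc u) * br [p..<Suc q]"
  using assms
proof (induction u)
  case (Cons i u)
  have "br [p..<Suc q] * br (i # u) = (br [p..<Suc q] * T i) * br u"
    by (simp only: br_Cons[of i u] mult.assoc)
  also have "\<dots> = T (Suc i) * (br [p..<Suc q] * br u)"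
    using Cons.prems by (subst br_upt_T) (auto simp: mult.assoc)
  also have "\<dots> = br (map Suc (i # u)) * br [p..<Suc q]"
    using Cons by (simp add: br_Cons[of "Suc i" "map Suc u"] mult.assoc)
  finally show ?case .
qed simp

lemma br_half_twist_interval:
  assumes "set u \<subseteq> {p..<q}"
  shows "br u * half_twist {p..<q} = half_twist {p..<q} * br (map (\<lambda>i. p + q - Suc i) u)"
  using assms
proof (induction u)
  case (Cons i u)
  have "br (i # u) * half_twist {p..<q} = T i * (half_twist {p..<q} * br (map (\<lambda>i. p + q - Suc i) u))"
    using Cons by (simp add: br_Cons[of i u] mult.assoc)
  also have "\<dots> = half_twist {p..<q} * T (p + q - Suc i) * br (map (\<lambda>i. p + q - Suc i) u)"
    using T_half_twist_interval[of i p q] Cons.prems by (simp add: mult.assoc[symmetric])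
  finally show ?case
    by (simp add: br_Cons[of "p + q - Suc i" "map (\<lambda>i. p + q - Suc i) u"] mult.assoc)
qed simp

lemma br_half_twist_interval_square:
  assumes "set u \<subseteq> {p..<q}"
  shows "br u * half_twist {p..<q} ^ 2 = half_twist {p..<q} ^ 2 * br u"
proof -
  have "map (\<lambda>i. p + q - Suc i) (map (\<lambda>i. p + q - Suc i) u) = u"
    using assms by (induction u) auto
  moreover have "set (map (\<lambda>i. p + q - Suc i) u) \<subseteq> {p..<q}" using assms by (fastforce simp: subset_iff)
  ultimately show ?thesis using assms
    by (metis br_half_twist_interval mult.assoc power2_eq_square)
qed

lemma map_flip_upt: "map (\<lambda>i. p + q - Suc i) [p..<q] = rev [p..<q]"
  by (rule nth_equalityI) (auto simp: rev_nth)

lemma half_twist_interval_left_mirror: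
  assumes "p < q"
  shows "half_twist {p..<q} = br (rev [p..<q]) * half_twist {Suc p..<q}"
  using arg_cong[OF half_twist_interval_left[OF assms], of mirror] by (simp add: mirror_mult mirror_br)

text \<open>The new strand runs once around all the others. The descending word that adds it is
  flipped into the ascending one when it passes the second half twist.\<close>

lemma half_twist_square_Suc:
  assumes "p \<le> q"
  shows "half_twist {p..<Suc q} ^ 2 = half_twist {p..<q} ^ 2 * br (rev [p..<Suc q] @ [p..<Suc q])"
proof -
  let ?D = "half_twist {p..<q}" and ?D' = "half_twist {p..<Suc q}"
  have R: "?D' = ?D * br (rev [p..<Suc q])" by (rule half_twist_interval_right[OF assms])
  have "br (rev [p..<Suc q]) * ?D' = ?D' * br (map (\<lambda>i. p + Suc q - Suc i) (rev [p..<Suc q]))"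
    by (rule br_half_twist_interval) auto
  also have "map (\<lambda>i. p + Suc q - Suc i) (rev [p..<Suc q]) = [p..<Suc q]"
    by (simp only: rev_map[symmetric] map_flip_upt rev_rev_ident)
  finally have "?D' * ?D' = ?D * (?D' * br [p..<Suc q])" by (metis R mult.assoc)
  also have "\<dots> = ?D * ?D * br (rev [p..<Suc q] @ [p..<Suc q])"
    by (simp only: R br_append mult.assoc)
  finally show ?thesis by (simp only: power2_eq_square mult.assoc)
qed

lemma mult_power_rotate: "u * (v * u) ^ k = (u * v) ^ k * u" for u v :: "'a::monoid_mult"
proof (induction k)
  case (Suc k)
  have "u * (v * u) ^ Suc k = u * v * (u * (v * u) ^ k)" by (simp add: mult.assoc)
  then show ?case by (simp only: Suc power_Suc mult.assoc)
qed simp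

text \<open>Conjugation by \<open>u\<close> is carried out by cancelling \<open>u\<close> on the
  left. The factor \<open>D\<close> may become another \<open>D'\<close>; this is how
  \<open>full_twist_shifted\<close> moves the band.\<close>

lemma braid_power_rotate:
  fixes u v :: braid
  assumes "D * (u * v) ^ k = Z" "D * u = u * D'" "Z * u = u * Z"
  shows "D' * (v * u) ^ k = Z"
proof -
  have "u * (D' * (v * u) ^ k) = D * (u * (v * u) ^ k)"
    by (simp only: mult.assoc[symmetric] assms(2))
  also have "\<dots> = u * Z" by (simp only: mult_power_rotate mult.assoc[symmetric] assms)
  finally show ?thesis by simp
qed

text \<open>The band consists of the \<open>d\<close> strands at the left end and acts as one thick
  strand: \<open>g 0\<close> takes strand \<open>d + 1\<close> once around it, and every other
  \<open>g i\<close> exchanges two neighbouring strands outside. The exponent is the number of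
  strands outside.\<close>

lemma full_twist_left:
  assumes "1 \<le> d" "d \<le> n"
  shows "half_twist {1..<d} ^ 2 * (br (rev [1..<Suc d]) * br [1..<Suc n]) ^ (Suc n - d)
    = half_twist {1..<Suc n} ^ 2"
proof -
  define g where "g i = (if i = 0 then br (rev [1..<Suc d] @ [1..<Suc d]) else T (d + i))" for i
  define r where "r = n - d"
  have g0: "g 0 = br (rev [1..<Suc d] @ [1..<Suc d])" and gS: "g (Suc i) = T (d + Suc i)" for i
    by (simp_all add: g_def)
  have "half_braided g (Suc r)"
    unfolding half_braided_def
  proof (intro conjI allI impI)
    fix i j assume "Suc i < j" "j < Suc r"
    then show "g i * g j = g j * g i"
      unfolding g_def by (auto intro!: br_commute simp del: upt_Suc) (auto simp: far_def)
  next
    fix i assume "1 \<le> i" "Suc i < Suc r"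
    then show "g i * g (Suc i) * g i = g (Suc i) * g i * g (Suc i)"
      by (simp add: g_def T_adj adj_def)
  qed
  then have P: "seq_prod g (Suc r) ^ Suc r = prod_list (map (nest_prod g) [0..<Suc r])"
    by (rule seq_prod_power)
  have seq: "seq_prod g (Suc i) = br (rev [1..<Suc d] @ [1..<Suc (d + i)])" for i
  proof (induction i)
    case (Suc i)
    have "rev [1..<Suc d] @ [1..<Suc (d + Suc i)] = (rev [1..<Suc d] @ [1..<Suc (d + i)]) @ [d + Suc i]"
      by simp
    then show ?case by (simp only: seq_prod_Suc[of _ "Suc i"] gS Suc.IH br_append)
  qed (simp add: seq_prod_def g0)
  have nest: "nest_prod g i = br (rev [1..<Suc (d + i)] @ [1..<Suc (d + i)])" for i
  proof (induction i)
    case (Suc i)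
    have "nest_prod g (Suc i) = br ((d + Suc i) # (rev [1..<Suc (d + i)] @ [1..<Suc (d + i)]) @ [d + Suc i])"
      by (simp only: nest_prod.simps Suc.IH gS br_Cons[of "d + Suc i" "_ @ _"] br_append mult.assoc)
    then show ?case using assms by simp
  qed (simp add: g0)
  \<comment> \<open>Each palindrome is the factor by which \<open>half_twist_square_Suc\<close> adds
    one strand to the full twist.\<close>
  have "half_twist {1..<d} ^ 2 * prod_list (map (nest_prod g) [0..<i]) = half_twist {1..<d + i} ^ 2" for i
  proof (induction i)
    case (Suc i)
    have "prod_list (map (nest_prod g) [0..<Suc i]) = prod_list (map (nest_prod g) [0..<i]) * nest_prod g i"
      by simp
    then have "half_twist {1..<d} ^ 2 * prod_list (map (nest_prod g) [0..<Suc i])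
      = half_twist {1..<d + i} ^ 2 * nest_prod g i"
      by (simp only: mult.assoc[symmetric] Suc.IH)
    also have "\<dots> = half_twist {1..<Suc (d + i)} ^ 2"
      unfolding nest using assms by (intro half_twist_square_Suc[symmetric]) simp
    finally show ?case by simp
  qed simp
  from this[of "Suc r"] P have "half_twist {1..<d} ^ 2 * seq_prod g (Suc r) ^ Suc r = half_twist {1..<d + Suc r} ^ 2"
    by simp
  then show ?thesis using assms by (simp add: seq r_def br_append Suc_diff_le del: upt_Suc power_Suc)
qed

text \<open>Moving \<open>?B j\<close> to the other end of the product moves the band from the
  strands \<open>j + 1, ..., j + d\<close> one position to the right; \<open>br_map_Suc\<close> then
  restores the first form with \<open>Suc j\<close>. The second equation stops halfway.\<close>

lemma full_twist_shifted:
  assumes "1 \<le> d" "d + j \<le> n"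
  shows "half_twist {Suc j..<j + d} ^ 2 * (br (rev [Suc j..<Suc (j + d)]) * br [1..<Suc n]) ^ (Suc n - d)
      = half_twist {1..<Suc n} ^ 2"
    and "half_twist {Suc (Suc j)..<Suc (j + d)} ^ 2 * (br [1..<Suc n] * br (rev [Suc j..<Suc (j + d)])) ^ (Suc n - d)
      = half_twist {1..<Suc n} ^ 2"
proof -
  let ?Z = "half_twist {1..<Suc n} ^ 2"
  let ?D = "\<lambda>j. half_twist {Suc j..<j + d}" and ?B = "\<lambda>j. br (rev [Suc j..<Suc (j + d)])"
  \<comment> \<open>Both sides are the half twist of the band together with one further
    strand.\<close>
  have D: "?D j * ?B j = ?B j * ?D (Suc j)" if "d + j \<le> n" for j
    using half_twist_interval_right[of "Suc j" "j + d"] assms(1)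
      half_twist_interval_left_mirror[of "Suc j" "Suc (j + d)"] by simp
  have rot: "?D (Suc j) ^ 2 * (br [1..<Suc n] * ?B j) ^ (Suc n - d) = ?Z"
    if "?D j ^ 2 * (?B j * br [1..<Suc n]) ^ (Suc n - d) = ?Z" "d + j \<le> n" for j
  proof (rule braid_power_rotate)
    show "?D j ^ 2 * (?B j * br [1..<Suc n]) ^ (Suc n - d) = ?Z" by fact
    show "?D j ^ 2 * ?B j = ?B j * ?D (Suc j) ^ 2"
      using D[OF that(2)] by (metis mult.assoc power2_eq_square)
    show "?Z * ?B j = ?B j * ?Z"
      using that(2) by (intro br_half_twist_interval_square[symmetric]) auto
  qed
  show 1: "?D j ^ 2 * (?B j * br [1..<Suc n]) ^ (Suc n - d) = ?Z"
    using assms(2)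
  proof (induction j)
    case 0
    then show ?case using full_twist_left[of d n] assms(1) by simp
  next
    case (Suc j)
    have "?D (Suc j) ^ 2 * (br [1..<Suc n] * ?B j) ^ (Suc n - d) = ?Z" using Suc by (intro rot) auto
    moreover have "br [1..<Suc n] * ?B j = br (map Suc (rev [Suc j..<Suc (j + d)])) * br [1..<Suc n]"
      using Suc.prems by (intro br_map_Suc) auto
    moreover have "map Suc (rev [Suc j..<Suc (j + d)]) = rev [Suc (Suc j)..<Suc (Suc j + d)]"
      by (simp only: rev_map[symmetric] map_Suc_upt add_Suc)
    ultimately show ?case by simp
  qed
  show "half_twist {Suc (Suc j)..<Suc (j + d)} ^ 2 * (br [1..<Suc n] * ?B j) ^ (Suc n - d) = ?Z"
    using rot[OF 1 assms(2)] by simp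
qed

section \<open>The bouncing strand\<close>

text \<open>Factor \<open>i\<close> of the linear product is the word \<open>h i\<close>. The factor
  \<open>c\<close> carries the band; it is not a product of commuting generators and is left
  out.\<close>

abbreviation even_letters :: "(nat \<Rightarrow> nat list) \<Rightarrow> nat \<Rightarrow> nat \<Rightarrow> nat \<Rightarrow> nat set" where
  "even_letters h c k e \<equiv> {l. \<exists>i<k. i \<noteq> c \<and> even (i + e) \<and> l \<in> set (h i)}"

abbreviation odd_letters :: "(nat \<Rightarrow> nat list) \<Rightarrow> nat \<Rightarrow> nat \<Rightarrow> nat \<Rightarrow> nat set" where
  "odd_letters h c k e \<equiv> {l. \<exists>i<k. i \<noteq> c \<and> odd (i + e) \<and> l \<in> set (h i)}"

text \<open>The factors of equal parity consist of commuting letters and merge into one half twist,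
  while \<open>g c\<close>, if it occurs, commutes with them and is moved to the front.\<close>

lemma alt_prod_half_twist:
  fixes h :: "nat \<Rightarrow> nat list" and g :: "nat \<Rightarrow> braid"
  assumes g: "\<And>i. i < k \<Longrightarrow> i \<noteq> c \<Longrightarrow> g i = br (h i)"
    and dist: "\<And>i. i < k \<Longrightarrow> i \<noteq> c \<Longrightarrow> distinct (h i)"
    and far: "\<And>i j l l'. i < k \<Longrightarrow> j < k \<Longrightarrow> i \<noteq> c \<Longrightarrow> j \<noteq> c \<Longrightarrow> even (i + j) \<Longrightarrow>
      l \<in> set (h i) \<Longrightarrow> l' \<in> set (h j) \<Longrightarrow> l = l' \<or> far l l'"
    and disj: "\<And>i j. i < j \<Longrightarrow> j < k \<Longrightarrow> i \<noteq> c \<Longrightarrow> j \<noteq> c \<Longrightarrow> set (h i) \<inter> set (h j) = {}"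
    and comm: "\<And>i. i < k \<Longrightarrow> i \<noteq> c \<Longrightarrow> even (i + c) \<Longrightarrow> g i * g c = g c * g i"
  shows "alt_prod g k = (if c < k \<and> odd (c + k) then g c else 1) *
    half_twist (odd_letters h c k k)"
  using assms
proof (induction g k rule: alt_prod.induct)
  case (1 g)
  then show ?case by simp
next
  case (2 g)
  show ?case
  proof (cases "c = 0")
    case False
    have "half_twist ({} \<union> set (h 0)) = half_twist {} * br (h 0)"
      using 2(2)[of 0] 2(3)[of 0 0] False by (intro half_twist_Un_far) auto
    then have "half_twist (set (h 0)) = br (h 0)" by simp
    moreover have "odd_letters h c (Suc 0) (Suc 0) = set (h 0)"
      using False by auto
    ultimately show ?thesis using 2(1)[of 0] False by simp
  qed simp
next
  case (3 g k)
  let ?S = "\<lambda>k. odd_letters h c k k"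
  have IH: "alt_prod g k = (if c < k \<and> odd (c + k) then g c else 1) * half_twist (?S k)"
  proof (rule 3(1))
    show "l = l' \<or> far l l'" if "i < k" "j < k" "i \<noteq> c" "j \<noteq> c" "even (i + j)" "l \<in> set (h i)" "l' \<in> set (h j)"
      for i j l l' using that by (intro 3(4)[of i j]) auto
    show "set (h i) \<inter> set (h j) = {}" if "i < j" "j < k" "i \<noteq> c" "j \<noteq> c" for i j
      using that by (intro 3(5)) auto
    show "g i * g c = g c * g i" if "i < k" "i \<noteq> c" "even (i + c)" for i
      using that by (intro 3(6)) auto
  qed (auto intro: 3(2,3))
  have fin: "finite (?S k)"
  proof (rule finite_subset)
    show "?S k \<subseteq> (\<Union>i<k. set (h i))" by auto
  qed auto
  have S: "?S (Suc (Suc k)) = ?S k \<union> (if Suc k = c then {} else set (h (Suc k)))"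
    by (auto simp: less_Suc_eq)
  show ?case
  proof (cases "Suc k = c")
    case True
    then show ?thesis unfolding S alt_prod.simps(3) IH by (simp flip: True)
  next
    case False
    have "half_twist (?S k \<union> set (h (Suc k))) = half_twist (?S k) * br (h (Suc k))"
    proof (rule half_twist_Un_far)
      show "distinct (h (Suc k))" using 3(3) False by simp
      show "?S k \<inter> set (h (Suc k)) = {}"
      proof -
        have "l \<notin> set (h (Suc k))" if "i < k" "i \<noteq> c" "l \<in> set (h i)" for i l
          using 3(5)[of i "Suc k"] that False by auto
        then show ?thesis by auto
      qed
    next
      fix l l' assume l: "l \<in> set (h (Suc k))" "l' \<in> ?S k \<union> set (h (Suc k))"
      have "\<exists>i<Suc (Suc k). i \<noteq> c \<and> odd (i + k) \<and> l' \<in> set (h i)"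
      proof (cases "l' \<in> set (h (Suc k))")
        case True
        then show ?thesis using False by (intro exI[of _ "Suc k"]) simp
      qed (use l in \<open>auto intro: less_SucI\<close>)
      then obtain i where "i < Suc (Suc k)" "i \<noteq> c" "odd (i + k)" "l' \<in> set (h i)" by blast
      then show "l = l' \<or> far l l'" using 3(4)[of "Suc k" i l l'] l False by simp
    qed (rule fin)
    \<comment> \<open>The new factor stands in front in \<open>alt_prod\<close> but was appended by
      \<open>half_twist_Un_far\<close>; the half twists on both sides are fixed by
      \<open>mirror\<close>.\<close>
    from arg_cong[OF this, of mirror]
    have mir: "half_twist (?S k \<union> set (h (Suc k))) = mirror (br (h (Suc k))) * half_twist (?S k)"
      using fin by (simp add: mirror_mult)
    have "mirror (br (h (Suc k))) = br (h (Suc k))"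
    proof -
      have "half_twist ({} \<union> set (h (Suc k))) = half_twist {} * br (h (Suc k))"
        using 3(3)[of "Suc k"] 3(4)[of "Suc k" "Suc k"] False by (intro half_twist_Un_far) auto
      then show ?thesis by (metis List.finite_set half_twist_empty mirror_half_twist mult_1 sup_bot_left)
    qed
    with mir have H: "half_twist (?S k \<union> set (h (Suc k))) = g (Suc k) * half_twist (?S k)"
      using 3(2)[of "Suc k"] False by simp
    have "g (Suc k) * (if c < k \<and> odd (c + k) then g c else 1) = (if c < k \<and> odd (c + k) then g c else 1) * g (Suc k)"
      using 3(6)[of "Suc k"] False by auto
    moreover have "c < Suc (Suc k) \<and> odd (c + Suc (Suc k)) \<longleftrightarrow> c < k \<and> odd (c + k)"
      using False by (auto simp: less_Suc_eq)
    ultimately show ?thesis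
      unfolding S using False by (simp only: alt_prod.simps IH H if_False mult.assoc[symmetric])
  qed
qed

text \<open>Passage from the linear to the bipartite order, with cyclic shifts allowed for elements
  that commute with \<open>D\<close> and \<open>Z\<close>. The parity of \<open>c + k\<close>
  decides whether \<open>x\<close> is the longer or the shorter alternating product; one more shift
  exchanges the two factors and yields the second equation.\<close>

theorem bipartite_power:
  fixes h :: "nat \<Rightarrow> nat list" and g :: "nat \<Rightarrow> braid"
  assumes "c < k" and g: "\<And>i. i < k \<Longrightarrow> i \<noteq> c \<Longrightarrow> g i = br (h i)"
    and dist: "\<And>i. i < k \<Longrightarrow> i \<noteq> c \<Longrightarrow> distinct (h i)"
    and far: "\<And>i j l l'. i < k \<Longrightarrow> j < k \<Longrightarrow> i \<noteq> c \<Longrightarrow> j \<noteq> c \<Longrightarrow> even (i + j) \<Longrightarrow>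
      l \<in> set (h i) \<Longrightarrow> l' \<in> set (h j) \<Longrightarrow> l = l' \<or> far l l'"
    and disj: "\<And>i j. i < j \<Longrightarrow> j < k \<Longrightarrow> i \<noteq> c \<Longrightarrow> j \<noteq> c \<Longrightarrow> set (h i) \<inter> set (h j) = {}"
    and comm: "\<And>i j. Suc i < j \<Longrightarrow> j < k \<Longrightarrow> g i * g j = g j * g i"
    and D: "\<And>i. i < k \<Longrightarrow> g i * D = D * g i" and Z: "\<And>i. i < k \<Longrightarrow> g i * Z = Z * g i"
    and seq: "D * seq_prod g k ^ m = Z"
  defines "x \<equiv> g c * half_twist (even_letters h c k c)"
    and "y \<equiv> half_twist (odd_letters h c k c)"
  shows "D * (x * y) ^ m = Z" "D * (y * x) ^ m = Z"
proof -
  define S where "S = {u. D * u = u * D \<and> Z * u = u * Z}"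
  define Q where "Q u \<longleftrightarrow> D * u ^ m = Z" for u
  have one: "1 \<in> S" by (simp add: S_def)
  have mult: "u * v \<in> S" if "u \<in> S" "v \<in> S" for u v
    using that unfolding S_def by (auto simp: mult.assoc) (metis mult.assoc)+
  have gS: "g i \<in> S" if "i < k" for i using D[OF that] Z[OF that] by (simp add: S_def)
  have cyclic: "Q (v * u)" if "u \<in> S" "v \<in> S" "Q (u * v)" for u v
    using that unfolding S_def Q_def by (intro braid_power_rotate[of D u v]) auto
  have "Q (alt_prod g k * alt_prod g (k - 1))"
    using assms(1) seq by (intro seq_prod_cyclic_alt_prod[where S = S and Q = Q, OF one mult gS comm cyclic])
      (auto simp: Q_def)
  moreover have "alt_prod g k \<in> S" "alt_prod g (k - 1) \<in> S"
  proof -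
    have "alt_prod g l \<in> S" if "l \<le> k" for l
      using that gS by (induction g l rule: alt_prod.induct) (auto simp: one intro!: mult)
    then show "alt_prod g k \<in> S" "alt_prod g (k - 1) \<in> S" by auto
  qed
  ultimately have Q: "Q (alt_prod g k * alt_prod g (k - 1))" "Q (alt_prod g (k - 1) * alt_prod g k)"
    using cyclic by blast+
  have gc: "g i * g c = g c * g i" if "i < k" "i \<noteq> c" "even (i + c)" for i
  proof -
    have "Suc i < c \<or> Suc c < i" using that by presburger
    then show ?thesis using comm[of i c] comm[of c i] assms(1) that by auto
  qed
  have alt: "alt_prod g l = (if c < l \<and> odd (c + l) then g c else 1) *
      half_twist (odd_letters h c l l)" if "l \<le> k" for l
  proof (rule alt_prod_half_twist)
    show "j = j' \<or> far j j'" if "i < l" "i' < l" "i \<noteq> c" "i' \<noteq> c" "even (i + i')" "j \<in> set (h i)" "j' \<in> set (h i')"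
      for i i' j j' using that \<open>l \<le> k\<close> by (intro far[of i i']) auto
    show "set (h i) \<inter> set (h j) = {}" if "i < j" "j < l" "i \<noteq> c" "j \<noteq> c" for i j
      using that \<open>l \<le> k\<close> by (intro disj) auto
    show "g i * g c = g c * g i" if "i < l" "i \<noteq> c" "even (i + c)" for i
      using that \<open>l \<le> k\<close> by (intro gc) auto
  qed (use \<open>l \<le> k\<close> in \<open>auto intro: g dist\<close>)
  have "alt_prod g k = x \<and> alt_prod g (k - 1) = y \<or> alt_prod g k = y \<and> alt_prod g (k - 1) = x"
  proof (cases "odd (c + k)")
    case True
    then have "alt_prod g k = x" unfolding alt[OF order_refl] x_def using assms(1)
      by (auto intro!: arg_cong[of _ _ half_twist] arg_cong2[of _ _ _ _ "(*)"])
    moreover have "odd_letters h c (k - 1) (k - 1) =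
      odd_letters h c k c"
    proof -
      have "i < k - 1 \<and> odd (i + (k - 1)) \<longleftrightarrow> i < k \<and> odd (i + c)" for i
        using True assms(1) by (cases k) (auto simp: less_Suc_eq)
      then show ?thesis by blast
    qed
    then have "alt_prod g (k - 1) = y" using alt[of "k - 1"] True assms(1) by (simp add: y_def)
    ultimately show ?thesis by blast
  next
    case False
    then have "c < k - 1" using assms(1) by (cases k) (auto simp: less_Suc_eq)
    moreover have "odd_letters h c (k - 1) (k - 1) =
      even_letters h c k c"
    proof -
      have "i < k - 1 \<and> odd (i + (k - 1)) \<longleftrightarrow> i < k \<and> even (i + c)" for i
        using False assms(1) by (cases k) (auto simp: less_Suc_eq)
      then show ?thesis by blast
    qed
    ultimately have "alt_prod g (k - 1) = x" using alt[of "k - 1"] False assms(1) by (simp add: x_def)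
    moreover have "odd_letters h c k k =
      odd_letters h c k c"
      using False by auto
    then have "alt_prod g k = y" using alt[of k] False by (simp add: y_def)
    ultimately show ?thesis by blast
  qed
  then show "D * (x * y) ^ m = Z" "D * (y * x) ^ m = Z" using Q by (auto simp: Q_def)
qed


section \<open>The element that exchanges two strands around a band\<close>

definition bounce :: "nat \<Rightarrow> nat \<Rightarrow> braid" where
  "bounce p q = br ([p..<q] @ [q] @ rev [p..<q])"

text \<open>One strand is added on each side of the band \<open>Suc p, ..., q\<close>, first on the
  left and then on the right.\<close>

lemma half_twist_bounce:
  assumes "p < q"
  shows "half_twist {p..<Suc q} = half_twist {Suc p..<q} * bounce p q"
proof -
  have "bounce p q = br [p..<q] * br (rev [p..<Suc q])"
    using assms by (simp add: bounce_def br_append[symmetric])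
  then show ?thesis
    using half_twist_interval_right[of p q] half_twist_interval_left[of p q] assms by (simp add: mult.assoc)
qed

lemma mirror_bounce: "mirror (bounce p q) = bounce p q"
  by (simp add: bounce_def mirror_br)

text \<open>Both products are the half twist of the enlarged band, by \<open>mirror\<close>.\<close>

lemma bounce_half_twist_inner:
  assumes "p < q"
  shows "bounce p q * half_twist {Suc p..<q} = half_twist {Suc p..<q} * bounce p q"
proof -
  have "half_twist {p..<Suc q} = bounce p q * half_twist {Suc p..<q}"
    using arg_cong[OF half_twist_bounce[OF assms], of mirror] by (simp add: mirror_mult mirror_bounce)
  then show ?thesis using half_twist_bounce[OF assms] by metis
qed

text \<open>The two outer strands can be added to the band in either order; cancelling the half
  twist of the band compares the resulting words.\<close>

lemma bounce_reverse:
  assumes "p < q"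
  shows "bounce p q = br (rev [p..<Suc q] @ [Suc p..<Suc q])"
proof -
  have "half_twist {p..<Suc q} = half_twist {Suc p..<Suc q} * br [p..<Suc q]"
    using assms by (intro half_twist_interval_left) simp
  also have "half_twist {Suc p..<Suc q} = half_twist {Suc p..<q} * br (rev [Suc p..<Suc q])"
    using assms by (intro half_twist_interval_right) simp
  finally have "bounce p q = br (rev [Suc p..<Suc q]) * br [p..<Suc q]"
    using half_twist_bounce[OF assms] by (simp add: mult.assoc)
  then show ?thesis using assms by (simp add: br_append[symmetric] upt_conv_Cons del: upt_Suc)
qed

text \<open>The last hypothesis centres the band in the interval. The flip then turns the ascending
  and descending word into the descending and ascending one of
  \<open>bounce_reverse\<close>.\<close>

lemma bounce_half_twist:
  assumes "p < q" "l \<le> p" "q < u" "Suc (p + q) = l + u"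
  shows "bounce p q * half_twist {l..<u} = half_twist {l..<u} * bounce p q"
proof -
  let ?f = "\<lambda>i. l + u - Suc i"
  have 1: "map ?f [p..<Suc q] = rev [p..<Suc q]"
    using map_flip_upt[of p "Suc q"] assms by simp
  have "?f i = Suc p + Suc q - Suc (Suc i)" for i using assms by simp
  then have "map ?f [p..<q] = map (\<lambda>i. Suc p + Suc q - Suc i) (map Suc [p..<q])" by simp
  then have 2: "map ?f [p..<q] = rev [Suc p..<Suc q]"
    using map_flip_upt[of "Suc p" "Suc q"] by (simp only: map_Suc_upt)
  have b: "bounce p q = br ([p..<Suc q] @ rev [p..<q])" using assms by (simp add: bounce_def)
  have "map ?f ([p..<Suc q] @ rev [p..<q]) = rev [p..<Suc q] @ [Suc p..<Suc q]"
    unfolding map_append 1 rev_map[symmetric] 2 rev_rev_ident by (rule HOL.refl)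
  moreover have "br ([p..<Suc q] @ rev [p..<q]) * half_twist {l..<u} =
      half_twist {l..<u} * br (map ?f ([p..<Suc q] @ rev [p..<q]))"
    using assms by (intro br_half_twist_interval) auto
  ultimately show ?thesis using bounce_reverse[OF assms(1)] b by metis
qed

text \<open>The braid relation at the turning point replaces \<open>q\<close>, \<open>Suc q\<close>,
  \<open>q\<close> by \<open>Suc q\<close>, \<open>q\<close>, \<open>Suc q\<close>, and the outer
  two letters move to the ends of the word.\<close>

lemma bounce_extend_right:
  assumes "p < q"
  shows "bounce p (Suc q) = T (Suc q) * bounce p q * T (Suc q)"
proof -
  let ?A = "br [p..<q]" and ?B = "br (rev [p..<q])"
  have c: "T (Suc q) * ?A = ?A * T (Suc q)" "T (Suc q) * ?B = ?B * T (Suc q)"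
    by (intro br_commute; auto simp: far_def)+
  have a: "T q * T (Suc q) * T q = T (Suc q) * T q * T (Suc q)"
    using T_adj[of q "Suc q"] by (simp add: adj_def)
  have "[p..<Suc q] @ [Suc q] @ rev [p..<Suc q] = [p..<q] @ [q] @ [Suc q] @ [q] @ rev [p..<q]"
    using assms by simp
  then have "bounce p (Suc q) = ?A * (T q * T (Suc q) * T q) * ?B"
    by (simp only: bounce_def br_append mult.assoc)
  also have "\<dots> = T (Suc q) * (?A * T q * ?B) * T (Suc q)"
    unfolding a by (metis c mult.assoc)
  finally show ?thesis by (simp only: bounce_def br_append mult.assoc)
qed

lemma bounce_extend_left:
  assumes "p < q"
  shows "bounce p q = T p * bounce (Suc p) q * T p"
proof -
  have "[p..<q] @ [q] @ rev [p..<q] = [p] @ ([Suc p..<q] @ [q] @ rev [Suc p..<q]) @ [p]"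
    using assms by (simp add: upt_conv_Cons)
  then show ?thesis by (simp only: bounce_def br_append mult.assoc)
qed

lemma bounce_far:
  assumes "\<And>i. i \<in> set w \<Longrightarrow> Suc i < p \<or> Suc q < i" "p < q"
  shows "br w * bounce p q = bounce p q * br w"
  unfolding bounce_def
proof (rule br_commute)
  fix i j assume "i \<in> set w" "j \<in> set ([p..<q] @ [q] @ rev [p..<q])"
  then show "far i j" using assms(1)[of i] assms(2) by (auto simp: far_def)
qed

text \<open>When \<open>a + b = n + 1\<close>, the letters on both sides of the band are paired off, and the Garside
  element already occurs as the half turn.\<close>

lemma symmetric_half_twist_seq:
  fixes a b n :: nat
  assumes "1 \<le> a" "a < b" "a + b = Suc n"
  defines "g \<equiv> \<lambda>i. if i = 0 then bounce a b else br [a - i, b + i]"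
  shows "half_twist {Suc a..<b} * seq_prod g a ^ a = half_twist {1..<Suc n}"
proof -
  obtain r where r: "a = Suc r" using assms(1) by (cases a) auto
  have g0: "g 0 = bounce a b" and gS: "g (Suc i) = T (a - Suc i) * T (b + Suc i)" for i
    by (simp_all add: g_def br_append[of "[_]" "[_]", simplified])
  have bb: "half_braided g (Suc r)"
    unfolding half_braided_def
  proof (intro conjI allI impI)
    fix i j assume ij: "Suc i < j" "j < Suc r"
    show "g i * g j = g j * g i"
    proof (cases i)
      case 0
      have "br [a - j, b + j] * bounce a b = bounce a b * br [a - j, b + j]"
        using ij assms(2) r by (intro bounce_far) auto
      then show ?thesis using 0 ij by (simp add: g_def)
    next
      case (Suc i')
      then show ?thesis using ij r assms(2) unfolding g_def
        by (auto intro!: br_commute simp: far_def)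
    qed
  next
    fix i assume i: "1 \<le> i" "Suc i < Suc r"
    let ?a = "a - i" and ?a' = "a - Suc i" and ?b = "b + i" and ?b' = "b + Suc i"
    have far: "T x * T y = T y * T x" if "x \<in> {?a, ?a'}" "y \<in> {?b, ?b'}" for x y
      using that i r assms(2) by (intro T_far) (auto simp: far_def)
    have 1: "T ?a * T ?a' * T ?a = T ?a' * T ?a * T ?a'"
      using i r by (intro T_adj) (auto simp: adj_def)
    have 2: "T ?b * T ?b' * T ?b = T ?b' * T ?b * T ?b'"
      by (intro T_adj) (auto simp: adj_def)
    have comm: "(T x * T y) * (T x' * T y') * (T x'' * T y'') = (T x * T x' * T x'') * (T y * T y' * T y'')"
      if "{x, x', x''} \<subseteq> {?a, ?a'}" "{y, y', y''} \<subseteq> {?b, ?b'}" for x x' x'' y y' y''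
      using that far by (smt (verit, ccfv_threshold) insert_subset mult.assoc)
    have gi: "g i = T ?a * T ?b" "g (Suc i) = T ?a' * T ?b'"
      using gS[of "i - 1"] gS[of i] i by simp_all
    show "g i * g (Suc i) * g i = g (Suc i) * g i * g (Suc i)"
    proof -
      have "g i * g (Suc i) * g i = (T ?a * T ?a' * T ?a) * (T ?b * T ?b' * T ?b)"
        unfolding gi by (rule comm) auto
      moreover have "g (Suc i) * g i * g (Suc i) = (T ?a' * T ?a * T ?a') * (T ?b' * T ?b * T ?b')"
        unfolding gi by (rule comm) auto
      ultimately show ?thesis by (simp only: 1 2)
    qed
  qed
  \<comment> \<open>Surrounding \<open>bounce\<close> by a pair of letters lets it reach one strand
    further on both sides.\<close>
  have nest: "nest_prod g i = bounce (a - i) (b + i)" if "i \<le> r" for i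
    using that
  proof (induction i)
    case (Suc i)
    let ?p = "a - Suc i" and ?q = "b + i"
    have p: "Suc ?p = a - i" using Suc.prems r by simp
    have c: "T ?p * T (Suc ?q) = T (Suc ?q) * T ?p"
      using assms(2) by (intro T_far) (auto simp: far_def)
    have "bounce ?p (Suc ?q) = T (Suc ?q) * (T ?p * bounce (a - i) ?q * T ?p) * T (Suc ?q)"
      using bounce_extend_right[of ?p ?q] bounce_extend_left[of ?p ?q] assms(2) p by simp
    also have "\<dots> = T ?p * T (Suc ?q) * bounce (a - i) ?q * (T ?p * T (Suc ?q))"
      by (metis c mult.assoc)
    finally show ?case using Suc by (simp add: gS)
  qed (simp add: g0)
  \<comment> \<open>By \<open>half_twist_bounce\<close> each factor enlarges the band by one strand
    on either side; after \<open>a\<close> factors it contains all strands.\<close>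
  have "half_twist {Suc a..<b} * prod_list (map (nest_prod g) [0..<i]) = half_twist {Suc a - i..<b + i}"
    if "i \<le> Suc r" for i
    using that
  proof (induction i)
    case (Suc i)
    have "prod_list (map (nest_prod g) [0..<Suc i]) = prod_list (map (nest_prod g) [0..<i]) * nest_prod g i"
      by simp
    then have "half_twist {Suc a..<b} * prod_list (map (nest_prod g) [0..<Suc i])
      = half_twist {Suc a - i..<b + i} * bounce (a - i) (b + i)"
      using Suc nest[of i] by (simp only: mult.assoc[symmetric])
    also have "\<dots> = half_twist {a - i..<Suc (b + i)}"
      using half_twist_bounce[of "a - i" "b + i"] assms(2) Suc.prems r by (simp add: Suc_diff_le)
    finally show ?case by simp
  qed simp
  from this[of "Suc r"] show ?thesis using seq_prod_power[OF bb] r assms(3) by (simp add: add.commute)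
qed


text \<open>The sides are not paired here: the factors are listed from left to right, with
  \<open>bounce a b\<close> at index \<open>a - 1\<close> and the letter \<open>b + 1\<close> at
  index \<open>a\<close>. The descending half of \<open>bounce a b\<close> commutes with all letters
  beyond \<open>b\<close>, which gives the product in the second equation of
  \<open>full_twist_shifted\<close> for \<open>d = b - a\<close> and
  \<open>j = a - 1\<close>.\<close>

lemma asymmetric_full_twist_seq:
  fixes a b n :: nat
  assumes "1 \<le> a" "a < b" "b \<le> n"
  defines "g \<equiv> \<lambda>i. if i = a - 1 then bounce a b else br [if i < a - 1 then Suc i else b + i + 1 - a]"
  shows "half_twist {Suc a..<b} ^ 2 * seq_prod g (a + n - b) ^ (Suc n - b + a) = half_twist {1..<Suc n} ^ 2"
proof -
  have 1: "seq_prod g i = br [1..<Suc i]" if "i \<le> a - 1" for i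
    using that
  proof (induction i)
    case (Suc i)
    have "[1..<Suc (Suc i)] = [1..<Suc i] @ [Suc i]" by simp
    then show ?case using Suc by (simp only: seq_prod_Suc br_append) (simp add: g_def)
  qed (simp add: seq_prod_def)
  have 2: "seq_prod g (a + i) = br [1..<a] * bounce a b * br [Suc b..<Suc (b + i)]" for i
  proof (induction i)
    case 0
    have "seq_prod g (Suc (a - 1)) = br [1..<a] * bounce a b"
      unfolding seq_prod_Suc using 1[of "a - 1"] assms(1) by (simp add: g_def)
    then show ?case using assms(1) by simp
  next
    case (Suc i)
    have "a + i \<noteq> a - 1" "\<not> a + i < a - 1" using assms(1) by arith+
    then have "g (a + i) = T (Suc (b + i))" by (simp add: g_def)
    then show ?case by (simp add: Suc.IH seq_prod_Suc br_append mult.assoc)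
  qed
  have seq: "seq_prod g (a + n - b) = br [1..<Suc n] * br (rev [a..<b])"
  proof -
    have "[1..<Suc n] = [1..<a] @ [a..<b] @ [b] @ [Suc b..<Suc n]"
      using assms upt_add_eq_append[of 1 a "Suc n - a"] upt_add_eq_append[of a b "Suc n - b"]
      by (simp add: upt_conv_Cons)
    then have "br [1..<Suc n] * br (rev [a..<b])
        = br [1..<a] * br [a..<b] * T b * (br [Suc b..<Suc n] * br (rev [a..<b]))"
      by (simp only: br_append mult.assoc)
    also have "br [Suc b..<Suc n] * br (rev [a..<b]) = br (rev [a..<b]) * br [Suc b..<Suc n]"
      by (intro br_commute) (auto simp: far_def)
    finally have "br [1..<Suc n] * br (rev [a..<b]) = br [1..<a] * bounce a b * br [Suc b..<Suc n]"
      by (simp only: bounce_def br_append mult.assoc)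
    moreover have "a + n - b = a + (n - b)" using assms by simp
    ultimately show ?thesis using 2[of "n - b"] assms by simp
  qed
  have "a - 1 + (b - a) \<le> n" "1 \<le> b - a" using assms by auto
  then have "half_twist {Suc (Suc (a - 1))..<Suc (a - 1 + (b - a))} ^ 2 *
      (br [1..<Suc n] * br (rev [Suc (a - 1)..<Suc (a - 1 + (b - a))])) ^ (Suc n - (b - a))
    = half_twist {1..<Suc n} ^ 2"
    by (intro full_twist_shifted(2)) auto
  moreover have "Suc (a - 1) = a" "Suc (a - 1 + (b - a)) = b" "Suc n - (b - a) = Suc n - b + a"
    using assms by auto
  ultimately show ?thesis by (simp only: seq)
qed

lemma half_twist_inner_commute:
  assumes "\<And>i. i \<in> set w \<Longrightarrow> i < p \<or> q < i"
  shows "br w * half_twist {Suc p..<q} = half_twist {Suc p..<q} * br w"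
proof (rule half_twist_commute)
  fix i j assume "i \<in> set w" "j \<in> {Suc p..<q}"
  then show "far i j" using assms[of i] by (auto simp: far_def)
qed simp

text \<open>Parity is that of the distance from the band: offset 0 belongs to the image of the first
  generator, offset 1 to that of the second.\<close>

definition side_letters :: "nat \<Rightarrow> nat \<Rightarrow> nat \<Rightarrow> nat \<Rightarrow> nat set" where
  "side_letters a b n e = {i \<in> {1..<a}. even (a - i + e)} \<union> {i \<in> {Suc b..n}. even (i - b + e)}"

text \<open>The exponent \<open>e\<close> is 1 for a half turn and 2 for a full one. The theorem
  \<open>bipartite_power\<close> is applied to the paired factors with the band at index 0, or to
  the single letters with the band at index \<open>a - 1\<close>.\<close>

theorem bounce_alternating_power:
  fixes a b n :: nat
  assumes "1 \<le> a" "a < b" "b \<le> n"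
  defines "e \<equiv> if a + b = Suc n then 1 else 2"
    and "m \<equiv> if a + b = Suc n then a else Suc n - b + a"
    and "x \<equiv> bounce a b * half_twist (side_letters a b n 0)"
    and "y \<equiv> half_twist (side_letters a b n 1)"
  shows "half_twist {Suc a..<b} ^ e * (x * y) ^ m = half_twist {1..<Suc n} ^ e"
    and "half_twist {Suc a..<b} ^ e * (y * x) ^ m = half_twist {1..<Suc n} ^ e"
proof -
  let ?D = "half_twist {Suc a..<b} ^ e" and ?Z = "half_twist {1..<Suc n} ^ e"
  have "?D * (x * y) ^ m = ?Z \<and> ?D * (y * x) ^ m = ?Z"
  proof (cases "a + b = Suc n")
    case True
    define h where "h i = [a - i, b + i]" for i
    define g where "g i = (if i = 0 then bounce a b else br (h i))" for i
    have side: "even_letters h 0 a f = side_letters a b n f" for f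
    proof (intro equalityI subsetI)
      fix l assume "l \<in> side_letters a b n f"
      then consider "l \<in> {1..<a}" "even (a - l + f)" | "l \<in> {Suc b..n}" "even (l - b + f)"
        by (auto simp: side_letters_def)
      then show "l \<in> even_letters h 0 a f"
      proof cases
        case 1
        then show ?thesis by (auto simp: h_def intro!: exI[of _ "a - l"])
      next
        case 2
        then show ?thesis using True by (auto simp: h_def intro!: exI[of _ "l - b"])
      qed
    qed (use True in \<open>auto simp: h_def side_letters_def\<close>)
    have far: "l = l' \<or> far l l'" if "i < a" "j < a" "i \<noteq> 0" "j \<noteq> 0" "even (i + j)"
      "l \<in> set (h i)" "l' \<in> set (h j)" for i j l l'
    proof (cases "i = j")
      case False
      then have "i + 2 \<le> j \<or> j + 2 \<le> i" using that(5) by presburger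
      then show ?thesis using that assms(2) by (auto simp: h_def far_def)
    qed (use that assms(2) in \<open>auto simp: h_def far_def\<close>)
    have bh: "br (h i) * bounce a b = bounce a b * br (h i)" if "Suc 0 < i" "i < a" for i
      using that assms(2) by (intro bounce_far) (auto simp: h_def)
    have comm: "g i * g j = g j * g i" if "Suc i < j" "j < a" for i j
      using that assms(2) bh by (auto simp: g_def intro!: br_commute) (auto simp: h_def far_def)
    have D: "g i * half_twist {Suc a..<b} = half_twist {Suc a..<b} * g i" if "i < a" for i
      using that assms(2) by (auto simp: g_def h_def bounce_half_twist_inner intro!: half_twist_inner_commute)
    have Z: "g i * half_twist {1..<Suc n} = half_twist {1..<Suc n} * g i" if "i < a" for i
    proof (cases "i = 0")
      case True
      then show ?thesis using bounce_half_twist[of a b 1 "Suc n"] assms \<open>a + b = Suc n\<close> by (simp add: g_def)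
    next
      case False
      have "br (h i) * half_twist {1..<Suc n} = half_twist {1..<Suc n} * br (map (\<lambda>i. 1 + Suc n - Suc i) (h i))"
        using that False True assms(2) by (intro br_half_twist_interval) (auto simp: h_def)
      \<comment> \<open>Since \<open>a + b = Suc n\<close>, the flip exchanges the two letters of a
        pair, and these commute.\<close>
      also have "map (\<lambda>i. 1 + Suc n - Suc i) (h i) = [b + i] @ [a - i]"
        using that True by (auto simp: h_def)
      also have "br ([b + i] @ [a - i]) = br (h i)"
      proof -
        have "h i = [a - i] @ [b + i]" by (simp add: h_def)
        moreover have "T (b + i) * T (a - i) = T (a - i) * T (b + i)"
          using assms(2) that False by (intro T_far) (auto simp: far_def)
        ultimately show ?thesis by (simp only: br_append)
      qed
      finally show ?thesis using False by (simp add: g_def)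
    qed
    have seq: "half_twist {Suc a..<b} * seq_prod g a ^ a = half_twist {1..<Suc n}"
      using symmetric_half_twist_seq[OF assms(1,2) True] unfolding g_def[abs_def] h_def .
    have a0: "0 < a" using assms(1) by simp
    have gi: "g i = br (h i)" and dist: "distinct (h i)" if "i < a" "i \<noteq> 0" for i
      using that assms(2) by (auto simp: g_def h_def)
    have disj: "set (h i) \<inter> set (h j) = {}" if "i < j" "j < a" "i \<noteq> 0" "j \<noteq> 0" for i j
      using that assms(2) by (auto simp: h_def)
    note bipartite_power[where c = 0 and k = a and g = g and h = h and m = a
        and D = "half_twist {Suc a..<b}" and Z = "half_twist {1..<Suc n}",
        OF a0 gi dist far disj comm D Z seq]
    moreover have "odd_letters h 0 a 0 = side_letters a b n 1"
      using side[of 1] by simp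
    ultimately show ?thesis using True unfolding side[of 0] x_def y_def e_def m_def by (simp add: g_def)
  next
    case False
    define k where "k = a + n - b"
    define c where "c = a - 1"
    define h where "h i = [if i < c then Suc i else b + i + 1 - a]" for i
    define g where "g i = (if i = c then bounce a b else br (h i))" for i
    have ck: "c < k" using assms by (simp add: c_def k_def)
    have ac: "a = Suc c" using assms(1) by (simp add: c_def)
    have h_left: "h i = [Suc i]" if "i < c" for i using that by (simp add: h_def)
    have h_right: "h i = [b + (i - c)]" if "c < i" for i using that by (simp add: h_def ac)
    have side: "even_letters h c k (c + f) = side_letters a b n f" for f
    proof (intro equalityI subsetI)
      fix l assume "l \<in> side_letters a b n f"
      then consider "l \<in> {1..<a}" "even (a - l + f)" | "l \<in> {Suc b..n}" "even (l - b + f)"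
        by (auto simp: side_letters_def)
      then show "l \<in> even_letters h c k (c + f)"
      proof cases
        case 1
        then have "l - 1 < c" "Suc (l - 1) = l" "even (l - 1 + (c + f))" by (auto simp: ac)
        then show ?thesis using h_left[of "l - 1"] ck by (intro CollectI exI[of _ "l - 1"]) auto
      next
        case 2
        then have "c < c + (l - b)" "c + (l - b) < k" "even (c + (l - b) + (c + f))"
          using assms by (auto simp: k_def ac)
        then show ?thesis using h_right[of "c + (l - b)"] 2
          by (intro CollectI exI[of _ "c + (l - b)"]) auto
      qed
    next
      fix l assume "l \<in> even_letters h c k (c + f)"
      then obtain i where i: "i < k" "i \<noteq> c" "even (i + (c + f))" "l \<in> set (h i)" by blast
      show "l \<in> side_letters a b n f"
      proof (cases "i < c")
        case True
        then have "l = Suc i" using h_left i by simp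
        then show ?thesis using i True by (auto simp: side_letters_def ac)
      next
        case False
        then have "l = b + (i - c)" "c < i" using h_right[of i] i by auto
        then show ?thesis using i by (auto simp: side_letters_def k_def ac)
      qed
    qed
    have hset: "l < a \<and> l = Suc i \<and> i < c \<or> b < l \<and> l \<le> n \<and> l + c = b + i \<and> c < i"
      if "i < k" "i \<noteq> c" "l \<in> set (h i)" for i l
      using that h_left[of i] h_right[of i] by (cases "i < c") (auto simp: ac k_def)
    have h_far: "l = l' \<or> far l l'" if "i < k" "j < k" "i \<noteq> c" "j \<noteq> c" "even (i + j)"
      "l \<in> set (h i)" "l' \<in> set (h j)" for i j l l'
    proof (cases "i = j")
      case True
      then show ?thesis using that by (simp add: h_def)
    next
      case False
      then have "i + 2 \<le> j \<or> j + 2 \<le> i" using that(5) by presburger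
      then show ?thesis using hset[OF that(1,3,6)] hset[OF that(2,4,7)] assms(2)
        unfolding far_def by linarith
    qed
    have comm: "g i * g j = g j * g i" if "Suc i < j" "j < k" for i j
    proof -
      have bh: "br (h i) * bounce a b = bounce a b * br (h i)"
        if "i < k" "Suc i < c \<or> Suc c < i" for i
        using that assms(2) hset[of i] ac by (intro bounce_far) fastforce+
      have "br (h i) * br (h j) = br (h j) * br (h i)" if "i \<noteq> c" "j \<noteq> c"
      proof (rule br_commute)
        fix l l' assume "l \<in> set (h i)" "l' \<in> set (h j)"
        then show "far l l'" using hset[of i l] hset[of j l'] that \<open>Suc i < j\<close> \<open>j < k\<close> assms(2)
          by (auto simp: far_def)
      qed
      then show ?thesis using bh[of i] bh[of j] that by (auto simp: g_def)
    qed
    have D: "g i * half_twist {Suc a..<b} ^ 2 = half_twist {Suc a..<b} ^ 2 * g i" if "i < k" for i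
    proof (rule power_commuting_commutes[symmetric], cases "i = c")
      case True
      then show "half_twist {Suc a..<b} * g i = g i * half_twist {Suc a..<b}"
        using assms(2) by (simp add: g_def bounce_half_twist_inner)
    next
      case False
      have "br (h i) * half_twist {Suc a..<b} = half_twist {Suc a..<b} * br (h i)"
        using hset[OF that False] by (intro half_twist_inner_commute) auto
      then show "half_twist {Suc a..<b} * g i = g i * half_twist {Suc a..<b}"
        using False by (simp add: g_def)
    qed
    \<comment> \<open>Off centre the flip takes the band to a different place, so the full twist has
      to be used: its double flip is the identity on letters.\<close>
    have Z: "g i * half_twist {1..<Suc n} ^ 2 = half_twist {1..<Suc n} ^ 2 * g i" if "i < k" for i
    proof (cases "i = c")
      case True
      then show ?thesis using assms unfolding g_def bounce_def
        by (auto intro!: br_half_twist_interval_square)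
    next
      case False
      have "set (h i) \<subseteq> {1..<Suc n}" using hset[OF that False] assms(2,3) by fastforce
      then show ?thesis using False by (simp add: g_def br_half_twist_interval_square)
    qed
    have seq: "half_twist {Suc a..<b} ^ 2 * seq_prod g k ^ (Suc n - b + a) = half_twist {1..<Suc n} ^ 2"
      using asymmetric_full_twist_seq[OF assms(1-3)] unfolding g_def[abs_def] h_def k_def c_def .
    have disj: "set (h i) \<inter> set (h j) = {}" if "i < j" "j < k" "i \<noteq> c" "j \<noteq> c" for i j
    proof -
      have "l \<notin> set (h j)" if "l \<in> set (h i)" for l
        using hset[of i l] hset[of j l] that \<open>i < j\<close> \<open>j < k\<close> \<open>i \<noteq> c\<close> \<open>j \<noteq> c\<close> assms(2) by auto
      then show ?thesis by auto
    qed
    have gi: "g i = br (h i)" and dist: "distinct (h i)" if "i < k" "i \<noteq> c" for i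
      using that by (auto simp: g_def h_def)
    note bipartite_power[where c = c and k = k and g = g and h = h and m = "Suc n - b + a"
        and D = "half_twist {Suc a..<b} ^ 2" and Z = "half_twist {1..<Suc n} ^ 2",
        OF ck gi dist h_far disj comm D Z seq]
    moreover have "odd_letters h c k c = side_letters a b n 1"
      "even_letters h c k c = side_letters a b n 0"
      using side[of 1] side[of 0] by simp_all
    ultimately show ?thesis using False unfolding x_def y_def e_def m_def by (simp add: g_def)
  qed
  then show "?D * (x * y) ^ m = ?Z" "?D * (y * x) ^ m = ?Z" by auto
qed

section \<open>Artin monoids and Coxeter groups of type \<open>A\<close>\<close>

abbreviation artin_cong :: "'i set \<Rightarrow> ('i \<Rightarrow> 'i \<Rightarrow> enat) \<Rightarrow> ('i list \<times> 'i list) set" where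
  "artin_cong I M \<equiv> word_cong I (artin_rels I M)"

abbreviation coxeter_cong :: "'i set \<Rightarrow> ('i \<Rightarrow> 'i \<Rightarrow> enat) \<Rightarrow> ('i list \<times> 'i list) set" where
  "coxeter_cong I M \<equiv> word_cong I (coxeter_rels I M)"

lemma artin_word_eq_iff:
  assumes "u \<in> lists I" "v \<in> lists I"
  shows "artin_word I M u = artin_word I M v \<longleftrightarrow> (u, v) \<in> artin_cong I M"
  unfolding artin_word_def using eq_equiv_class_iff[OF equiv_word_cong[OF artin_rels_lists] assms] .

lemma coxeter_word_eq_iff:
  assumes "u \<in> lists I" "v \<in> lists I"
  shows "coxeter_word I M u = coxeter_word I M v \<longleftrightarrow> (u, v) \<in> coxeter_cong I M"
  unfolding coxeter_word_def using eq_equiv_class_iff[OF equiv_word_cong[OF coxeter_rels_lists] assms] .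

lemma in_coxeter_word: "v \<in> coxeter_word I M u \<longleftrightarrow> (u, v) \<in> coxeter_cong I M"
  by (simp add: coxeter_word_def)

lemma artin_word_append:
  assumes "u \<in> lists I" "v \<in> lists I"
  shows "artin_word I M u \<otimes>\<^bsub>artin_monoid I M\<^esub> artin_word I M v = artin_word I M (u @ v)"
  using presented_monoid_mult[OF artin_rels_lists assms] by (simp add: artin_word_def artin_monoid_def)

lemma coxeter_word_append:
  assumes "u \<in> lists I" "v \<in> lists I"
  shows "coxeter_word I M u \<otimes>\<^bsub>coxeter_group I M\<^esub> coxeter_word I M v = coxeter_word I M (u @ v)"
  using presented_monoid_mult[OF coxeter_rels_lists assms] by (simp add: coxeter_word_def coxeter_group_def)

lemma coxeter_word_Nil: "coxeter_word I M [] = \<one>\<^bsub>coxeter_group I M\<^esub>"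
  by (simp add: coxeter_word_def coxeter_group_def presented_monoid_def)

lemma carrier_artin_monoid: "carrier (artin_monoid I M) = artin_word I M ` lists I"
  by (auto simp: artin_monoid_def presented_monoid_def artin_word_def quotient_def)

lemma carrier_coxeter_group: "carrier (coxeter_group I M) = coxeter_word I M ` lists I"
  by (auto simp: coxeter_group_def presented_monoid_def coxeter_word_def quotient_def)

lemma monoid_artin_monoid: "monoid (artin_monoid I M)"
  unfolding artin_monoid_def by (rule monoid_presented_monoid[OF artin_rels_lists])

lemma coxeter_cong_cancel:
  assumes "\<forall>i\<in>I. M i i = 1" "u \<in> lists I"
  shows "(rev u @ u, []) \<in> coxeter_cong I M"
  using assms(2)
proof (induction u)
  case (Cons i u)
  have "(alternating (2 * 1) i i, []) \<in> coxeter_rels I M"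
    using Cons.hyps assms(1) unfolding coxeter_rels_def by (force simp: one_enat_def)
  then have "(rev u @ [i, i] @ u, rev u @ [] @ u) \<in> coxeter_cong I M"
    using Cons by (intro word_cong.rel) (auto simp: numeral_2_eq_2)
  then show ?case using Cons.IH by (auto intro: word_cong.trans)
qed (simp add: word_cong.refl)

lemma alternating_Suc_double: "alternating (Suc (2 * k)) i j = alternating (2 * k) i j @ [i]"
  by (induction k) auto

lemma alternating_double: "alternating (2 * k) i j = alternating k i j @ rev (alternating k j i)"
proof (induction k arbitrary: i j)
  case (Suc k)
  have "alternating (2 * Suc k) i j = i # alternating (Suc (2 * k)) j i" by simp
  then show ?case unfolding alternating_Suc_double Suc.IH by simp
qed simp

lemma length_alternating [simp]: "length (alternating k i j) = k"
  by (induction k i j rule: alternating.induct) auto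

lemma alternating_lists: "i \<in> I \<Longrightarrow> j \<in> I \<Longrightarrow> alternating k i j \<in> lists I"
  using set_alternating[of k i j] by auto

text \<open>By \<open>alternating_double\<close> the relator is \<open>?x\<close> followed by the
  reversal of \<open>?y\<close>; multiply by \<open>?y\<close> and cancel.\<close>

lemma coxeter_cong_alternating:
  assumes "\<forall>i\<in>I. M i i = 1" "i \<in> I" "j \<in> I" "M i j = enat k"
  shows "(alternating k i j, alternating k j i) \<in> coxeter_cong I M"
proof -
  let ?x = "alternating k i j" and ?y = "alternating k j i"
  have l: "?x \<in> lists I" "?y \<in> lists I" using assms alternating_lists by metis+
  have "(alternating (2 * k) i j, []) \<in> coxeter_rels I M" using assms by (auto simp: coxeter_rels_def)
  then have "([] @ (?x @ rev ?y) @ ?y, [] @ [] @ ?y) \<in> coxeter_cong I M"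
    unfolding alternating_double using l by (intro word_cong.rel) auto
  moreover have "(?x @ (rev ?y @ ?y) @ [], ?x @ [] @ []) \<in> coxeter_cong I M"
    using coxeter_cong_cancel[of I M, OF assms(1) l(2)] l by (intro word_cong_context) auto
  ultimately show ?thesis by (auto intro: word_cong.trans word_cong.sym)
qed

lemma artin_cong_coxeter_cong:
  assumes "\<forall>i\<in>I. M i i = 1" "(u, v) \<in> artin_cong I M"
  shows "(u, v) \<in> coxeter_cong I M"
  using assms(2)
proof induction
  case (rel x y u v)
  then show ?case using assms(1)
    by (intro word_cong_context) (auto simp: artin_rels_def intro: coxeter_cong_alternating)
qed (auto intro: word_cong.refl word_cong.sym word_cong.trans)

text \<open>Every generator is its own inverse, so the generated subgroup consists of classes of
  words.\<close>

lemma parabolic_subgroup_eq: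
  assumes "\<forall>i\<in>I. M i i = 1" "K \<subseteq> I"
  shows "parabolic_subgroup I M K = coxeter_word I M ` lists K"
proof (intro equalityI subsetI)
  let ?G = "coxeter_group I M" and ?S = "(\<lambda>k. coxeter_word I M [k]) ` K"
  interpret group ?G using assms(1) by (rule group_coxeter_group)
  have KI: "w \<in> lists I" if "w \<in> lists K" for w using that assms(2) by auto
  fix x assume "x \<in> parabolic_subgroup I M K"
  then have "x \<in> generate ?G ?S" by (simp add: parabolic_subgroup_def)
  then show "x \<in> coxeter_word I M ` lists K"
  proof induction
    case one
    have "\<one>\<^bsub>?G\<^esub> = coxeter_word I M []" by (simp add: coxeter_word_Nil)
    then show ?case by blast
  next
    case (incl h)
    then show ?case by auto
  next
    case (inv h)
    then obtain k where k: "k \<in> K" "h = coxeter_word I M [k]" by blast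
    have "coxeter_word I M [k] \<otimes>\<^bsub>?G\<^esub> coxeter_word I M [k] = coxeter_word I M ([k] @ [k])"
      using k KI[of "[k]"] by (intro coxeter_word_append) auto
    also have "\<dots> = coxeter_word I M []"
      using coxeter_cong_cancel[of I M "[k]"] assms(1) k assms(2)
      by (subst coxeter_word_eq_iff) auto
    finally have "h \<otimes>\<^bsub>?G\<^esub> h = \<one>\<^bsub>?G\<^esub>" using k by (simp add: coxeter_word_Nil)
    moreover have "h \<in> carrier ?G" using k assms(2) by (auto simp: carrier_coxeter_group)
    ultimately have "inv\<^bsub>?G\<^esub> h = h" by (intro inv_equality)
    then show ?case using k by auto
  next
    case (eng h1 h2)
    then obtain u v where "u \<in> lists K" "v \<in> lists K" "h1 = coxeter_word I M u" "h2 = coxeter_word I M v"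
      by blast
    moreover from this have "h1 \<otimes>\<^bsub>?G\<^esub> h2 = coxeter_word I M (u @ v)"
      using KI coxeter_word_append by metis
    ultimately show ?case by auto
  qed
next
  let ?G = "coxeter_group I M" and ?S = "(\<lambda>k. coxeter_word I M [k]) ` K"
  fix x assume "x \<in> coxeter_word I M ` lists K"
  then obtain w where "w \<in> lists K" "x = coxeter_word I M w" by blast
  moreover have "coxeter_word I M w \<in> generate ?G ?S" if "w \<in> lists K" for w
    using that
  proof (induction w)
    case Nil
    then show ?case by (simp add: coxeter_word_Nil generate.one)
  next
    case (Cons k w)
    have e: "coxeter_word I M (k # w) = coxeter_word I M [k] \<otimes>\<^bsub>?G\<^esub> coxeter_word I M w"
      using coxeter_word_append[of "[k]" I w M] Cons.hyps assms(2) by auto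
    have "coxeter_word I M [k] \<in> generate ?G ?S" using Cons.hyps by (intro generate.incl) auto
    then show ?case unfolding e using Cons.IH by (rule generate.eng)
  qed
  ultimately show "x \<in> parabolic_subgroup I M K" by (simp add: parabolic_subgroup_def)
qed

text \<open>The operator \<open>arg_max_on\<close> chooses a maximiser; strict inequality leaves
  only one to choose.\<close>

lemma arg_max_on_eqI:
  fixes f :: "'a \<Rightarrow> nat"
  assumes "x \<in> S" "\<And>y. y \<in> S \<Longrightarrow> y \<noteq> x \<Longrightarrow> f y < f x"
  shows "arg_max_on f S = x"
  unfolding arg_max_on_def arg_max_def
proof (rule some_equality)
  have "\<not> f x < f y" if "y \<in> S" for y
    using assms(2)[OF that] by (cases "y = x") auto
  then show "is_arg_max f (\<lambda>x. x \<in> S) x" using assms(1) by (simp add: is_arg_max_def)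
  show "y = x" if "is_arg_max f (\<lambda>x. x \<in> S) y" for y
    using that assms unfolding is_arg_max_def by blast
qed

text \<open>The second hypothesis is Matsumoto's theorem for the element \<open>w\<close>, which
  makes the choice in \<open>artin_lift\<close> immaterial.\<close>

lemma artin_lift_eqI:
  assumes "reduced_expression x w"
    and "\<And>y. reduced_expression y w \<Longrightarrow> artin_word I M y = artin_word I M x"
  shows "artin_lift I M w = artin_word I M x"
proof -
  have "reduced_expression (SOME x. reduced_expression x w) w" using assms(1) by (rule someI)
  then show ?thesis unfolding artin_lift_def by (rule assms(2))
qed

lemma coxeter_length_le: "x \<in> w \<Longrightarrow> coxeter_length w \<le> length x"
  unfolding coxeter_length_def by (rule Least_le) blast

lemma coxeter_length_eqI:
  assumes "x \<in> w" "\<And>y. y \<in> w \<Longrightarrow> length x \<le> length y"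
  shows "coxeter_length w = length x"
  unfolding coxeter_length_def using assms by (intro Least_equality) auto

lemma finite_coxeter_groupI:
  assumes "finite I" "\<And>u. u \<in> lists I \<Longrightarrow> \<exists>v\<in>lists I. length v \<le> N \<and> (u, v) \<in> coxeter_cong I M"
  shows "finite (carrier (coxeter_group I M))"
proof (rule finite_subset)
  show "carrier (coxeter_group I M) \<subseteq> coxeter_word I M ` {v. set v \<subseteq> I \<and> length v \<le> N}"
  proof
    fix x assume "x \<in> carrier (coxeter_group I M)"
    then obtain u where u: "u \<in> lists I" "x = coxeter_word I M u" by (auto simp: carrier_coxeter_group)
    then obtain v where v: "v \<in> lists I" "length v \<le> N" "(u, v) \<in> coxeter_cong I M"
      using assms(2) by blast
    have "x = coxeter_word I M v" using coxeter_word_eq_iff[OF u(1) v(1), of M] u(2) v(3) by metis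
    moreover have "v \<in> {v. set v \<subseteq> I \<and> length v \<le> N}" using v by auto
    ultimately show "x \<in> coxeter_word I M ` {v. set v \<subseteq> I \<and> length v \<le> N}" by (rule image_eqI)
  qed
  show "finite (coxeter_word I M ` {v. set v \<subseteq> I \<and> length v \<le> N})"
    using finite_lists_length_le[OF assms(1)] by simp
qed

section \<open>Type A in terms of braids and permutations\<close>

lemma coxeter_A_diag: "\<forall>i\<in>I. coxeter_A i i = 1"
  by (simp add: coxeter_A_def)

lemma coxeter_matrix_A: "finite I \<Longrightarrow> coxeter_matrix I coxeter_A"
  by (auto simp: coxeter_matrix_def coxeter_A_def)

lemma coxeter_A_far: "far i j \<Longrightarrow> coxeter_A i j = enat 2"
  by (auto simp: coxeter_A_def far_def numeral_eq_enat)

lemma coxeter_A_adj: "adj i j \<Longrightarrow> coxeter_A i j = enat 3"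
  by (auto simp: coxeter_A_def adj_def numeral_eq_enat)

lemma alternating_2: "alternating 2 i j = [i, j]"
  and alternating_3: "alternating 3 i j = [i, j, i]"
  by (simp_all add: numeral_2_eq_2 numeral_3_eq_3)

lemma alternating_braid_eq:
  assumes "coxeter_A i j = enat k"
  shows "alternating k i j \<approx> alternating k j i"
proof -
  consider "i = j" | "far i j" | "adj i j" using far_adj_eq_cases by blast
  then show ?thesis
  proof cases
    case 2
    then have "k = 2" using assms coxeter_A_far by simp
    then show ?thesis using 2 by (simp add: alternating_2 braid_eq_far)
  next
    case 3
    then have "k = 3" using assms coxeter_A_adj by simp
    then show ?thesis using 3 by (simp add: alternating_3 braid_eq_adj)
  qed simp
qed

text \<open>Rewriting preserves the set of letters, so a chain of steps that starts over
  \<open>I\<close> stays over \<open>I\<close>; the calculus on all natural numbers thus restricts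
  to the given generators.\<close>

lemma artin_cong_A_iff:
  "(u, v) \<in> artin_cong I coxeter_A \<longleftrightarrow> u \<in> lists I \<and> v \<in> lists I \<and> u \<approx> v"
proof (intro iffI conjI)
  assume uv: "(u, v) \<in> artin_cong I coxeter_A"
  then show "u \<in> lists I" "v \<in> lists I" using word_cong_lists[OF artin_rels_lists] by blast+
  show "u \<approx> v" using uv
  proof induction
    case (rel x y u v)
    then obtain i j k where k: "x = alternating k i j" "y = alternating k j i" "i \<noteq> j" "coxeter_A i j = enat k"
      by (auto simp: artin_rels_def)
    then have "x \<approx> y" by (simp add: alternating_braid_eq)
    then show ?case by (intro braid_eq_append) auto
  qed (auto intro: braid_eq_sym braid_eq_trans)
next
  have one_step: "(u, v) \<in> artin_cong I coxeter_A" if "braid_step u v" "u \<in> lists I" for u v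
    using that
  proof induction
    case (far i j w)
    then have "([i, j], [j, i]) \<in> artin_rels I coxeter_A"
      unfolding artin_rels_def using coxeter_A_far[OF far(1)]
      by (intro CollectI exI[of _ i] exI[of _ j] exI[of _ 2]) (auto simp: alternating_2 far_def)
    then show ?case using word_cong.rel[of "[i, j]" "[j, i]" _ "[]" I w] far by simp
  next
    case (adj i j w)
    then have "([i, j, i], [j, i, j]) \<in> artin_rels I coxeter_A"
      unfolding artin_rels_def using coxeter_A_adj[OF adj(1)]
      by (intro CollectI exI[of _ i] exI[of _ j] exI[of _ 3]) (auto simp: alternating_3 adj_def)
    then show ?case using word_cong.rel[of "[i, j, i]" "[j, i, j]" _ "[]" I w] adj by simp
  next
    case (Cons u v i)
    then show ?case using word_cong_context[of u v I _ "[i]" "[]"] by simp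
  qed
  assume "u \<in> lists I \<and> v \<in> lists I \<and> u \<approx> v"
  then have "u \<approx> v" "u \<in> lists I" by auto
  then show "(u, v) \<in> artin_cong I coxeter_A"
  proof (induction rule: rtranclp_induct)
    case base
    then show ?case by (rule word_cong.refl)
  next
    case (step v w)
    then have "v \<in> lists I" using braid_eq_set[OF step.hyps(1)] by auto
    then show ?case using word_cong.trans[OF step.IH[OF step.prems] one_step] step.hyps(2) by blast
  qed
qed

lemma artin_word_A_eq_iff:
  assumes "u \<in> lists I" "v \<in> lists I"
  shows "artin_word I coxeter_A u = artin_word I coxeter_A v \<longleftrightarrow> br u = br v"
  using assms by (simp add: artin_word_eq_iff artin_cong_A_iff br_eq_iff)

text \<open>If the letter \<open>i\<close> cannot be prefixed to the reduced word \<open>v\<close>,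
  then \<open>v\<close> is equivalent to a word beginning with \<open>i\<close>, and the two copies
  of \<open>i\<close> cancel.\<close>

lemma ex_reduced_coxeter_cong:
  assumes "u \<in> lists I"
  shows "\<exists>v. reduced v \<and> set v \<subseteq> set u \<and> (u, v) \<in> coxeter_cong I coxeter_A"
  using assms
proof (induction u)
  case Nil
  then show ?case by (intro exI[of _ "[]"]) (simp add: word_cong.refl)
next
  case (Cons i u)
  then obtain v where v: "reduced v" "set v \<subseteq> set u" "(u, v) \<in> coxeter_cong I coxeter_A"
    by auto
  then have vI: "v \<in> lists I" using Cons by auto
  have iv: "(i # u, i # v) \<in> coxeter_cong I coxeter_A"
    using word_cong_context[OF v(3), of "[i]" "[]"] Cons by simp
  show ?case
  proof (cases "strand v i < strand v (Suc i)")
    case True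
    then show ?thesis using v iv by (intro exI[of _ "i # v"]) (auto simp: reduced_Cons)
  next
    case False
    then have "strand v (Suc i) < strand v i" by (simp add: not_less order.order_iff_strict)
    then obtain w where w: "v \<approx> i # w" "reduced (i # w)" using reduced_descent v by blast
    have wI: "set w \<subseteq> set v" "w \<in> lists I" using braid_eq_set[OF w(1)] vI by auto
    have "(v, i # w) \<in> artin_cong I coxeter_A"
      using w vI wI Cons by (auto simp: artin_cong_A_iff)
    then have "(v, i # w) \<in> coxeter_cong I coxeter_A"
      using coxeter_A_diag by (intro artin_cong_coxeter_cong) auto
    then have "(i # v, i # i # w) \<in> coxeter_cong I coxeter_A"
      using word_cong_context[of v "i # w" I _ "[i]" "[]"] Cons by simp
    moreover have "(i # i # w, w) \<in> coxeter_cong I coxeter_A"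
      using word_cong_context[OF coxeter_cong_cancel[of I coxeter_A "[i]"], of "[]" w] Cons wI coxeter_A_diag by simp
    ultimately have "(i # u, w) \<in> coxeter_cong I coxeter_A"
      using iv by (blast intro: word_cong.trans)
    then show ?thesis using w wI v by (intro exI[of _ w]) (auto simp: reduced_Cons)
  qed
qed

text \<open>Faithfulness of the permutation action: both words are reduced first, and then
  \<open>reduced_strand_braid_eq\<close> applies.\<close>

lemma coxeter_cong_A_iff:
  "(u, v) \<in> coxeter_cong I coxeter_A \<longleftrightarrow> u \<in> lists I \<and> v \<in> lists I \<and> strand u = strand v"
proof -
  have strand: "strand u = strand v" if "(u, v) \<in> coxeter_cong I coxeter_A" for u v
    using that
  proof induction
    case (rel x y u v)
    then obtain i j k where k: "x = alternating (2 * k) i j" "y = []" "coxeter_A i j = enat k"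
      by (auto simp: coxeter_rels_def)
    have "strand (alternating k i j) = strand (alternating k j i)"
      using strand_braid_eq[OF alternating_braid_eq[OF k(3)]] .
    then have "strand x = id"
      by (simp add: k(1) alternating_double strand_append fun_eq_iff)
    then show ?case using k by (simp add: strand_append)
  qed auto
  show ?thesis
  proof (intro iffI conjI)
    assume uv: "(u, v) \<in> coxeter_cong I coxeter_A"
    then show "u \<in> lists I" "v \<in> lists I" using word_cong_lists[OF coxeter_rels_lists] by blast+
    show "strand u = strand v" using uv by (rule strand)
  next
    assume uv: "u \<in> lists I \<and> v \<in> lists I \<and> strand u = strand v"
    then obtain u' v' where u': "reduced u'" "set u' \<subseteq> set u" "(u, u') \<in> coxeter_cong I coxeter_A"
      and v': "reduced v'" "set v' \<subseteq> set v" "(v, v') \<in> coxeter_cong I coxeter_A"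
      using ex_reduced_coxeter_cong by metis
    have "u' \<approx> v'" using u' v' uv strand by (intro reduced_strand_braid_eq) auto
    then have "(u', v') \<in> artin_cong I coxeter_A"
      using u' v' uv by (auto simp: artin_cong_A_iff)
    then have "(u', v') \<in> coxeter_cong I coxeter_A"
      using coxeter_A_diag by (intro artin_cong_coxeter_cong) auto
    then show "(u, v) \<in> coxeter_cong I coxeter_A"
      using u' v' by (blast intro: word_cong.trans word_cong.sym)
  qed
qed


lemma coxeter_length_A:
  assumes "u \<in> lists I"
  shows "coxeter_length (coxeter_word I coxeter_A u) = card (Inv (strand u))"
proof -
  obtain v where v: "reduced v" "(u, v) \<in> coxeter_cong I coxeter_A"
    using ex_reduced_coxeter_cong[OF assms] by blast
  have len: "length v = card (Inv (strand u))" using v by (simp add: reduced_def coxeter_cong_A_iff)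
  have "coxeter_length (coxeter_word I coxeter_A u) = length v"
  proof (rule coxeter_length_eqI)
    fix y assume "y \<in> coxeter_word I coxeter_A u"
    then have "strand y = strand u" by (simp add: in_coxeter_word coxeter_cong_A_iff)
    then show "length v \<le> length y" using card_Inv_strand_le[of y] len by simp
  qed (simp add: in_coxeter_word v)
  then show ?thesis using len by simp
qed

lemma reduced_expression_A_iff:
  assumes "u \<in> lists I"
  shows "reduced_expression x (coxeter_word I coxeter_A u) \<longleftrightarrow>
    x \<in> lists I \<and> strand x = strand u \<and> reduced x"
  using assms by (auto simp: reduced_expression_def coxeter_length_A in_coxeter_word
      coxeter_cong_A_iff reduced_def)

lemma artin_lift_A:
  assumes "u \<in> lists I" "x \<in> lists I" "strand x = strand u" "reduced x"
  shows "artin_lift I coxeter_A (coxeter_word I coxeter_A u) = artin_word I coxeter_A x"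
proof (rule artin_lift_eqI)
  fix y assume "reduced_expression y (coxeter_word I coxeter_A u)"
  then have y: "y \<in> lists I" "strand y = strand u" "reduced y"
    using reduced_expression_A_iff[OF assms(1)] by blast+
  then show "artin_word I coxeter_A y = artin_word I coxeter_A x"
    using assms by (simp add: artin_word_A_eq_iff br_eq_iff reduced_strand_braid_eq)
qed (use assms reduced_expression_A_iff in blast)

text \<open>A word over \<open>J\<close> has its inversions in \<open>block J\<close>. Either it
  misses a pair and is shorter, or it has all of them and represents the same permutation as
  \<open>u\<close>.\<close>

lemma longest_element_A:
  assumes "half_twist_word J u" "J \<subseteq> I" "finite J"
  shows "longest_element I coxeter_A J = coxeter_word I coxeter_A u"
proof -
  have u: "u \<in> lists J" "u \<in> lists I" using assms by (auto simp: half_twist_word_def)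
  have "coxeter_length y < coxeter_length (coxeter_word I coxeter_A u)"
    if y: "y \<in> coxeter_word I coxeter_A ` lists J" "y \<noteq> coxeter_word I coxeter_A u" for y
  proof -
    obtain v where v: "v \<in> lists J" "y = coxeter_word I coxeter_A v" using y by blast
    have vI: "v \<in> lists I" using v assms by auto
    have sub: "Inv (strand v) \<subseteq> block J" using v by (intro Inv_strand_subset) auto
    have "Inv (strand v) \<noteq> block J"
    proof
      assume eq: "Inv (strand v) = block J"
      obtain v' where v': "reduced v'" "(v, v') \<in> coxeter_cong I coxeter_A"
        using ex_reduced_coxeter_cong[OF vI] by blast
      then have "v' \<approx> u" using eq assms(1)
        by (intro reduced_Inv_braid_eq) (auto simp: coxeter_cong_A_iff half_twist_word_def)
      then have "strand v = strand u" using v' strand_braid_eq by (metis coxeter_cong_A_iff)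
      then have "y = coxeter_word I coxeter_A u"
        using v vI u by (simp add: coxeter_word_eq_iff coxeter_cong_A_iff del: in_lists_conv_set)
      then show False using y(2) by simp
    qed
    then have "card (Inv (strand v)) < card (block J)"
      using sub finite_block[OF assms(3)] by (intro psubset_card_mono) auto
    then show ?thesis using v vI u assms(1) by (simp add: coxeter_length_A half_twist_word_def)
  qed
  then show ?thesis unfolding longest_element_def
    using u parabolic_subgroup_eq[of I coxeter_A, OF coxeter_A_diag assms(2)]
    by (intro arg_max_on_eqI) auto
qed

lemma strand_half_twist_word_involution:
  assumes "half_twist_word J u" "finite J"
  shows "strand u (strand u p) = p"
proof -
  have "u \<approx> rev u"
    using assms half_twist_word_rev[OF assms(2,1)]
    by (intro reduced_Inv_braid_eq) (auto simp: half_twist_word_def)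
  then have "strand u = strand (rev u)" by (rule strand_braid_eq)
  then show ?thesis by (metis strand_rev)
qed

text \<open>The longest element of \<open>J\<close> is an involution, so its product with the
  longest element of \<open>I\<close> has the permutation of \<open>U\<close>; and \<open>U\<close>
  is reduced as the end of a reduced word.\<close>

lemma artin_lift_rel_longest_A:
  assumes "J \<subseteq> I" "finite I" "set U \<subseteq> I" "half_twist J * br U = half_twist I"
  shows "artin_lift I coxeter_A (rel_longest_element I coxeter_A J I) = artin_word I coxeter_A U"
proof -
  have finJ: "finite J" using assms finite_subset by blast
  obtain u where u: "half_twist_word J u" "half_twist J = br u" using obtain_half_twist_word[OF finJ] .
  obtain k where k: "half_twist_word I k" "half_twist I = br k" using obtain_half_twist_word[OF assms(2)] .
  have l: "u \<in> lists I" "k \<in> lists I" "U \<in> lists I"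
    using u k assms by (auto simp: half_twist_word_def)
  have uk: "u @ U \<approx> k" using assms(4) u k by (simp add: br_append[symmetric] br_eq_iff)
  have "rel_longest_element I coxeter_A J I = coxeter_word I coxeter_A (u @ k)"
    unfolding rel_longest_element_def
    using longest_element_A[OF u(1) assms(1) finJ] longest_element_A[OF k(1) _ assms(2)]
      coxeter_word_append[OF l(1,2)] by simp
  moreover have "strand U = strand (u @ k)"
    using strand_braid_eq[OF uk] strand_half_twist_word_involution[OF u(1) finJ]
    by (auto simp: strand_append fun_eq_iff) (metis comp_apply)
  moreover have "reduced U"
    using reduced_braid_eq[OF uk] k reduced_append_right by (auto simp: half_twist_word_def)
  ultimately show ?thesis using l by (simp add: artin_lift_A)
qed

lemma finite_type_A:
  assumes "finite I"
  shows "finite_type I coxeter_A"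
proof -
  have "\<exists>v\<in>lists I. length v \<le> card (block I) \<and> (u, v) \<in> coxeter_cong I coxeter_A"
    if u: "u \<in> lists I" for u
  proof -
    obtain v where v: "reduced v" "set v \<subseteq> set u" "(u, v) \<in> coxeter_cong I coxeter_A"
      using ex_reduced_coxeter_cong[OF u] by blast
    then have "set v \<subseteq> I" using u by auto
    then have "card (Inv (strand v)) \<le> card (block I)"
      by (intro card_mono finite_block[OF assms] Inv_strand_subset)
    then show ?thesis using v \<open>set v \<subseteq> I\<close> by (intro bexI[of _ v]) (auto simp: reduced_def)
  qed
  then show ?thesis using coxeter_matrix_A[OF assms] finite_coxeter_groupI[OF assms, of "card (block I)"]
    unfolding finite_type_def by blast
qed

lemma artin_support_A:
  assumes "u \<in> lists I"
  shows "artin_support (artin_word I coxeter_A u) = set u"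
proof -
  have "v \<in> artin_word I coxeter_A u \<longleftrightarrow> v \<in> lists I \<and> u \<approx> v" for v
    using assms by (simp add: artin_word_def artin_cong_A_iff)
  then have "artin_support (artin_word I coxeter_A u) = (\<Union>v\<in>{v. v \<in> lists I \<and> u \<approx> v}. set v)"
    unfolding artin_support_def by blast
  also have "\<dots> = set u"
  proof (intro equalityI UN_least)
    show "set u \<subseteq> (\<Union>v\<in>{v. v \<in> lists I \<and> u \<approx> v}. set v)"
      using assms by (intro UN_upper) simp
  qed (use braid_eq_set in blast)
  finally show ?thesis .
qed

lemma component_A: "1 \<le> n \<Longrightarrow> {1..n} \<in> coxeter_components coxeter_A {1..n}"
proof -
  assume n: "1 \<le> n"
  let ?E = "{(i, j). i \<in> {1..n} \<and> j \<in> {1..n} \<and> coxeter_A i j > 2}"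
  have "(1, i) \<in> ?E\<^sup>*" if "1 \<le> i" "i \<le> n" for i
    using that
  proof (induction i rule: dec_induct)
    case (step i)
    then have "(i, Suc i) \<in> ?E" by (auto simp: coxeter_A_def numeral_eq_enat)
    then show ?case using step by (meson Suc_leD rtrancl.rtrancl_into_rtrancl)
  qed simp
  then have "Restr (?E\<^sup>*) {1..n} `` {1} = {1..n}" using n by auto
  moreover have "Restr (?E\<^sup>*) {1..n} `` {1} \<in> coxeter_components coxeter_A {1..n}"
    unfolding coxeter_components_def using n by (intro quotientI) simp
  ultimately show ?thesis by (simp only:)
qed

lemma submonoid_hull_one: "\<one>\<^bsub>G\<^esub> \<in> (\<lambda>H. submonoid H G) hull S"
  by (auto simp: hull_def intro: submonoid.one_closed)

lemma submonoid_hull_mult: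
  assumes "x \<in> (\<lambda>H. submonoid H G) hull S" "y \<in> (\<lambda>H. submonoid H G) hull S"
  shows "x \<otimes>\<^bsub>G\<^esub> y \<in> (\<lambda>H. submonoid H G) hull S"
  using assms by (auto simp: hull_def dest: submonoid.m_closed)

section \<open>Dihedral groups\<close>

text \<open>Letting \<open>1\<close> act by \<open>t \<mapsto> - t\<close> and \<open>2\<close> by \<open>t \<mapsto> 1 - t\<close>, this is the image of \<open>0\<close>; modulo \<open>r\<close>
  it is an invariant of elements of the dihedral group.\<close>

fun dihedral_image :: "nat list \<Rightarrow> int" where
  "dihedral_image [] = 0"
| "dihedral_image (i # w) = (if i = 1 then 0 else 1) - dihedral_image w"

lemma dihedral_image_append:
  "dihedral_image (u @ v) = dihedral_image u + (- 1) ^ length u * dihedral_image v"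
  by (induction u) auto

lemma dihedral_image_alternating:
  "dihedral_image (alternating (2 * k) 1 2) = - int k"
  "dihedral_image (alternating (2 * k) 2 1) = int k"
  by (induction k) auto

text \<open>Together with the parity of the length, the image modulo \<open>r\<close> distinguishes
  the longest element from shorter alternating words.\<close>

lemma dihedral_image_cong:
  assumes "(u, v) \<in> coxeter_cong {1, 2} (coxeter_I2 r)"
  shows "even (length u + length v)" "int r dvd dihedral_image u - dihedral_image v"
proof -
  have "even (length u + length v) \<and> int r dvd dihedral_image u - dihedral_image v"
    using assms
  proof induction
    case (rel x y u v)
    then obtain i j k where k: "i \<in> {1, 2}" "j \<in> {1, 2}" "x = alternating (2 * k) i j" "y = []"
      "coxeter_I2 r i j = enat k" unfolding coxeter_rels_def by blast
    have "int r dvd dihedral_image x"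
    proof (cases "i = j")
      case True
      then have "k = 1" using k(5) by (simp add: coxeter_I2_def one_enat_def)
      then have "dihedral_image x = 0" unfolding k(3) True by (simp add: alternating_2)
      then show ?thesis by simp
    next
      case False
      then have "k = r" using k(5) by (simp add: coxeter_I2_def)
      moreover have "(i, j) = (1, 2) \<or> (i, j) = (2, 1)" using False k(1,2) by auto
      then have "dihedral_image x = - int k \<or> dihedral_image x = int k"
        unfolding k(3) using dihedral_image_alternating[of k] by fastforce
      ultimately show ?thesis by auto
    qed
    moreover have "even (length (u @ x @ v) + length (u @ y @ v))"
      unfolding k(3,4) by simp
    moreover have "dihedral_image (u @ x @ v) - dihedral_image (u @ y @ v) = (- 1) ^ length u * dihedral_image x"
      unfolding dihedral_image_append k(3,4) by (simp add: algebra_simps)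
    ultimately show ?case by (metis dvd_mult)
  next
    case (sym x y)
    then show ?case by (metis add.commute dvd_diff_commute)
  next
    case (trans x y z)
    have "int r dvd (dihedral_image x - dihedral_image y) + (dihedral_image y - dihedral_image z)"
      by (rule dvd_add) (use trans.IH in blast)+
    moreover have "even (length x + length z)" using trans.IH by (metis even_add)
    ultimately show ?case by simp
  qed simp
  then show "even (length u + length v)" "int r dvd dihedral_image u - dihedral_image v" by blast+
qed

lemma coxeter_I2_diag: "\<forall>i\<in>I. coxeter_I2 r i i = 1"
  by (simp add: coxeter_I2_def)

lemma alternating_cong_I2:
  assumes "{i, j} = {1, 2}"
  shows "(alternating r i j, alternating r j i) \<in> artin_cong {1, 2} (coxeter_I2 r)"
proof -
  have "i \<noteq> j" "i \<in> {1, 2}" "j \<in> {1, 2}" using assms by (auto simp: doubleton_eq_iff)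
  then have "(alternating r i j, alternating r j i) \<in> artin_rels {1, 2} (coxeter_I2 r)"
    unfolding artin_rels_def by (intro CollectI exI[of _ i] exI[of _ j] exI[of _ r]) (simp add: coxeter_I2_def)
  from word_cong.rel[OF this, of "[]" _ "[]"] show ?thesis by simp
qed

lemma rev_alternating_even: "rev (alternating (2 * k) i j) = alternating (2 * k) j i"
proof (induction k arbitrary: i j)
  case (Suc k)
  have "alternating (2 * Suc k) p q = p # alternating (2 * k) q p @ [q]" for p q :: 'a
    using alternating_Suc_double[of k q p] by simp
  then show ?case using Suc.IH by simp
qed simp

section \<open>Relative longest elements for an even exponent\<close>

context
  fixes r m :: nat
  assumes m: "1 \<le> m" and r: "r = 2 * m"
begin

private abbreviation cong :: "nat list \<Rightarrow> nat list \<Rightarrow> bool" (infix "\<sim>" 50) where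
  "u \<sim> v \<equiv> (u, v) \<in> coxeter_cong {1, 2} (coxeter_I2 r)"

private abbreviation A :: "nat list \<Rightarrow> nat list set" where
  "A \<equiv> artin_word {1, 2} (coxeter_I2 r)"

private abbreviation lift :: "nat list set \<Rightarrow> nat list set" where
  "lift \<equiv> artin_lift {1, 2} (coxeter_I2 r)"

private abbreviation longest :: "nat set \<Rightarrow> nat list set" where
  "longest \<equiv> longest_element {1, 2} (coxeter_I2 r)"

private abbreviation W :: "nat list \<Rightarrow> nat list set" where
  "W \<equiv> coxeter_word {1, 2} (coxeter_I2 r)"

private lemma W_eq_iff: "set u \<subseteq> {1, 2} \<Longrightarrow> set v \<subseteq> {1, 2} \<Longrightarrow> W u = W v \<longleftrightarrow> u \<sim> v"
  by (rule coxeter_word_eq_iff) auto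

private lemma set_alt: "{i, j} = {1, 2 :: nat} \<Longrightarrow> set (alternating k i j) \<subseteq> {1, 2}"
  using set_alternating[of k i j] by simp

private lemma cong_set: "u \<sim> v \<Longrightarrow> set u \<subseteq> {1, 2} \<and> set v \<subseteq> {1, 2}"
  using word_cong_lists[OF coxeter_rels_lists, of u v "{1, 2}"] by auto

private lemma W_eqI: "u \<sim> v \<Longrightarrow> W u = W v"
  using W_eq_iff cong_set by blast

private lemma cong_refl: "set u \<subseteq> {1, 2} \<Longrightarrow> u \<sim> u"
  by (rule word_cong.refl) auto

private lemma cong_alt: "{i, j} = {1, 2} \<Longrightarrow> alternating r i j \<sim> alternating r j i"
  by (rule artin_cong_coxeter_cong[of _ "coxeter_I2 r", OF coxeter_I2_diag alternating_cong_I2])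

private lemma cong_Cons: "i \<in> {1, 2} \<Longrightarrow> u \<sim> v \<Longrightarrow> i # u \<sim> i # v"
  using word_cong_context[of u v _ _ "[i]" "[]"] by simp

private lemma cong_Cons_Cons: "i \<in> {1, 2} \<Longrightarrow> set u \<subseteq> {1, 2} \<Longrightarrow> i # i # u \<sim> u"
  using word_cong_context[OF coxeter_cong_cancel[of "{1, 2}" "coxeter_I2 r" "[i]"], of "[]" u] coxeter_I2_diag
  by auto

text \<open>The last clause records that a word which is not itself this alternating word becomes
  strictly shorter. This identifies the reduced expressions in \<open>lift_longest\<close> and
  \<open>lift_second_longest\<close>.\<close>

private lemma normal_form:
  assumes "set w \<subseteq> {1, 2}"
  shows "\<exists>k i j. {i, j} = {1, 2} \<and> k \<le> r \<and> w \<sim> alternating k i j \<and>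
    (k = length w \<and> w = alternating k i j \<or> k < length w)"
  using assms
proof (induction w)
  case Nil
  then show ?case by (intro exI[of _ 0] exI[of _ 1] exI[of _ 2]) (simp add: word_cong.refl)
next
  case (Cons c w)
  from Cons.prems have "set w \<subseteq> {1, 2}" by simp
  from Cons.IH[OF this] obtain k i j where k: "{i, j} = {1, 2}" "k \<le> r" "w \<sim> alternating k i j"
    "k = length w \<and> w = alternating k i j \<or> k < length w" by blast
  have c: "c \<in> {1, 2}" using Cons.prems by simp
  have kw: "k \<le> length w" using k(4) by linarith
  have 1: "c # w \<sim> c # alternating k i j" using cong_Cons[OF c k(3)] .
  show ?case
  proof (cases k)
    case 0
    obtain c' where c': "{c, c'} = {1, 2}" using c by auto
    have "c # w \<sim> alternating 1 c c'" using 1 0 by simp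
    moreover have "1 = length (c # w) \<and> c # w = alternating 1 c c' \<or> 1 < length (c # w)"
      using 0 k(4) by (cases w) auto
    moreover have "1 \<le> r" using m r by simp
    ultimately show ?thesis using c' by blast
  next
    case (Suc k')
    show ?thesis
    proof (cases "c = i")
      case True
      have ji: "{j, i} = {1, 2}" using k(1) by (metis insert_commute)
      have "c # alternating k i j \<sim> alternating k' j i"
        using cong_Cons_Cons[OF c set_alt[OF ji, of k']] Suc True by simp
      then have "c # w \<sim> alternating k' j i" using 1 by (rule word_cong.trans[rotated])
      moreover have "k' < length (c # w)" "k' \<le> r" using k(2) kw Suc by simp_all
      ultimately show ?thesis using ji by blast
    next
      case False
      then have cj: "c = j" using c k(1) by blast
      show ?thesis
      proof (cases "k = r")
        case False
        have "c # w \<sim> alternating (Suc k) j i" using 1 cj by simp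
        moreover have "Suc k \<le> r" using k(2) False by simp
        moreover have "{j, i} = {1, 2}" using k(1) by (metis insert_commute)
        moreover have "Suc k = length (c # w) \<and> c # w = alternating (Suc k) j i \<or> Suc k < length (c # w)"
          using k(4) cj by (metis Suc_less_eq alternating.simps(2) length_Cons)
        ultimately show ?thesis by blast
      next
        case True
        \<comment> \<open>At length \<open>r\<close> the alternating word can be made to begin with
          either letter, so the additional letter \<open>c\<close> cancels.\<close>
        then have "alternating k i j \<sim> j # alternating k' i j"
          using cong_alt[OF k(1)] Suc by (metis alternating.simps(2))
        then have "c # alternating k i j \<sim> c # j # alternating k' i j" using cong_Cons c by blast
        moreover have "c # j # alternating k' i j \<sim> alternating k' i j"
          using cong_Cons_Cons[OF c set_alt[OF k(1), of k']] cj by simp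
        ultimately have "c # w \<sim> alternating k' i j"
          using word_cong.trans[OF 1] word_cong.trans by metis
        moreover have "k' < length (c # w)" "k' \<le> r" using k(2) kw Suc by simp_all
        ultimately show ?thesis using k(1) by blast
      qed
    qed
  qed
qed

text \<open>A shorter alternating word has even length \<open>2 * l\<close> by parity. The images
  are then \<open>m\<close> and \<open>l\<close> up to sign with \<open>l < m\<close>, so their
  difference is nonzero and smaller than \<open>2 * m\<close> in absolute value.\<close>

private lemma longest_no_shorter:
  assumes "{i, j} = {1, 2}" "alternating r i j \<sim> x"
  shows "r \<le> length x"
proof (rule ccontr)
  assume lt: "\<not> r \<le> length x"
  have "set x \<subseteq> {1, 2}" using cong_set assms(2) by blast
  from normal_form[OF this] obtain k p q where k: "{p, q} = {1, 2}" "x \<sim> alternating k p q"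
    "k = length x \<and> x = alternating k p q \<or> k < length x" by blast
  then have kr: "k < r" using lt by linarith
  have "alternating r i j \<sim> alternating k p q" using assms(2) k(2) by (rule word_cong.trans)
  note * = dihedral_image_cong[OF this]
  then obtain l where l: "k = 2 * l" using r by (auto simp: even_add elim: evenE)
  let ?A = "dihedral_image (alternating r i j)" and ?B = "dihedral_image (alternating k p q)"
  have "(i, j) = (1, 2) \<or> (i, j) = (2, 1)" "(p, q) = (1, 2) \<or> (p, q) = (2, 1)"
    using assms(1) k(1) by (auto simp: doubleton_eq_iff)
  then have "?A = int m \<or> ?A = - int m" "?B = int l \<or> ?B = - int l"
    unfolding l r using dihedral_image_alternating by fastforce+
  moreover have "l < m" using kr l r by simp
  ultimately have "?A - ?B \<noteq> 0" "\<bar>?A - ?B\<bar> < int r" using r by auto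
  then show False using dvd_imp_le_int[OF _ *(2)] by simp
qed

private lemma coxeter_length_longest:
  assumes "{i, j} = {1, 2}"
  shows "coxeter_length (W (alternating r i j)) = r"
  using coxeter_length_eqI[of "alternating r i j" "W (alternating r i j)"]
    longest_no_shorter[OF assms] cong_refl[OF set_alt[OF assms]]
  by (simp add: in_coxeter_word)

private lemma lists12: "set w \<subseteq> {1, 2} \<longleftrightarrow> w \<in> lists {1, 2 :: nat}" by auto

private lemma longest_element_full: "longest {1, 2} = W (alternating r 1 2)"
proof -
  have "coxeter_length y < coxeter_length (W (alternating r 1 2))"
    if y: "y \<in> W ` lists {1, 2}" "y \<noteq> W (alternating r 1 2)" for y
  proof -
    obtain w where w: "w \<in> lists {1, 2}" "y = W w" using y(1) by blast
    then have "set w \<subseteq> {1, 2}" using lists12 by blast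
    from normal_form[OF this] obtain k i j where k: "{i, j} = {1, 2}" "k \<le> r" "w \<sim> alternating k i j"
      by blast
    have "k \<noteq> r"
    proof
      assume "k = r"
      have "(i, j) = (1, 2) \<or> (i, j) = (2, 1)" using k(1) by (auto simp: doubleton_eq_iff)
      moreover have "alternating r 2 1 \<sim> alternating r 1 2" by (rule cong_alt) auto
      ultimately have "w \<sim> alternating r 1 2"
        using k(3) \<open>k = r\<close> word_cong.trans by blast
      then show False using y(2) w(2) W_eqI by blast
    qed
    moreover have "coxeter_length y \<le> k"
      using coxeter_length_le[of "alternating k i j" y] k w by (simp add: in_coxeter_word)
    ultimately show ?thesis using k coxeter_length_longest[of 1 2] by simp
  qed
  moreover have "alternating r 1 2 \<in> lists {1, 2 :: nat}" using set_alt[of 1 2] lists12 by blast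
  ultimately show ?thesis unfolding longest_element_def
    using parabolic_subgroup_eq[of "{1, 2}" "coxeter_I2 r" "{1, 2}", OF coxeter_I2_diag]
    by (intro arg_max_on_eqI) auto
qed

private lemma longest_element_singleton:
  assumes "i \<in> {1, 2}"
  shows "longest {i} = W [i]"
proof -
  have pos: "coxeter_length (W [i]) \<noteq> 0"
  proof
    assume "coxeter_length (W [i]) = 0"
    moreover have "[i] \<in> W [i]" using cong_refl[of "[i]"] assms by (simp add: in_coxeter_word)
    then have "\<exists>k. \<exists>x\<in>W [i]. length x = k" by blast
    then have "\<exists>x\<in>W [i]. length x = coxeter_length (W [i])"
      unfolding coxeter_length_def by (rule LeastI_ex)
    ultimately have "[i] \<sim> []" by (auto simp: in_coxeter_word)
    then show False using dihedral_image_cong(1) by fastforce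
  qed
  have y_cases: "y = W [] \<or> y = W [i]" if y: "y \<in> W ` lists {i}" for y
  proof -
    have *: "w \<sim> [] \<or> w \<sim> [i]" if "set w \<subseteq> {i}" for w
      using that
    proof (induction w)
      case (Cons c w)
      then have "c = i" "w \<sim> [] \<or> w \<sim> [i]" by auto
      then show ?case using cong_Cons[OF assms] cong_Cons_Cons[OF assms, of "[]"]
        by (auto intro: word_cong.trans)
    qed (use cong_refl[of "[]"] in simp)
    obtain w where w: "w \<in> lists {i}" "y = W w" using y by blast
    then have "set w \<subseteq> {i}" by auto
    from *[OF this] show ?thesis using W_eqI[of w "[]"] W_eqI[of w "[i]"] w(2) by blast
  qed
  have zero: "coxeter_length (W []) = 0"
    using coxeter_length_le[of "[]" "W []"] cong_refl[of "[]"] by (simp add: in_coxeter_word)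
  have "parabolic_subgroup {1, 2} (coxeter_I2 r) {i} = W ` lists {i}"
    using assms by (intro parabolic_subgroup_eq coxeter_I2_diag) auto
  then show ?thesis unfolding longest_element_def
  proof (elim ssubst, intro arg_max_on_eqI)
    show "W [i] \<in> W ` lists {i}" by (intro imageI) simp
    fix y assume "y \<in> W ` lists {i}" "y \<noteq> W [i]"
    then have "y = W []" using y_cases by blast
    then show "coxeter_length y < coxeter_length (W [i])" using pos zero by simp
  qed
qed

private lemma longest_element_empty: "longest {} = W []"
  unfolding longest_element_def
  using parabolic_subgroup_eq[of "{1, 2}" "coxeter_I2 r" "{}", OF coxeter_I2_diag]
  by (intro arg_max_on_eqI) auto

private lemma lift_Nil: "lift (W []) = A []"
proof (rule artin_lift_eqI)
  have "coxeter_length (W []) = 0"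
    using coxeter_length_le[of "[]" "W []"] cong_refl[of "[]"] by (simp add: in_coxeter_word)
  then show "reduced_expression [] (W [])" "\<And>y. reduced_expression y (W []) \<Longrightarrow>
      A y = A []"
    using cong_refl[of "[]"] by (auto simp: reduced_expression_def in_coxeter_word)
qed

private lemma lift_longest:
  "lift (W (alternating r 1 2)) = A (alternating r 1 2)"
proof (rule artin_lift_eqI)
  show "reduced_expression (alternating r 1 2) (W (alternating r 1 2))"
    using coxeter_length_longest[of 1 2] cong_refl[OF set_alt[of 1 2]]
    by (simp add: reduced_expression_def in_coxeter_word)
  fix y assume "reduced_expression y (W (alternating r 1 2))"
  then have y: "alternating r 1 2 \<sim> y" "length y = r"
    using coxeter_length_longest[of 1 2] by (auto simp: reduced_expression_def in_coxeter_word)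
  obtain k i j where k: "{i, j} = {1, 2}" "y \<sim> alternating k i j"
    "k = length y \<and> y = alternating k i j \<or> k < length y"
    using normal_form[of y] cong_set[OF y(1)] by blast
  have "r \<le> k" using longest_no_shorter[of 1 2 "alternating k i j"] y k by (auto intro: word_cong.trans)
  then have "y = alternating r i j" using k y by auto
  moreover have "A (alternating r 2 1) = A (alternating r 1 2)"
  proof -
    have "{2, 1} = {1, 2 :: nat}" by auto
    then show ?thesis using alternating_cong_I2[of 2 1 r] set_alt[of 1 2 r] set_alt[of 2 1 r] lists12
      by (subst artin_word_eq_iff) blast+
  qed
  ultimately show "A y = A (alternating r 1 2)"
    using k(1) by (auto simp: doubleton_eq_iff)
qed

text \<open>One letter cancels from the longest element. A reduced expression that begins with
  \<open>i\<close> would, after prefixing \<open>i\<close>, express the longest element by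
  \<open>r - 2\<close> letters; hence the only reduced expression begins with
  \<open>j\<close>.\<close>

private lemma lift_second_longest:
  assumes "{i, j} = {1, 2}"
  shows "lift (W (i # alternating r 1 2))
    = A (alternating (r - 1) j i)"
proof -
  have i: "i \<in> {1, 2}" and ji: "{j, i} = {1, 2}" using assms by auto
  have r1: "alternating r p q = p # alternating (r - 1) q p" for p q :: nat
  proof -
    have "alternating (Suc (r - 1)) p q = p # alternating (r - 1) q p" by simp
    moreover have "Suc (r - 1) = r" using m r by simp
    ultimately show ?thesis by metis
  qed
  have w0: "alternating r 1 2 \<sim> alternating r i j"
    using assms cong_alt[of 1 2] cong_refl[OF set_alt[of 1 2]] by (auto simp: doubleton_eq_iff)
  then have "i # alternating r 1 2 \<sim> i # i # alternating (r - 1) j i"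
    using cong_Cons[OF i] r1[of i j] by simp
  then have e: "i # alternating r 1 2 \<sim> alternating (r - 1) j i"
    using cong_Cons_Cons[OF i set_alt[OF ji]] by (rule word_cong.trans)
  have ge: "r \<le> Suc (length y)" if "i # alternating r 1 2 \<sim> y" for y
  proof -
    have "alternating r 1 2 \<sim> i # i # alternating r 1 2"
      using word_cong.sym[OF cong_Cons_Cons[OF i set_alt[of 1 2]]] by simp
    then have "alternating r 1 2 \<sim> i # y" using cong_Cons[OF i that] by (rule word_cong.trans)
    then show ?thesis using longest_no_shorter[of 1 2 "i # y"] by simp
  qed
  have len: "coxeter_length (W (i # alternating r 1 2)) = r - 1"
    using coxeter_length_eqI[of "alternating (r - 1) j i" "W (i # alternating r 1 2)"] e ge
    by (fastforce simp: in_coxeter_word)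
  show ?thesis
  proof (rule artin_lift_eqI)
    show "reduced_expression (alternating (r - 1) j i) (W (i # alternating r 1 2))"
      using e len by (simp add: reduced_expression_def in_coxeter_word)
    fix y assume "reduced_expression y (W (i # alternating r 1 2))"
    then have y: "i # alternating r 1 2 \<sim> y" "length y = r - 1"
      using len by (auto simp: reduced_expression_def in_coxeter_word)
    obtain k p q where k: "{p, q} = {1, 2}" "y \<sim> alternating k p q"
      "k = length y \<and> y = alternating k p q \<or> k < length y"
      using normal_form[of y] cong_set[OF y(1)] by blast
    have "r \<le> Suc k" using ge[of "alternating k p q"] y k by (auto intro: word_cong.trans)
    then have ypq: "y = alternating (r - 1) p q" using k y by auto
    have "p \<noteq> i"
    proof
      assume "p = i"
      have "alternating (Suc (r - 2)) i q = i # alternating (r - 2) q i" by simp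
      moreover have "Suc (r - 2) = r - 1" using m r by simp
      ultimately have "y = i # alternating (r - 2) q p" using ypq \<open>p = i\<close> by metis
      moreover have "{q, p} = {1, 2}" using k(1) by (metis insert_commute)
      ultimately have "i # y \<sim> alternating (r - 2) q p"
        using cong_Cons_Cons[OF i set_alt] by metis
      moreover have "i # i # alternating r 1 2 \<sim> i # y" by (rule cong_Cons[OF i y(1)])
      ultimately have "alternating r 1 2 \<sim> alternating (r - 2) q p"
        using word_cong.sym[OF cong_Cons_Cons[OF i set_alt[of 1 2]]] by (blast intro: word_cong.trans)
      then have "r \<le> r - 2" using longest_no_shorter[of 1 2 "alternating (r - 2) q p"] by simp
      then show False using m r by simp
    qed
    then have "p = j" "q = i" using k(1) assms by (auto simp: doubleton_eq_iff)
    then show "A y = A (alternating (r - 1) j i)"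
      using ypq by simp
  qed
qed

text \<open>This serves the case \<open>r = 2\<close>, in which each generator is a component of its
  own.\<close>

private lemma lift_singleton:
  assumes "i \<in> {1, 2}"
  shows "lift (W [i]) = A [i]"
proof (rule artin_lift_eqI)
  have ne: "y \<noteq> []" if "[i] \<sim> y" for y
    using dihedral_image_cong(1)[OF that] by auto
  then have "Suc 0 \<le> length y" if "[i] \<sim> y" for y using that by (cases y) auto
  then have len: "coxeter_length (W [i]) = 1"
    using coxeter_length_eqI[of "[i]" "W [i]"] cong_refl[of "[i]"] assms by (simp add: in_coxeter_word)
  then show "reduced_expression [i] (W [i])"
    using cong_refl[of "[i]"] assms by (simp add: reduced_expression_def in_coxeter_word)
  fix y assume "reduced_expression y (W [i])"
  then have y: "[i] \<sim> y" "length y = 1" using len by (auto simp: reduced_expression_def in_coxeter_word)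
  then obtain j where j: "y = [j]" by (auto simp: length_Suc_conv)
  then have "j \<in> {1, 2}" using cong_set[OF y(1)] by simp
  moreover have "int r dvd dihedral_image [i] - dihedral_image [j]"
    using dihedral_image_cong(2) y j by blast
  then have "j = i" using assms calculation r m
    by (auto dest!: zdvd_imp_le[of "int r" 1] zdvd_imp_le[of "int r" "1"] simp: zdvd1_eq)
  then show "A y = A [i]" using j by simp
qed

lemma components_I2:
  assumes "C \<in> coxeter_components (coxeter_I2 r) {1, 2}"
  shows "C = {1, 2} \<or> r = 2 \<and> (C = {1} \<or> C = {2})"
proof -
  let ?E = "{(i, j). i \<in> {1, 2} \<and> j \<in> {1, 2} \<and> coxeter_I2 r i j > 2}"
  obtain x where x: "x \<in> {1, 2}" "C = Restr (?E\<^sup>*) {1, 2} `` {x}"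
    using assms unfolding coxeter_components_def by (rule quotientE)
  show ?thesis
  proof (cases "r = 2")
    case True
    then have "?E = {}" by (auto simp: coxeter_I2_def numeral_eq_enat one_enat_def split: if_splits)
    then show ?thesis using x True by auto
  next
    case False
    then have "2 < enat r" using m r by (simp add: numeral_eq_enat)
    then have "(1, 2) \<in> ?E" "(2, 1) \<in> ?E" by (simp_all add: coxeter_I2_def)
    from this[THEN r_into_rtrancl] have "C = {1, 2}" unfolding x(2) using x(1) by auto
    then show ?thesis by simp
  qed
qed

text \<open>The empty word comes from \<open>J = C\<close>, the word of length \<open>r\<close> from
  \<open>J = {}\<close>, and those of length \<open>r - 1\<close> from singletons \<open>J\<close>.
  The components of size one for \<open>r = 2\<close> fit in as well, since the words of length
  \<open>r - 1\<close> are then the single generators.\<close>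

theorem artin_lift_rel_longest_I2:
  assumes "C \<in> coxeter_components (coxeter_I2 r) {1, 2}" "J \<subseteq> C"
  shows "artin_lift {1, 2} (coxeter_I2 r) (rel_longest_element {1, 2} (coxeter_I2 r) J C)
    \<in> artin_word {1, 2} (coxeter_I2 r) ` {[], alternating r 1 2, alternating (r - 1) 1 2, alternating (r - 1) 2 1}"
proof -
  let ?rel = "rel_longest_element {1, 2} (coxeter_I2 r)"
  have rel: "?rel J C = W (u @ v)"
    if "longest J = W u" "longest C = W v"
      "set u \<subseteq> {1, 2}" "set v \<subseteq> {1, 2}" for J C u v
    unfolding rel_longest_element_def that(1,2)
    using that(3,4) by (intro coxeter_word_append) auto
  have s: "set (alternating r 1 2) \<subseteq> {1, 2 :: nat}" using set_alt[of 1 2] by simp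
  show ?thesis
  proof (cases "C = {1, 2}")
    case True
    then have "J = {} \<or> J = {1} \<or> J = {2} \<or> J = {1, 2}"
    proof -
      have "J \<in> Pow {1, 2}" using assms(2) True by blast
      then show ?thesis unfolding Pow_insert Pow_empty by auto
    qed
    then consider "J = {}" | i where "i \<in> {1, 2}" "J = {i}" | "J = {1, 2}" by blast
    then show ?thesis
    proof cases
      case 1
      then have "lift (?rel J C) = A (alternating r 1 2)"
        using rel[OF longest_element_empty longest_element_full _ s] True lift_longest by simp
      then show ?thesis by blast
    next
      case (2 i)
      obtain j where j: "{i, j} = {1, 2}" using 2(1) by auto
      have "lift (?rel J C) = A (alternating (r - 1) j i)"
        using rel[OF longest_element_singleton[OF 2(1)] longest_element_full _ s] 2 True
          lift_second_longest[OF j] by simp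
      moreover have "(j, i) = (1, 2) \<or> (j, i) = (2, 1)" using j by (auto simp: doubleton_eq_iff)
      ultimately show ?thesis by blast
    next
      case 3
      let ?w = "alternating r 1 2 :: nat list" and ?v = "alternating r 2 1 :: nat list"
      \<comment> \<open>As \<open>r\<close> is even, reversing \<open>?w\<close> gives
        \<open>?v\<close>, so this congruence shows that the longest element is an
        involution.\<close>
      have "?w \<sim> ?v" by (rule cong_alt) (rule HOL.refl)
      moreover have "?w \<in> lists {1, 2}" using s lists12 by blast
      ultimately have "?w @ ?w \<sim> ?v @ ?w" using word_cong_context[of ?w ?v _ _ "[]" ?w] by simp
      moreover have "rev ?w @ ?w \<sim> []"
        using s lists12 by (intro coxeter_cong_cancel coxeter_I2_diag) blast
      then have "?v @ ?w \<sim> []" using rev_alternating_even[of m "1 :: nat" 2] r by simp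
      ultimately have "?w @ ?w \<sim> []" by (rule word_cong.trans)
      then have "W (?w @ ?w) = W []" by (rule W_eqI)
      then have "lift (?rel J C) = A []"
        using rel[OF longest_element_full longest_element_full s s] 3 True lift_Nil by simp
      then show ?thesis by blast
    qed
  next
    case False
    with components_I2[OF assms(1)] have "r = 2 \<and> (C = {1} \<or> C = {2})" by metis
    then obtain i where i: "r = 2" "i \<in> {1, 2}" "C = {i}" by blast
    have si: "set [i] \<subseteq> {1, 2}" "set [] \<subseteq> {1, 2 :: nat}" using i(2) by simp_all
    have "J = {} \<or> J = {i}" using assms(2) unfolding i(3) by (rule subset_singletonD)
    then consider "J = {}" | "J = {i}" by blast
    then show ?thesis
    proof cases
      case 1
      then have "lift (?rel J C) = A [i]"
        using rel[OF longest_element_empty longest_element_singleton[OF i(2)] si(2,1)] i(3)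
          lift_singleton[OF i(2)] by simp
      moreover have "alternating (r - 1) p q = [p]" for p q :: nat using i(1) by simp
      then have "[i] = alternating (r - 1) 1 2 \<or> [i] = alternating (r - 1) 2 1" using i(2) by simp
      ultimately show ?thesis by blast
    next
      case 2
      have "i # i # [] \<sim> []" using cong_Cons_Cons[OF i(2) si(2)] .
      then have "W [i, i] = W []" by (rule W_eqI)
      then have "lift (?rel J C) = A []"
        using rel[OF longest_element_singleton[OF i(2)] longest_element_singleton[OF i(2)] si(1,1)] i(3) 2
          lift_Nil by simp
      then show ?thesis by blast
    qed
  qed
qed

lemma finite_type_I2: "finite_type {1, 2} (coxeter_I2 r)"
proof -
  have "\<exists>v\<in>lists {1, 2}. length v \<le> r \<and> u \<sim> v" if "u \<in> lists {1, 2}" for u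
  proof -
    from that have "set u \<subseteq> {1, 2}" using lists12 by blast
    from normal_form[OF this] obtain k i j where "{i, j} = {1, 2}" "k \<le> r" "u \<sim> alternating k i j"
      by blast
    moreover from this have "alternating k i j \<in> lists {1, 2}" using set_alt lists12 by blast
    ultimately show ?thesis using length_alternating by metis
  qed
  then have "finite (carrier (coxeter_group {1, 2} (coxeter_I2 r)))"
    by (intro finite_coxeter_groupI[of _ r]) auto
  moreover have "coxeter_matrix {1, 2} (coxeter_I2 r)"
    using m r by (auto simp: coxeter_matrix_def coxeter_I2_def numeral_eq_enat)
  ultimately show ?thesis by (simp add: finite_type_def)
qed

end

section \<open>Parabolic elements and homomorphisms\<close>

lemma map_flip_rev_upt:
  assumes "1 \<le> p" "q \<le> Suc n"
  shows "map (\<lambda>i. 1 + Suc n - Suc i) (rev [p..<q]) = [n + 2 - q..<n + 2 - p]"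
  using assms by (intro nth_equalityI) (auto simp: rev_nth)

text \<open>The letter \<open>i\<close> is flipped to \<open>n + 1 - i\<close>. Adding a strand on
  the right of the interval corresponds to adding one on the left of its reflection.\<close>

lemma half_twist_interval_flip:
  assumes "1 \<le> p" "p \<le> q" "q \<le> Suc n"
  shows "half_twist {p..<q} * half_twist {1..<Suc n} = half_twist {1..<Suc n} * half_twist {n + 2 - q..<n + 2 - p}"
  using assms(2,3)
proof (induction q rule: dec_induct)
  case base
  then show ?case by simp
next
  case (step q)
  let ?K = "half_twist {1..<Suc n}"
  have "br (rev [p..<Suc q]) * ?K = ?K * br (map (\<lambda>i. 1 + Suc n - Suc i) (rev [p..<Suc q]))"
    using assms(1) step by (intro br_half_twist_interval) auto
  then have 1: "br (rev [p..<Suc q]) * ?K = ?K * br [n + 1 - q..<n + 2 - p]"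
    using map_flip_rev_upt[of p "Suc q" n] assms(1) step by simp
  have "Suc (n + 1 - q) = n + 2 - q" using step by simp
  then have 2: "half_twist {n + 1 - q..<n + 2 - p} = half_twist {n + 2 - q..<n + 2 - p} * br [n + 1 - q..<n + 2 - p]"
    using half_twist_interval_left[of "n + 1 - q" "n + 2 - p"] step by simp
  have IH: "half_twist {p..<q} * ?K = ?K * half_twist {n + 2 - q..<n + 2 - p}"
    using step by simp
  have "half_twist {p..<Suc q} * ?K = half_twist {p..<q} * (br (rev [p..<Suc q]) * ?K)"
    using half_twist_interval_right[of p q] step by (simp add: mult.assoc)
  also have "\<dots> = ?K * (half_twist {n + 2 - q..<n + 2 - p} * br [n + 1 - q..<n + 2 - p])"
    unfolding 1 by (simp only: mult.assoc[symmetric] IH)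
  finally show ?case unfolding 2[symmetric] by simp
qed

lemma parabolic_A_half_twist:
  assumes "1 \<le> n" "J \<subseteq> {1..n}" "set U \<subseteq> {1..n}" "half_twist J * br U = half_twist {1..n}"
  shows "artin_word {1..n} coxeter_A U \<in> parabolic_submonoid {1..n} coxeter_A {1..n}"
proof -
  have "artin_word {1..n} coxeter_A U
      = artin_lift {1..n} coxeter_A (rel_longest_element {1..n} coxeter_A J {1..n})"
    using artin_lift_rel_longest_A[OF assms(2) _ assms(3,4)] by simp
  then show ?thesis unfolding parabolic_submonoid_def
    using component_A[OF assms(1)] assms(2) by (intro hull_inc CollectI exI conjI)
qed

text \<open>Here \<open>s\<close> stands for the leading factor missing from \<open>U\<close>. For
  \<open>e = 2\<close> let \<open>v\<close> be a complement of \<open>J\<close> and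
  \<open>v'\<close> one of the reflected interval \<open>?J'\<close>: the first copy of the inner
  half twist turns \<open>s * br v\<close> into the half twist of all strands, the second passes
  through it and becomes that of \<open>?J'\<close>, which \<open>v'\<close> completes. Cancellation
  gives \<open>br U = br (v @ v')\<close>.\<close>

lemma parabolic_A_power:
  assumes "1 \<le> p" "p \<le> q" "q \<le> Suc n" "1 \<le> n" "J \<subseteq> {1..n}" "set U \<subseteq> {1..n}"
    and J: "half_twist J = half_twist {p..<q} * s"
    and U: "half_twist {p..<q} ^ e * (s * br U) = half_twist {1..n} ^ e" and e: "e = 1 \<or> e = 2"
  shows "artin_word {1..n} coxeter_A U \<in> parabolic_submonoid {1..n} coxeter_A {1..n}"
  using e
proof
  assume "e = 1"
  then show ?thesis using J U assms by (intro parabolic_A_half_twist[of n J]) (simp_all add: mult.assoc)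
next
  assume e: "e = 2"
  let ?J' = "{n + 2 - q..<n + 2 - p}"
  have "{1..n} = {1..<Suc n}" by auto
  then have flip: "half_twist {p..<q} * half_twist {1..n} = half_twist {1..n} * half_twist ?J'"
    using half_twist_interval_flip[OF assms(1-3)] by simp
  have J': "?J' \<subseteq> {1..n}" using assms(1-3) by auto
  obtain v where v: "set v \<subseteq> {1..n}" "half_twist J * br v = half_twist {1..n}"
    using half_twist_left_divides[OF _ assms(5)] by auto
  obtain v' where v': "set v' \<subseteq> {1..n}" "half_twist ?J' * br v' = half_twist {1..n}"
    using half_twist_left_divides[OF _ J'] by auto
  have "half_twist {p..<q} ^ 2 * (s * br (v @ v'))
      = half_twist {p..<q} * (half_twist J * br v) * br v'"
    by (simp add: J br_append power2_eq_square mult.assoc)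
  also have "\<dots> = half_twist {1..n} * (half_twist ?J' * br v')"
    unfolding v(2) by (simp only: mult.assoc[symmetric] flip)
  also have "\<dots> = half_twist {p..<q} ^ 2 * (s * br U)"
    unfolding v'(2) using U e by (simp add: power2_eq_square)
  finally have "br (v @ v') = br U" by (simp only: braid_mult_left_cancel)
  then have "artin_word {1..n} coxeter_A U = artin_word {1..n} coxeter_A (v @ v')"
    using assms(6) v v' by (subst artin_word_A_eq_iff) auto
  also have "\<dots> = artin_word {1..n} coxeter_A v \<otimes>\<^bsub>artin_monoid {1..n} coxeter_A\<^esub> artin_word {1..n} coxeter_A v'"
    using v v' by (intro artin_word_append[symmetric]) auto
  also have "\<dots> \<in> parabolic_submonoid {1..n} coxeter_A {1..n}"
    using parabolic_A_half_twist[OF assms(4,5) v] parabolic_A_half_twist[OF assms(4) J' v']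
    unfolding parabolic_submonoid_def by (rule submonoid_hull_mult)
  finally show ?thesis .
qed

section \<open>Construction of the homomorphism\<close>

lemma ex_artin_hom:
  assumes f: "\<And>i. i \<in> I' \<Longrightarrow> f i \<in> lists I"
    and rels: "\<And>x y. (x, y) \<in> artin_rels I' M' \<Longrightarrow>
      (concat (map f x), concat (map f y)) \<in> artin_cong I M"
  obtains \<Phi> where "artin_hom I' M' I M \<Phi>"
    "\<And>w. w \<in> lists I' \<Longrightarrow> \<Phi> (artin_word I' M' w) = artin_word I M (concat (map f w))"
proof -
  let ?F = "\<lambda>w. concat (map f w)"
  have F: "?F w \<in> lists I" if "w \<in> lists I'" for w
    using that
  proof (induction w)
    case (Cons i w)
    then show ?case using f[of i] by simp
  qed simp
  have cong: "(?F x, ?F y) \<in> artin_cong I M" if "(x, y) \<in> artin_cong I' M'" for x y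
    using that
  proof induction
    case (refl w)
    show ?case by (rule word_cong.refl[OF F[OF refl]])
  next
    case (rel x y u v)
    then show ?case using word_cong_context[OF rels[OF rel(1)] F[OF rel(2)] F[OF rel(3)]]
      by (simp only: map_append concat_append)
  next
    case (sym x y)
    show ?case by (rule word_cong.sym[OF sym.IH])
  next
    case (trans x y z)
    show ?case by (rule word_cong.trans[OF trans.IH])
  qed
  define \<Phi> where "\<Phi> A = artin_word I M (?F (SOME w. w \<in> A))" for A
  have \<Phi>: "\<Phi> (artin_word I' M' w) = artin_word I M (?F w)" if w: "w \<in> lists I'" for w
  proof -
    have "w \<in> artin_word I' M' w" using w by (simp add: artin_word_def word_cong.refl)
    then have "(SOME x. x \<in> artin_word I' M' w) \<in> artin_word I' M' w" by (rule someI)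
    then have "(w, SOME x. x \<in> artin_word I' M' w) \<in> artin_cong I' M'"
      by (simp add: artin_word_def)
    from cong[OF this] have "(?F w, ?F (SOME x. x \<in> artin_word I' M' w)) \<in> artin_cong I M" .
    then show ?thesis unfolding \<Phi>_def artin_word_def
      by (rule equiv_class_eq[OF equiv_word_cong[OF artin_rels_lists], symmetric])
  qed
  have "artin_hom I' M' I M \<Phi>"
    unfolding artin_hom_def
  proof (intro conjI homI)
    show "\<Phi> \<one>\<^bsub>artin_monoid I' M'\<^esub> = \<one>\<^bsub>artin_monoid I M\<^esub>"
      using \<Phi>[of "[]"] by (simp add: artin_word_Nil)
  next
    fix x assume "x \<in> carrier (artin_monoid I' M')"
    then obtain u where "u \<in> lists I'" "x = artin_word I' M' u" by (auto simp: carrier_artin_monoid)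
    then show "\<Phi> x \<in> carrier (artin_monoid I M)"
      using \<Phi> F unfolding carrier_artin_monoid by (metis imageI)
  next
    fix x y assume "x \<in> carrier (artin_monoid I' M')" "y \<in> carrier (artin_monoid I' M')"
    then obtain u v where u: "u \<in> lists I'" "x = artin_word I' M' u"
      and v: "v \<in> lists I'" "y = artin_word I' M' v" unfolding carrier_artin_monoid by blast
    have "u @ v \<in> lists I'" using u v by simp
    then have "\<Phi> (artin_word I' M' (u @ v)) = artin_word I M (?F u @ ?F v)" using \<Phi> by simp
    then show "\<Phi> (x \<otimes>\<^bsub>artin_monoid I' M'\<^esub> y) = \<Phi> x \<otimes>\<^bsub>artin_monoid I M\<^esub> \<Phi> y"
      unfolding u(2) v(2) artin_word_append[OF u(1) v(1)] \<Phi>[OF u(1)] \<Phi>[OF v(1)]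
        artin_word_append[OF F[OF u(1)] F[OF v(1)]] .
  qed
  then show ?thesis using that \<Phi> by blast
qed

lemma artin_hom_unique:
  assumes "artin_hom I' M' I M \<Phi>" "artin_hom I' M' I M \<Psi>"
    and "\<And>i. i \<in> I' \<Longrightarrow> \<Psi> (artin_word I' M' [i]) = \<Phi> (artin_word I' M' [i])"
    and "x \<in> carrier (artin_monoid I' M')"
  shows "\<Psi> x = \<Phi> x"
proof -
  obtain w where "w \<in> lists I'" "x = artin_word I' M' w"
    using assms(4) by (auto simp: carrier_artin_monoid)
  moreover have "\<Psi> (artin_word I' M' w) = \<Phi> (artin_word I' M' w)" if "w \<in> lists I'" for w
    using that
  proof (induction w)
    case Nil
    then show ?case using assms(1,2) by (simp add: artin_hom_def artin_word_Nil)
  next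
    case (Cons i w)
    have "artin_word I' M' [i] \<in> carrier (artin_monoid I' M')" "artin_word I' M' w \<in> carrier (artin_monoid I' M')"
      using Cons.hyps unfolding carrier_artin_monoid by (auto intro!: imageI)
    then show ?case unfolding artin_word_Cons[OF Cons.hyps(1,2)]
      using assms(1,2) assms(3)[OF Cons.hyps(1)] Cons.IH unfolding artin_hom_def by (metis hom_mult)
  qed
  ultimately show ?thesis by simp
qed

lemma side_letters_far:
  assumes "i \<in> side_letters a b n e" "j \<in> side_letters a b n e" "a < b"
  shows "i = j \<or> far i j"
proof -
  consider "i < a" "j < a" "even (a - i + e)" "even (a - j + e)" | "b < i" "b < j" "even (i - b + e)" "even (j - b + e)"
    | "i < a" "b < j" | "b < i" "j < a"
  proof -
    have "k < a \<and> even (a - k + e) \<or> b < k \<and> even (k - b + e)" if "k \<in> side_letters a b n e" for k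
    proof -
      have "k \<in> {1..<a} \<and> even (a - k + e) \<or> k \<in> {Suc b..n} \<and> even (k - b + e)"
        using that unfolding side_letters_def by blast
      then show ?thesis by (elim disjE conjE) simp_all
    qed
    from this[OF assms(1)] this[OF assms(2)] show ?thesis by (elim disjE conjE) (rule that; assumption)+
  qed
  then show ?thesis
  proof cases
    case 1
    then have "i \<noteq> Suc j" "j \<noteq> Suc i" by presburger+
    then show ?thesis by (auto simp: far_def)
  next
    case 2
    then have "i \<noteq> Suc j" "j \<noteq> Suc i" by presburger+
    then show ?thesis by (auto simp: far_def)
  qed (use assms(3) in \<open>auto simp: far_def\<close>)
qed

lemma br_side_letters:
  assumes "set w = side_letters a b n e" "distinct w" "a < b" "finite J"
    and "\<And>i j. i \<in> side_letters a b n e \<Longrightarrow> j \<in> J \<Longrightarrow> far i j"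
  shows "half_twist (J \<union> side_letters a b n e) = half_twist J * br w"
proof -
  have "half_twist (J \<union> set w) = half_twist J * br w"
  proof (rule half_twist_Un_far)
    show "J \<inter> set w = {}" using assms(1,5) by (force simp: far_def)
    fix i j assume "i \<in> set w" "j \<in> J \<union> set w"
    then show "i = j \<or> far i j" using assms(1,5) side_letters_far[OF _ _ assms(3)] by blast
  qed (use assms in auto)
  then show ?thesis by (simp only: assms(1))
qed

lemma br_concat_alternating_double:
  "br (concat (map f (alternating (2 * k) i j))) = (br (f i) * br (f j)) ^ k"
  by (induction k) (simp_all add: br_append mult.assoc)

text \<open>The relation follows by cancelling the power of the half twist of the band. For
  parabolicity, deleting the first factor from one of the two powers leaves a complement of
  \<open>JX\<close> or \<open>JY\<close>, just as deleting the first letter of the longest dihedral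
  word leaves the lift belonging to that letter.\<close>

lemma parabolic_hom_I2_A:
  fixes X Y :: "nat list"
  assumes ab: "1 \<le> a" "a < b" "b \<le> n" and m: "1 \<le> m" and e: "e = 1 \<or> e = 2"
    and X: "set X \<subseteq> {1..n}" and Y: "set Y \<subseteq> {1..n}" and XY: "set X \<union> set Y = {1..n}"
    and xy: "half_twist {Suc a..<b} ^ e * (br X * br Y) ^ m = half_twist {1..n} ^ e"
    and yx: "half_twist {Suc a..<b} ^ e * (br Y * br X) ^ m = half_twist {1..n} ^ e"
    and JX: "JX \<subseteq> {1..n}" "half_twist JX = half_twist {Suc a..<b} * br X"
    and JY: "JY \<subseteq> {1..n}" "half_twist JY = half_twist {Suc a..<b} * br Y"
  obtains \<Phi> where "parabolic_hom {1, 2} (coxeter_I2 (2 * m)) {1..n} coxeter_A \<Phi>"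
    "\<Phi> (artin_word {1, 2} (coxeter_I2 (2 * m)) [1]) = artin_word {1..n} coxeter_A X"
    "\<Phi> (artin_word {1, 2} (coxeter_I2 (2 * m)) [2]) = artin_word {1..n} coxeter_A Y"
proof -
  let ?I' = "{1, 2 :: nat}" and ?M' = "coxeter_I2 (2 * m)" and ?I = "{1..n}"
  let ?P = "parabolic_submonoid ?I coxeter_A ?I"
  define f where "f i = (if i = 1 then X else Y)" for i :: nat
  have f: "f 1 = X" "f 2 = Y" by (simp_all add: f_def)
  have fI: "f i \<in> lists ?I" for i using X Y by (auto simp: f_def)
  have F: "concat (map f w) \<in> lists ?I" for w
  proof (induction w)
    case (Cons i w)
    then show ?case using fI[of i] by simp
  qed simp
  have pow: "(br X * br Y) ^ m = (br Y * br X) ^ m"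
    using xy yx by (metis braid_mult_left_cancel)
  have rels: "(concat (map f x), concat (map f y)) \<in> artin_cong ?I coxeter_A"
    if "(x, y) \<in> artin_rels ?I' ?M'" for x y
  proof -
    obtain i j k where ij: "x = alternating k i j" "y = alternating k j i" "i \<in> ?I'" "j \<in> ?I'" "i \<noteq> j"
      "?M' i j = enat k" using \<open>(x, y) \<in> artin_rels ?I' ?M'\<close> unfolding artin_rels_def by blast
    have k: "k = 2 * m" using ij(5,6) by (simp add: coxeter_I2_def)
    have "i = 1 \<and> j = 2 \<or> i = 2 \<and> j = 1" using ij(3-5) by auto
    then have "br (concat (map f x)) = br (concat (map f y))"
      unfolding ij(1,2) k br_concat_alternating_double using f pow by auto
    then show ?thesis using F artin_word_A_eq_iff artin_word_eq_iff by metis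
  qed
  obtain \<Phi> where \<Phi>: "artin_hom ?I' ?M' ?I coxeter_A \<Phi>"
    "\<And>w. w \<in> lists ?I' \<Longrightarrow> \<Phi> (artin_word ?I' ?M' w) = artin_word ?I coxeter_A (concat (map f w))"
    using ex_artin_hom[where f = f and I = ?I and I' = ?I' and M = coxeter_A and M' = ?M', OF fI rels] by blast
  have XY': "\<Phi> (artin_word ?I' ?M' [1]) = artin_word ?I coxeter_A X"
    "\<Phi> (artin_word ?I' ?M' [2]) = artin_word ?I coxeter_A Y"
    using \<Phi>(2)[of "[1]"] \<Phi>(2)[of "[2]"] f by simp_all
  have supp: "(\<Union>i\<in>?I'. artin_support (\<Phi> (artin_word ?I' ?M' [i]))) = ?I"
  proof -
    have "artin_support (artin_word ?I coxeter_A X) = set X" "artin_support (artin_word ?I coxeter_A Y) = set Y"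
      using X Y by (auto intro!: artin_support_A)
    then show ?thesis unfolding UN_insert UN_empty Un_empty_right XY' using XY by simp
  qed
  have P_one: "\<one>\<^bsub>artin_monoid ?I coxeter_A\<^esub> \<in> ?P"
    unfolding parabolic_submonoid_def by (rule submonoid_hull_one)
  have P_mult: "x \<otimes>\<^bsub>artin_monoid ?I coxeter_A\<^esub> y \<in> ?P" if "x \<in> ?P" "y \<in> ?P" for x y
    using that unfolding parabolic_submonoid_def by (rule submonoid_hull_mult)
  note power = parabolic_A_power[where p = "Suc a" and q = b and n = n and e = e]
  have gen: "\<Phi> (artin_word ?I' ?M' w) \<in> ?P"
    if w: "w \<in> {[], alternating (2 * m) 1 2, alternating (2 * m - 1) 1 2, alternating (2 * m - 1) 2 1}" for w
  proof -
    let ?U = "concat (map f w)"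
    have U: "set ?U \<subseteq> ?I" using F[of w] by auto
    have S: "alternating (2 * m) i j = i # alternating (2 * m - 1) j i" for i j :: nat
    proof -
      have "alternating (Suc (2 * m - 1)) i j = i # alternating (2 * m - 1) j i" by simp
      then show ?thesis using m by simp
    qed
    have SY: "br Y * br (concat (map f (alternating (2 * m - 1) 1 2))) = (br Y * br X) ^ m"
      using br_concat_alternating_double[of f m 2 1] unfolding S[of 2 1] by (simp add: br_append f_def)
    have SX: "br X * br (concat (map f (alternating (2 * m - 1) 2 1))) = (br X * br Y) ^ m"
      using br_concat_alternating_double[of f m 1 2] unfolding S[of 1 2] by (simp add: br_append f_def)
    have wl: "w \<in> lists ?I'"
      using w alternating_lists[of 1 ?I' 2] alternating_lists[of 2 ?I' 1] by auto
    consider "w = []" | "w = alternating (2 * m) 1 2" | "w = alternating (2 * m - 1) 1 2" | "w = alternating (2 * m - 1) 2 1"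
      using w by blast
    then have "artin_word ?I coxeter_A ?U \<in> ?P"
    proof cases
      case 1
      then show ?thesis using P_one by (simp add: artin_word_Nil)
    next
      case 2
      then have "br ?U = (br X * br Y) ^ m" using br_concat_alternating_double[of f m 1 2] by (simp add: f_def)
      \<comment> \<open>The full power completes the band itself, without a leading factor.\<close>
      then show ?thesis using ab e U xy
        by (intro power[where J = "{Suc a..<b}" and s = 1]) auto
    next
      case 3
      then show ?thesis using ab e U yx SY JY
        by (intro power[where J = JY and s = "br Y"]) auto
    next
      case 4
      then show ?thesis using ab e U xy SX JX
        by (intro power[where J = JX and s = "br X"]) auto
    qed
    then show ?thesis using \<Phi>(2)[OF wl] by simp
  qed
  \<comment> \<open>The preimage of the target is a submonoid, so parabolicity only has to be
    checked on the generating lifts.\<close>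
  have sub: "submonoid {x \<in> carrier (artin_monoid ?I' ?M'). \<Phi> x \<in> ?P} (artin_monoid ?I' ?M')"
  proof -
    interpret D: monoid "artin_monoid ?I' ?M'" by (rule monoid_artin_monoid)
    have hom: "\<Phi> \<in> hom (artin_monoid ?I' ?M') (artin_monoid ?I coxeter_A)"
      "\<Phi> \<one>\<^bsub>artin_monoid ?I' ?M'\<^esub> = \<one>\<^bsub>artin_monoid ?I coxeter_A\<^esub>"
      using \<Phi>(1) unfolding artin_hom_def by blast+
    show ?thesis
    proof
      show "x \<otimes>\<^bsub>artin_monoid ?I' ?M'\<^esub> y \<in> {x \<in> carrier (artin_monoid ?I' ?M'). \<Phi> x \<in> ?P}"
        if "x \<in> {x \<in> carrier (artin_monoid ?I' ?M'). \<Phi> x \<in> ?P}"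
          "y \<in> {x \<in> carrier (artin_monoid ?I' ?M'). \<Phi> x \<in> ?P}" for x y
      proof -
        have xy: "x \<in> carrier (artin_monoid ?I' ?M')" "y \<in> carrier (artin_monoid ?I' ?M')"
          "\<Phi> x \<in> ?P" "\<Phi> y \<in> ?P" using that by blast+
        then have "\<Phi> (x \<otimes>\<^bsub>artin_monoid ?I' ?M'\<^esub> y) \<in> ?P"
          using hom_mult[OF hom(1) xy(1,2)] P_mult by metis
        then show ?thesis using D.m_closed[OF xy(1,2)] by blast
      qed
      have "\<Phi> \<one>\<^bsub>artin_monoid ?I' ?M'\<^esub> \<in> ?P" unfolding hom(2) by (rule P_one)
      then show "\<one>\<^bsub>artin_monoid ?I' ?M'\<^esub> \<in> {x \<in> carrier (artin_monoid ?I' ?M'). \<Phi> x \<in> ?P}"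
        using D.one_closed by blast
    qed blast
  qed
  have "{artin_lift ?I' ?M' (rel_longest_element ?I' ?M' J C) | J C. C \<in> coxeter_components ?M' ?I' \<and> J \<subseteq> C}
      \<subseteq> {x \<in> carrier (artin_monoid ?I' ?M'). \<Phi> x \<in> ?P}"
  proof safe
    fix J C assume "C \<in> coxeter_components ?M' ?I'" "J \<subseteq> C"
    from artin_lift_rel_longest_I2[OF m HOL.refl this] obtain w where
      w: "w \<in> {[], alternating (2 * m) 1 2, alternating (2 * m - 1) 1 2, alternating (2 * m - 1) 2 1}"
      and eq: "artin_lift ?I' ?M' (rel_longest_element ?I' ?M' J C) = artin_word ?I' ?M' w" by blast
    show "\<Phi> (artin_lift ?I' ?M' (rel_longest_element ?I' ?M' J C)) \<in> ?P" unfolding eq by (rule gen[OF w])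
    have "w \<in> lists ?I'"
      using w alternating_lists[of 1 ?I' 2] alternating_lists[of 2 ?I' 1] by auto
    then show "artin_lift ?I' ?M' (rel_longest_element ?I' ?M' J C) \<in> carrier (artin_monoid ?I' ?M')"
      unfolding eq carrier_artin_monoid by (rule imageI)
  qed
  then have "parabolic_submonoid ?I' ?M' ?I' \<subseteq> {x \<in> carrier (artin_monoid ?I' ?M'). \<Phi> x \<in> ?P}"
    unfolding parabolic_submonoid_def[of ?I' ?M'] using sub by (rule hull_minimal)
  then have "parabolic_hom ?I' ?M' ?I coxeter_A \<Phi>"
    unfolding parabolic_hom_def supp using \<Phi>(1) finite_type_A[of ?I] finite_type_I2[OF m HOL.refl] by blast
  then show ?thesis using that XY' by blast
qed

text \<open>That the assignments define a homomorphism is expressed by existence together with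
  uniqueness on the carrier, as values elsewhere are arbitrary.\<close>

theorem theorem1p7:
  fixes a b n m :: nat
  assumes "1 \<le> a" "a < b" "b \<le> n"
    and "m = n - b + 1 + (1 - (if a + b = n + 1 then 1 else 0)) * a"
  shows "\<exists>\<Phi>. parabolic_hom {1, 2} (coxeter_I2 (2 * m)) {1..n} coxeter_A \<Phi> \<and>
      \<Phi> (artin_word {1, 2} (coxeter_I2 (2 * m)) [1]) =
        artin_word {1..n} coxeter_A
          ([a..<b] @ [b] @ rev [a..<b]
            @ rev [i \<leftarrow> [1..<a]. even (a - i)] @ [i \<leftarrow> [b + 1..<n + 1]. even (i - b)]) \<and>
      \<Phi> (artin_word {1, 2} (coxeter_I2 (2 * m)) [2]) =
        artin_word {1..n} coxeter_A
          (rev [i \<leftarrow> [1..<a]. odd (a - i)] @ [i \<leftarrow> [b + 1..<n + 1]. odd (i - b)]) \<and>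
      (\<forall>\<Psi>. artin_hom {1, 2} (coxeter_I2 (2 * m)) {1..n} coxeter_A \<Psi> \<and>
          \<Psi> (artin_word {1, 2} (coxeter_I2 (2 * m)) [1])
            = \<Phi> (artin_word {1, 2} (coxeter_I2 (2 * m)) [1]) \<and>
          \<Psi> (artin_word {1, 2} (coxeter_I2 (2 * m)) [2])
            = \<Phi> (artin_word {1, 2} (coxeter_I2 (2 * m)) [2])
        \<longrightarrow> (\<forall>x\<in>carrier (artin_monoid {1, 2} (coxeter_I2 (2 * m))). \<Psi> x = \<Phi> x))"
proof -
  let ?Z = "rev [i \<leftarrow> [1..<a]. even (a - i)] @ [i \<leftarrow> [b + 1..<n + 1]. even (i - b)]"
  let ?X = "[a..<b] @ [b] @ rev [a..<b] @ ?Z"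
  let ?Y = "rev [i \<leftarrow> [1..<a]. odd (a - i)] @ [i \<leftarrow> [b + 1..<n + 1]. odd (i - b)]"
  let ?J = "{Suc a..<b}"
  let ?e = "if a + b = Suc n then 1 else 2 :: nat"
  have X0: "set ?Z = side_letters a b n 0" "distinct ?Z"
    using assms(2) by (auto simp: side_letters_def)
  have Y: "set ?Y = side_letters a b n 1" "distinct ?Y"
    using assms(2) by (auto simp: side_letters_def)
  have x0: "br ?Z = half_twist (side_letters a b n 0)"
    using br_side_letters[OF X0 assms(2), of "{}"] by simp
  have x: "br ?X = bounce a b * half_twist (side_letters a b n 0)"
    unfolding bounce_def x0[symmetric] by (simp only: br_append mult.assoc)
  have y: "br ?Y = half_twist (side_letters a b n 1)"
    using br_side_letters[OF Y assms(2), of "{}"] by simp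
  \<comment> \<open>For \<open>a + b = n + 1\<close> the remaining summand \<open>n - b + 1\<close>
    is \<open>a\<close>.\<close>
  have m: "m = (if a + b = Suc n then a else Suc n - b + a)" "1 \<le> m"
    using assms by auto
  have K: "{1..<Suc n} = {1..n}" by auto
  note pow = bounce_alternating_power[OF assms(1-3), folded m(1) x y, unfolded K]
  \<comment> \<open>The letters \<open>a - 1\<close> and \<open>b + 1\<close> are at odd distance
    from the band, so everything in this colour class is at least two steps away from
    \<open>{a..b}\<close>.\<close>
  have sideX: "far i j" if "i \<in> side_letters a b n 0" "j \<in> {a..<Suc b}" for i j
  proof -
    have "i \<noteq> a - 1" "i \<noteq> Suc b" "i < a \<or> b < i"
      using that(1) assms(2) by (auto simp: side_letters_def)
    then show ?thesis using that(2) by (auto simp: far_def)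
  qed
  have sideY: "far i j" if "i \<in> side_letters a b n 1" "j \<in> ?J" for i j
    using that by (auto simp: side_letters_def far_def)
  have JX: "half_twist ({a..<Suc b} \<union> side_letters a b n 0) = half_twist ?J * br ?X"
  proof -
    have "half_twist ({a..<Suc b} \<union> side_letters a b n 0) = half_twist {a..<Suc b} * br ?Z"
      using sideX by (intro br_side_letters[OF X0 assms(2)]) auto
    then show ?thesis unfolding x x0 half_twist_bounce[OF assms(2)] by (simp only: mult.assoc)
  qed
  have JY: "half_twist (?J \<union> side_letters a b n 1) = half_twist ?J * br ?Y"
    using sideY by (intro br_side_letters[OF Y assms(2)]) auto
  have sub: "side_letters a b n e \<subseteq> {1..n}" for e using assms(2,3) by (auto simp: side_letters_def)
  have cover: "set ?X \<union> set ?Y = {1..n}"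
  proof -
    have "side_letters a b n 0 \<union> side_letters a b n 1 \<union> {a..b} = {1..n}"
      using assms(1-3) by (auto simp: side_letters_def)
    moreover have "set ?X = {a..b} \<union> side_letters a b n 0"
      unfolding X0(1)[symmetric] using assms(2) by auto
    ultimately show ?thesis using Y(1) by blast
  qed
  obtain \<Phi> where \<Phi>: "parabolic_hom {1, 2} (coxeter_I2 (2 * m)) {1..n} coxeter_A \<Phi>"
    "\<Phi> (artin_word {1, 2} (coxeter_I2 (2 * m)) [1]) = artin_word {1..n} coxeter_A ?X"
    "\<Phi> (artin_word {1, 2} (coxeter_I2 (2 * m)) [2]) = artin_word {1..n} coxeter_A ?Y"
  proof (rule parabolic_hom_I2_A[OF assms(1-3) m(2) _ _ _ cover pow])
    show "?e = 1 \<or> ?e = 2" by simp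
    show "set ?X \<subseteq> {1..n}" "set ?Y \<subseteq> {1..n}" using cover by blast+
    show "half_twist ({a..<Suc b} \<union> side_letters a b n 0) = half_twist ?J * br ?X" by (fact JX)
    show "half_twist (?J \<union> side_letters a b n 1) = half_twist ?J * br ?Y" by (fact JY)
    show "{a..<Suc b} \<union> side_letters a b n 0 \<subseteq> {1..n}" "?J \<union> side_letters a b n 1 \<subseteq> {1..n}"
      using sub assms(1-3) by auto
  qed
  have "\<Psi> z = \<Phi> z"
    if "artin_hom {1, 2} (coxeter_I2 (2 * m)) {1..n} coxeter_A \<Psi>"
      "\<Psi> (artin_word {1, 2} (coxeter_I2 (2 * m)) [1]) = \<Phi> (artin_word {1, 2} (coxeter_I2 (2 * m)) [1])"
      "\<Psi> (artin_word {1, 2} (coxeter_I2 (2 * m)) [2]) = \<Phi> (artin_word {1, 2} (coxeter_I2 (2 * m)) [2])"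
      "z \<in> carrier (artin_monoid {1, 2} (coxeter_I2 (2 * m)))" for \<Psi> z
    using \<Phi>(1) that unfolding parabolic_hom_def by (intro artin_hom_unique[OF _ that(1) _ that(4)]) auto
  then show ?thesis using \<Phi> by blast
qed

end
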